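(* Let $n\ge 1$ and let $\mu$ be a Borel probability measure on $[0,1]^n\subset M_{1,n}=\mathbb R^n$ with local maximal dimension. If $\mu$ is Federer, then $\mathrm{DT}(1,n)$ cannot be improved for $\mu$-almost every element; that is, for $\mu$-a.e. $Y\in[0,1]^n$ and every $0<\sigma<1$ one has $Y\notin \mathrm{DI}_\sigma(1,n)$.
   Context: $\|\cdot\|$ is the sup norm on $\mathbb R^k$; $B_s(x)$ is the ball of radius $s$ centered at $x$ in this norm. Local maximal dimension: a probability measure $\mu$ on $J=[0,1]^k$ has local maximal dimension if there exists $s_0>0$ such that for every $\epsilon>0$ there is a constant $C_\epsilon>0$ with $\mu(B_{\delta s}(x))\le C_\epsilon\,\delta^{k-\epsilon}\mu(B_s(x))$ for all $0<\delta<1$, $0<s\le s_0$, $x\in J$. (Here $k=n$.) Federer: let $B(x,r)$ be the open Euclidean ball. A Radon measure $\mu$ on $\mathbb R^n$ is Federer on an open set $U$ if there exist $c,\beta>0$ such that for all $x\in\mathrm{supp}(\mu)\cap U$ and all $0<\delta\le s$ with $B(x,s)\subset U$ one has $\mu(B(x,\delta))\ge c(\delta/s)^\beta\mu(B(x,s))$. $\mu$ is Federer if for $\mu$-a.e. $x$ there is a neighborhood $U$ of $x$ such that $\mu$ is Federer on $U$. A measure on $[0,1]^n$ is called Federer if it is so as a measure on $\mathbb R^n$. Improvability of Dirichlet's theorem: $M_{m,n}=\mathbb R^{mn}$ is the space of real $m\times n$ matrices. For $0<\sigma<1$, $\mathrm{DI}_\sigma(m,n)$ is the set of $Y\in M_{m,n}$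 such that for every sufficiently large positive integer $N$ there exist $\mathbf q\in\mathbb Z^m\setminus\{0\}$ and $\mathbf p\in\mathbb Z^n$ (row vectors) with $\|\mathbf qY+\mathbf p\|\le \sigma/N^m$ and $\|\mathbf q\|\le\sigma N^n$. $\mathrm{DT}(m,n)$ can be improved for $Y$ if $Y\in\mathrm{DI}_\sigma(m,n)$ for some $0<\sigma<1$. *)

theory Defs
  imports "HOL-Analysis.Analysis" "HOL-Probability.Probability_Measure"
begin

(* The library's infnorm on real ^ 'k is the sup norm max_i |x $ i|; balls in this norm are taken
   open.  With closed balls one gets the same notion of local maximal dimension. *)

definition sup_ball :: "real ^ 'k \<Rightarrow> real \<Rightarrow> (real ^ 'k) set" where
  "sup_ball x s = {y. infnorm (y - x) < s}"

definition unit_cube :: "(real ^ 'k) set" where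
  "unit_cube = {x. \<forall>i. 0 \<le> x $ i \<and> x $ i \<le> 1}"

definition local_maximal_dimension :: "(real ^ 'k) measure \<Rightarrow> bool" where
  "local_maximal_dimension \<mu> \<longleftrightarrow>
     (\<exists>s0>0. \<forall>\<epsilon>>0. \<exists>C>0. \<forall>\<delta> s x. 0 < \<delta> \<and> \<delta> < 1 \<and> 0 < s \<and> s \<le> s0 \<and> x \<in> unit_cube \<longrightarrow>
        measure \<mu> (sup_ball x (\<delta> * s))
          \<le> C * \<delta> powr (real CARD('k) - \<epsilon>) * measure \<mu> (sup_ball x s))"

definition measure_support :: "'a :: topological_space measure \<Rightarrow> 'a set" where
  "measure_support \<mu> = {x. \<forall>V. open V \<and> x \<in> V \<longrightarrow> 0 < emeasure \<mu> V}"

(* Meant for Radon measures, for which all the balls below have finite measure, so that the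
   real-valued measure is the right one.  Here ball is the open Euclidean ball. *)

definition federer_on :: "(real ^ 'n) measure \<Rightarrow> (real ^ 'n) set \<Rightarrow> bool" where
  "federer_on \<mu> U \<longleftrightarrow>
     (\<exists>c>0. \<exists>\<beta>>0. \<forall>x \<in> measure_support \<mu> \<inter> U. \<forall>\<delta> s.
        0 < \<delta> \<and> \<delta> \<le> s \<and> ball x s \<subseteq> U \<longrightarrow>
        measure \<mu> (ball x \<delta>) \<ge> c * (\<delta> / s) powr \<beta> * measure \<mu> (ball x s))"

definition federer :: "(real ^ 'n) measure \<Rightarrow> bool" where
  "federer \<mu> \<longleftrightarrow> (AE x in \<mu>. \<exists>U. open U \<and> x \<in> U \<and> federer_on \<mu> U)"

(* real ^ 'n ^ 'm is the type of real matrices with m = CARD('m) rows and n = CARD('n) columns,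
   and q v* Y is the row vector q times Y.  Integer vectors are real vectors with integer
   coordinates. *)

definition DI :: "real \<Rightarrow> (real ^ 'n ^ 'm) set" where
  "DI \<sigma> = {Y. \<forall>\<^sub>F N in sequentially. \<exists>(q :: real ^ 'm) (p :: real ^ 'n).
      (\<forall>i. q $ i \<in> \<int>) \<and> q \<noteq> 0 \<and> (\<forall>j. p $ j \<in> \<int>) \<and>
      infnorm (q v* Y + p) \<le> \<sigma> / real N ^ CARD('m) \<and>
      infnorm q \<le> \<sigma> * real N ^ CARD('n)}"

definition DT_improvable :: "real ^ 'n ^ 'm \<Rightarrow> bool" where
  "DT_improvable Y \<longleftrightarrow> (\<exists>\<sigma>. 0 < \<sigma> \<and> \<sigma> < 1 \<and> Y \<in> DI \<sigma>)"

end

theory Submission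
  imports Defs
begin

text \<open>
  Let n be the dimension and call Y non-divergent at scale N if (p, q) = 0 is the only integral
  solution of |p + q Y| \<le> \<epsilon> / N, |q| \<le> \<epsilon> N^n; equivalently, the unimodular lattice attached to Y and N
  has no nonzero vector of sup norm at most \<epsilon>. Changing Y by N^-(n+1) changes this lattice by a bounded
  amount, so N^-(n+1) is the length that belongs to the scale N. Fix \<sigma> < 1 and N0, and let E be the
  set of points of the cube at which Dirichlet's system with constant \<sigma> is solvable for all N \<ge> N0.
  Countably many such sets E contain all improvable points, so it suffices that each is null
  (improvable_from_null). Three facts give this.

  Holes (hole_exists). If Y is non-divergent at scale N, and N \<ge> N0, then some ball of radius
  \<eta> N^-(n+1) with center at distance at most N^-(n+1) / 4 from Y misses E, where \<eta> depends on n, \<epsilon> and \<sigma> only. Indeed the dual lattice,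
  formed by the integral affine forms a . Y + b, has no short vector either, and hence a bounded covering radius.
  So there are n integral forms that are close to T times the coordinate forms and extend
  to a basis of all integral forms. Let Y' be their common zero. Being part of a basis, the forms identify
  Z^n + Z Y' with a lattice that is almost cubic of mesh 1/(T N), so the denominator
  of Y' is almost (T N)^n. For q below the denominator, q Y' stays at distance almost 1/(T N) from
  the integral points: at Y', and then near Y', Dirichlet's theorem cannot be improved for T N.

  Non-divergence (nondivergence). The set of points that are divergent at scale N has small measure if
  \<epsilon> is small, uniformly in N. Rational points with denominators about Q that lie in a common ball of
  radius c Q^-(1+1/n) lie on one hyperplane, and local maximal dimension bounds the measure of
  a thin neighbourhood of a hyperplane by a power of its relative width. Summing over dyadic Q gives the claim.

  Counting. If E had positive measure, a part of E of positive measure would be non-divergent at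
  half of the scales b^l, N0 \<le> l < N0 + 2s, for every s. In the tree of grid cubes each such scale costs
  a cube one of its B children, so that this part is covered by a constant times (1 - 1/B)^s B^(2s) cubes
  of the last generation (tree_count). Local maximal dimension bounds the measure of each of them, up to a constant,
  by its volume to the power 1 - e/n with e as small as desired, so the total tends to 0 with s: a contradiction.
\<close>

section \<open>Dirichlet's theorem for weighted boxes\<close>

definition int_vecs :: "(real ^ 'n) set" where
  "int_vecs = {v. \<forall>i. v $ i \<in> \<int>}"

lemma int_vecs_diff: "u \<in> int_vecs \<Longrightarrow> v \<in> int_vecs \<Longrightarrow> u - v \<in> int_vecs"
  by (auto simp: int_vecs_def)

lemma int_vecs_inner: "u \<in> int_vecs \<Longrightarrow> v \<in> int_vecs \<Longrightarrow> u \<bullet> v \<in> \<int>"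
  by (auto simp: int_vecs_def inner_vec_def)

lemma same_cell_dist:
  fixes x y \<delta> :: real and k :: nat
  assumes "0 < k" "1 / real k \<le> \<delta>"
    and "\<lfloor>frac x * k\<rfloor> = \<lfloor>frac y * k\<rfloor>"
  shows "\<bar>frac x - frac y\<bar> \<le> \<delta>"
proof -
  have "\<bar>frac x * k - frac y * k\<bar> < 1"
    using assms(3) by linarith
  then have "\<bar>frac x - frac y\<bar> * k < 1"
    using assms(1) by (metis abs_mult abs_of_nat left_diff_distrib)
  then have "\<bar>frac x - frac y\<bar> < 1 / k"
    using assms(1) by (simp add: field_simps)
  then show ?thesis using assms(2) by linarith
qed

lemma frac_cell_less:
  fixes x :: real and k :: nat
  assumes "0 < k"
  shows "nat \<lfloor>frac x * k\<rfloor> < k"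
proof -
  have "frac x * k < k" using assms frac_lt_1[of x] by simp
  then have "\<lfloor>frac x * k\<rfloor> < int k" by linarith
  then show ?thesis using assms by (simp add: nat_less_iff)
qed

lemma cells_bound:
  fixes \<beta> :: real
  assumes "0 < \<beta>" "\<beta> \<le> 1"
  shows "0 < nat \<lceil>1 / \<beta>\<rceil>" "1 / real (nat \<lceil>1 / \<beta>\<rceil>) \<le> \<beta>" "real (nat \<lceil>1 / \<beta>\<rceil>) \<le> 2 / \<beta>"
    "real (nat \<lceil>1 / \<beta>\<rceil>) < 1 / \<beta> + 1"
proof -
  have g: "1 \<le> 1 / \<beta>" using assms by simp
  then show 1: "0 < nat \<lceil>1 / \<beta>\<rceil>" by linarith
  have 2: "1 / \<beta> \<le> real (nat \<lceil>1 / \<beta>\<rceil>)" by linarith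
  then show "1 / real (nat \<lceil>1 / \<beta>\<rceil>) \<le> \<beta>"
    using 1 assms(1) by (metis mult.commute of_nat_0_less_iff pos_divide_le_eq)
  show 3: "real (nat \<lceil>1 / \<beta>\<rceil>) < 1 / \<beta> + 1" using g by linarith
  then show "real (nat \<lceil>1 / \<beta>\<rceil>) \<le> 2 / \<beta>" using g by (simp add: field_simps)
qed

text \<open>
  Pigeonhole principle: the fractional parts of q Y for 0 \<le> q \<le> \<gamma> fall into about the product of all
  1 / \<beta> i cells. The constant 2^n absorbs the rounding of the numbers of cells. If some \<beta> i is at least 1,
  a unit vector with q = 0 is a solution.
\<close>
lemma dirichlet_simultaneous:
  fixes Y :: "real ^ 'n" and \<beta> :: "'n \<Rightarrow> real"
  assumes pos: "\<And>i. 0 < \<beta> i" and prod: "2 ^ CARD('n) \<le> \<gamma> * (\<Prod>i\<in>UNIV. \<beta> i)"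
  obtains p q where "p \<in> int_vecs" "q \<in> \<int>" "p \<noteq> 0 \<or> q \<noteq> 0"
    "\<bar>q\<bar> \<le> \<gamma>" "\<And>i. \<bar>p $ i + q * Y $ i\<bar> \<le> \<beta> i"
proof -
  have P0: "0 < (\<Prod>i\<in>UNIV. \<beta> i)" using pos by (simp add: prod_pos)
  have "0 < \<gamma> * (\<Prod>i\<in>UNIV. \<beta> i)"
    by (rule less_le_trans[OF _ prod]) simp
  then have g0: "0 < \<gamma>"
    using P0 by (simp add: zero_less_mult_iff)
  show thesis
  proof (cases "\<exists>i. 1 \<le> \<beta> i")
    case True
    then obtain i where i: "1 \<le> \<beta> i" by blast
    show thesis
    proof (rule that[of "axis i 1" 0])
      show "\<bar>axis i 1 $ j + 0 * Y $ j\<bar> \<le> \<beta> j" for j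
        using i pos[of j] by (auto simp: axis_def)
      show "axis i (1::real) \<noteq> 0 \<or> (0::real) \<noteq> 0" by simp
      show "axis i 1 \<in> int_vecs" by (auto simp: int_vecs_def axis_def)
    qed (use g0 in auto)
  next
    case False
    define k where "k i = nat \<lceil>1 / \<beta> i\<rceil>" for i
    have k: "0 < k i" "1 / real (k i) \<le> \<beta> i" "real (k i) \<le> 2 / \<beta> i" for i
      using cells_bound[OF pos, of i] False unfolding k_def by (simp_all add: not_le less_imp_le)
    define h where "h q = (\<lambda>i. nat \<lfloor>frac (real q * Y $ i) * k i\<rfloor>)" for q :: nat
    let ?C = "PiE (UNIV :: 'n set) (\<lambda>i. {..<k i})"
    have "real (card ?C) = (\<Prod>i\<in>UNIV. real (k i))" by (simp add: card_PiE)
    also have "\<dots> \<le> (\<Prod>i\<in>UNIV. 2 / \<beta> i)" using k by (intro prod_mono) auto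
    also have "\<dots> = 2 ^ CARD('n) / (\<Prod>i\<in>UNIV. \<beta> i)" by (simp add: prod_dividef)
    also have "\<dots> \<le> \<gamma>" using prod P0 by (simp add: field_simps)
    finally have "card ?C < card {..nat \<lfloor>\<gamma>\<rfloor>}" using g0 by simp linarith
    moreover have "h ` {..nat \<lfloor>\<gamma>\<rfloor>} \<subseteq> ?C"
      using frac_cell_less[OF k(1)] by (auto simp: h_def PiE_def)
    ultimately have "\<not> inj_on h {..nat \<lfloor>\<gamma>\<rfloor>}"
      using card_inj_on_le[of h "{..nat \<lfloor>\<gamma>\<rfloor>}" ?C] by (auto simp: finite_PiE)
    then obtain q1 q2 where q: "q1 \<le> nat \<lfloor>\<gamma>\<rfloor>" "q2 \<le> nat \<lfloor>\<gamma>\<rfloor>" "q1 \<noteq> q2" "h q1 = h q2"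
      by (auto simp: inj_on_def)
    show thesis
    proof (rule that[of "\<chi> i. of_int (\<lfloor>real q2 * Y $ i\<rfloor> - \<lfloor>real q1 * Y $ i\<rfloor>)" "real q1 - real q2"])
      fix i
      have "\<lfloor>frac (real q1 * Y $ i) * k i\<rfloor> = \<lfloor>frac (real q2 * Y $ i) * k i\<rfloor>"
        using fun_cong[OF q(4), of i] unfolding h_def by (subst (asm) eq_nat_nat_iff) auto
      from same_cell_dist[OF k(1,2) this]
      show "\<bar>(\<chi> i. of_int (\<lfloor>real q2 * Y $ i\<rfloor> - \<lfloor>real q1 * Y $ i\<rfloor>)) $ i + (real q1 - real q2) * Y $ i\<bar> \<le> \<beta> i"
        by (simp add: frac_def algebra_simps)
    next
      show "\<bar>real q1 - real q2\<bar> \<le> \<gamma>" using q g0 by linarith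
    qed (use q in \<open>auto simp: int_vecs_def\<close>)
  qed
qed

text \<open>
  The dual pigeonhole argument, on the fractional parts of a . Y for a in a box.
\<close>
lemma dirichlet_form:
  fixes Y :: "real ^ 'n" and \<beta> :: "'n \<Rightarrow> real"
  assumes pos: "\<And>i. 0 < \<beta> i" "0 < \<gamma>" and prod: "2 \<le> \<gamma> * (\<Prod>i\<in>UNIV. \<beta> i)"
  obtains a b where "a \<in> int_vecs" "b \<in> \<int>" "a \<noteq> 0 \<or> b \<noteq> 0"
    "\<And>i. \<bar>a $ i\<bar> \<le> \<beta> i" "\<bar>a \<bullet> Y + b\<bar> \<le> \<gamma>"
proof (cases "1 \<le> \<gamma>")
  case True
  show thesis
    by (rule that[of 0 1]) (use True pos in \<open>auto simp: int_vecs_def less_imp_le\<close>)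
next
  case False
  define k where "k = nat \<lceil>1 / \<gamma>\<rceil>"
  have k: "0 < k" "1 / real k \<le> \<gamma>" "real k < 1 / \<gamma> + 1"
    using cells_bound[OF pos(2)] False unfolding k_def by simp_all
  define v where "v u = (\<chi> i. real (u i))" for u :: "'n \<Rightarrow> nat"
  define h where "h u = nat \<lfloor>frac (v u \<bullet> Y) * k\<rfloor>" for u :: "'n \<Rightarrow> nat"
  let ?C = "PiE (UNIV :: 'n set) (\<lambda>i. {..nat \<lfloor>\<beta> i\<rfloor>})"
  have "real k < 2 / \<gamma>" using k(3) False pos(2) by (simp add: field_simps)
  also have "\<dots> \<le> (\<Prod>i\<in>UNIV. \<beta> i)" using prod pos(2) by (simp add: field_simps)
  also have "\<dots> \<le> (\<Prod>i\<in>UNIV. real (Suc (nat \<lfloor>\<beta> i\<rfloor>)))"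
  proof (rule prod_mono)
    show "0 \<le> \<beta> i \<and> \<beta> i \<le> real (Suc (nat \<lfloor>\<beta> i\<rfloor>))" for i
      using pos(1)[of i] by linarith
  qed
  also have "\<dots> = real (card ?C)" by (simp add: card_PiE)
  finally have "card {..<k} < card ?C" by simp
  moreover have "h ` ?C \<subseteq> {..<k}" using frac_cell_less[OF k(1)] by (auto simp: h_def)
  ultimately have "\<not> inj_on h ?C" using card_inj_on_le[of h ?C "{..<k}"] by auto
  then obtain u1 u2 where u: "u1 \<in> ?C" "u2 \<in> ?C" "u1 \<noteq> u2" "h u1 = h u2"
    by (auto simp: inj_on_def)
  show thesis
  proof (rule that[of "v u1 - v u2" "of_int (\<lfloor>v u2 \<bullet> Y\<rfloor> - \<lfloor>v u1 \<bullet> Y\<rfloor>)"])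
    show "v u1 - v u2 \<noteq> 0 \<or> of_int (\<lfloor>v u2 \<bullet> Y\<rfloor> - \<lfloor>v u1 \<bullet> Y\<rfloor>) \<noteq> (0::real)"
      using u(3) by (auto simp: v_def vec_eq_iff fun_eq_iff)
    fix i
    have "u1 i \<le> nat \<lfloor>\<beta> i\<rfloor>" "u2 i \<le> nat \<lfloor>\<beta> i\<rfloor>" using u(1,2) by (auto simp: PiE_def)
    then show "\<bar>(v u1 - v u2) $ i\<bar> \<le> \<beta> i"
      using pos(1)[of i] unfolding v_def by simp linarith
  next
    have "\<lfloor>frac (v u1 \<bullet> Y) * k\<rfloor> = \<lfloor>frac (v u2 \<bullet> Y) * k\<rfloor>"
      using u(4) unfolding h_def by (subst (asm) eq_nat_nat_iff) auto
    from same_cell_dist[OF k(1,2) this]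
    show "\<bar>(v u1 - v u2) \<bullet> Y + of_int (\<lfloor>v u2 \<bullet> Y\<rfloor> - \<lfloor>v u1 \<bullet> Y\<rfloor>)\<bar> \<le> \<gamma>"
      by (simp add: frac_def algebra_simps)
  qed (auto simp: int_vecs_def v_def)
qed

section \<open>Transference and the covering radius\<close>

lemma sum_except_bound:
  fixes f :: "'d::finite \<Rightarrow> real" and c :: real
  assumes "\<And>i. i \<noteq> j \<Longrightarrow> \<bar>f i\<bar> \<le> c" "0 \<le> c"
  shows "\<bar>\<Sum>i\<in>UNIV - {j}. f i\<bar> \<le> CARD('d) * c"
proof -
  have "\<bar>\<Sum>i\<in>UNIV - {j}. f i\<bar> \<le> (\<Sum>i\<in>UNIV - {j}. \<bar>f i\<bar>)" by (rule sum_abs)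
  also have "\<dots> \<le> (\<Sum>i\<in>UNIV - {j}. c)" using assms(1) by (intro sum_mono) auto
  also have "\<dots> = real (card (UNIV - {j})) * c" by simp
  also have "\<dots> \<le> CARD('d) * c"
    using assms(2) by (intro mult_right_mono) (auto intro!: card_mono)
  finally show ?thesis .
qed

lemma divide_card_le:
  fixes \<epsilon> :: real
  shows "0 \<le> \<epsilon> \<Longrightarrow> \<epsilon> / CARD('d::finite) \<le> \<epsilon>"
  by (simp add: divide_le_eq mult_le_cancel_left1 Suc_leI)

definition short_free :: "(real ^ 'd) set \<Rightarrow> real \<Rightarrow> bool" where
  "short_free L \<epsilon> \<longleftrightarrow> (\<forall>x\<in>L. (\<forall>i. \<bar>x $ i\<bar> \<le> \<epsilon>) \<longrightarrow> x = 0)"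

text \<open>
  Up to the value of the constant, the conclusion of Minkowski's convex body theorem for a lattice of
  covolume 1 and axis-parallel boxes.
\<close>
definition minkowski :: "(real ^ 'd) set \<Rightarrow> bool" where
  "minkowski L \<longleftrightarrow> (\<forall>\<beta>. (\<forall>i. 0 < \<beta> i) \<and> 2 ^ CARD('d) \<le> (\<Prod>i\<in>UNIV. \<beta> i) \<longrightarrow>
     (\<exists>x\<in>L. x \<noteq> 0 \<and> (\<forall>i. \<bar>x $ i\<bar> \<le> \<beta> i)))"

text \<open>
  All sides but one have length \<epsilon>. Such boxes are the link between short vectors and hyperplanes: a vector
  of the box that lies on a hyperplane whose normal has its largest coordinate in the direction j is short.
\<close>
lemma minkowski_long_box:
  fixes L :: "(real ^ 'd) set" and \<epsilon> :: real
  assumes "minkowski L" "0 < \<epsilon>"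
  obtains x where "x \<in> L" "x \<noteq> 0" "\<And>i. i \<noteq> j \<Longrightarrow> \<bar>x $ i\<bar> \<le> \<epsilon>"
    "\<bar>x $ j\<bar> \<le> 2 ^ CARD('d) / \<epsilon> ^ (CARD('d) - 1)"
proof -
  define \<beta> where "\<beta> i = (if i = j then 2 ^ CARD('d) / \<epsilon> ^ (CARD('d) - 1) else \<epsilon>)" for i
  have "(\<Prod>i\<in>UNIV. \<beta> i) = \<beta> j * (\<Prod>i\<in>UNIV - {j}. \<beta> i)"
    by (rule prod.remove) auto
  also have "(\<Prod>i\<in>UNIV - {j}. \<beta> i) = \<epsilon> ^ (CARD('d) - 1)"
    by (simp add: \<beta>_def card_Diff_singleton)
  finally have "(\<Prod>i\<in>UNIV. \<beta> i) = 2 ^ CARD('d)"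
    using assms(2) by (simp add: \<beta>_def)
  moreover have "\<forall>i. 0 < \<beta> i" using assms(2) by (simp add: \<beta>_def)
  ultimately obtain x where x: "x \<in> L" "x \<noteq> 0" "\<And>i. \<bar>x $ i\<bar> \<le> \<beta> i"
    using assms(1) unfolding minkowski_def by (metis order_refl)
  show thesis
    by (rule that[OF x(1,2)]) (use x(3)[unfolded \<beta>_def] in \<open>metis\<close>)+
qed

lemma exists_max_coord:
  fixes v :: "real ^ 'd"
  obtains j where "\<And>i. \<bar>v $ i\<bar> \<le> \<bar>v $ j\<bar>"
proof -
  have "Max (range (\<lambda>i. \<bar>v $ i\<bar>)) \<in> range (\<lambda>i. \<bar>v $ i\<bar>)" by (rule Max_in) auto
  then obtain j where j: "Max (range (\<lambda>i. \<bar>v $ i\<bar>)) = \<bar>v $ j\<bar>" by (elim rangeE)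
  have "\<bar>v $ i\<bar> \<le> \<bar>v $ j\<bar>" for i unfolding j[symmetric] by (rule Max_ge) auto
  then show thesis by (rule that)
qed

text \<open>
  The coordinate in the long direction is determined by the others through the equation x . v = 0, and
  the coefficients of this equation are at most 1 after division by the largest coordinate of v.
\<close>
lemma orthogonal_box_small:
  fixes x v :: "real ^ 'd" and \<epsilon> :: real
  assumes "x \<bullet> v = 0" "\<And>i. \<bar>v $ i\<bar> \<le> \<bar>v $ j\<bar>" "v \<noteq> 0" "\<And>i. i \<noteq> j \<Longrightarrow> \<bar>x $ i\<bar> \<le> \<epsilon>" "0 \<le> \<epsilon>"
  shows "\<bar>x $ j\<bar> \<le> CARD('d) * \<epsilon>"
proof -
  have vj: "0 < \<bar>v $ j\<bar>"
  proof (rule ccontr)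
    assume "\<not> 0 < \<bar>v $ j\<bar>"
    then have "v $ i = 0" for i using assms(2)[of i] by simp
    then show False using assms(3) by (simp add: vec_eq_iff)
  qed
  have "0 = x $ j * v $ j + (\<Sum>i\<in>UNIV - {j}. x $ i * v $ i)"
    using assms(1) by (simp add: inner_vec_def sum.remove[of UNIV j])
  then have "\<bar>x $ j\<bar> * \<bar>v $ j\<bar> = \<bar>\<Sum>i\<in>UNIV - {j}. x $ i * v $ i\<bar>"
    by (simp add: abs_mult[symmetric])
  also have "\<dots> \<le> CARD('d) * (\<epsilon> * \<bar>v $ j\<bar>)"
    using assms by (intro sum_except_bound) (auto simp: abs_mult intro!: mult_mono)
  finally show ?thesis using vj by (simp add: mult.assoc[symmetric])
qed

text \<open>
  A very short v in D would have integral and small, hence zero, inner product with the vector of P that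
  Minkowski's theorem provides in a box that is long in the direction of the largest coordinate of v. That
  vector would then be short.
\<close>
lemma transference:
  fixes P D :: "(real ^ 'd) set"
  assumes pair: "\<And>x v. x \<in> P \<Longrightarrow> v \<in> D \<Longrightarrow> x \<bullet> v \<in> \<int>"
    and "minkowski P" "short_free P \<epsilon>" "0 < \<epsilon>"
    and \<epsilon>': "\<epsilon>' * (2 ^ CARD('d) / (\<epsilon> / CARD('d)) ^ (CARD('d) - 1) + \<epsilon>) < 1"
  shows "short_free D \<epsilon>'"
  unfolding short_free_def
proof (intro ballI impI, rule ccontr)
  fix v assume v: "v \<in> D" "\<forall>i. \<bar>v $ i\<bar> \<le> \<epsilon>'" "v \<noteq> 0"
  obtain j where j: "\<And>i. \<bar>v $ i\<bar> \<le> \<bar>v $ j\<bar>" using exists_max_coord by blast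
  define e where "e = \<epsilon> / CARD('d)"
  have e: "0 < e" "CARD('d) * e = \<epsilon>" using assms(4) by (auto simp: e_def)
  define l where "l = 2 ^ CARD('d) / e ^ (CARD('d) - 1)"
  obtain x where x: "x \<in> P" "x \<noteq> 0" "\<And>i. i \<noteq> j \<Longrightarrow> \<bar>x $ i\<bar> \<le> e" "\<bar>x $ j\<bar> \<le> l"
    using minkowski_long_box[OF assms(2) e(1), where j = j] unfolding l_def by blast
  have e0: "0 \<le> \<epsilon>'" using v(2) abs_ge_zero order_trans by blast
  have "x \<bullet> v = x $ j * v $ j + (\<Sum>i\<in>UNIV - {j}. x $ i * v $ i)"
    by (simp add: inner_vec_def sum.remove[of UNIV j])
  then have "\<bar>x \<bullet> v\<bar> \<le> \<bar>x $ j * v $ j\<bar> + \<bar>\<Sum>i\<in>UNIV - {j}. x $ i * v $ i\<bar>" by simp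
  also have "\<dots> \<le> l * \<epsilon>' + CARD('d) * (e * \<epsilon>')"
  proof (rule add_mono)
    show "\<bar>x $ j * v $ j\<bar> \<le> l * \<epsilon>'" using x(4) v(2) by (auto simp: abs_mult intro!: mult_mono)
    show "\<bar>\<Sum>i\<in>UNIV - {j}. x $ i * v $ i\<bar> \<le> CARD('d) * (e * \<epsilon>')"
      using x(3) v(2) e(1) e0 by (intro sum_except_bound) (auto simp: abs_mult intro!: mult_mono)
  qed
  also have "\<dots> = \<epsilon>' * (l + \<epsilon>)" using e(2) by (simp add: algebra_simps)
  also have "\<dots> < 1" using \<epsilon>' by (simp add: l_def e_def)
  finally have "\<bar>x \<bullet> v\<bar> < 1" .
  then have "x \<bullet> v = 0" using pair[OF x(1) v(1)] Ints_nonzero_abs_less1 by blast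
  then have "\<bar>x $ j\<bar> \<le> \<epsilon>"
    using orthogonal_box_small[OF _ j v(3) x(3)] e by simp
  moreover have "e \<le> \<epsilon>" by (metis divide_card_le assms(4) e_def less_imp_le)
  ultimately have "\<forall>i. \<bar>x $ i\<bar> \<le> \<epsilon>" using x(3) by (metis order_trans)
  then show False using assms(3) x(1,2) by (auto simp: short_free_def)
qed

definition additive_subgroup :: "('a :: ab_group_add) set \<Rightarrow> bool" where
  "additive_subgroup D \<longleftrightarrow> 0 \<in> D \<and> (\<forall>x\<in>D. \<forall>y\<in>D. x - y \<in> D)"

lemma additive_subgroupD:
  assumes "additive_subgroup D"
  shows "0 \<in> D" "x \<in> D \<Longrightarrow> y \<in> D \<Longrightarrow> x - y \<in> D" "x \<in> D \<Longrightarrow> - x \<in> D"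
    "x \<in> D \<Longrightarrow> y \<in> D \<Longrightarrow> x + y \<in> D"
proof -
  show 0: "0 \<in> D" and d: "\<And>x y. x \<in> D \<Longrightarrow> y \<in> D \<Longrightarrow> x - y \<in> D"
    using assms by (auto simp: additive_subgroup_def)
  show n: "\<And>x. x \<in> D \<Longrightarrow> - x \<in> D" using d[OF 0] by simp
  show "x \<in> D \<Longrightarrow> y \<in> D \<Longrightarrow> x + y \<in> D" using d[OF _ n] by simp
qed

lemma additive_subgroup_scale_int:
  fixes D :: "'a :: real_vector set"
  assumes "additive_subgroup D" "x \<in> D"
  shows "of_int k *\<^sub>R x \<in> D"
proof -
  have "of_nat m *\<^sub>R x \<in> D" for m
    by (induction m) (use additive_subgroupD[OF assms(1)] assms(2) in \<open>auto simp: scaleR_add_left\<close>)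
  then show ?thesis
    by (cases k) (use additive_subgroupD(3)[OF assms(1)] in \<open>fastforce simp del: of_nat_Suc\<close>)+
qed

lemma additive_subgroup_sum:
  assumes "additive_subgroup D" "\<And>i. i \<in> I \<Longrightarrow> f i \<in> D"
  shows "sum f I \<in> D"
  using assms(2)
  by (induction I rule: infinite_finite_induct) (use additive_subgroupD[OF assms(1)] in auto)

text \<open>
  If the vectors of D of norm at most R spanned a proper subspace, a long box in the direction of the
  largest coordinate of a normal would contain a vector of D on that subspace, which would be short. So D contains a
  basis of bounded vectors, and coefficients with respect to it can be rounded.
\<close>
lemma covering_radius:
  fixes D :: "(real ^ 'd) set" and v :: "real ^ 'd" and \<epsilon> R :: real
  assumes D: "additive_subgroup D" "minkowski D" "short_free D \<epsilon>" "0 < \<epsilon>"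
    and R: "R = 2 ^ CARD('d) / (\<epsilon> / CARD('d)) ^ (CARD('d) - 1) + \<epsilon>"
  obtains f where "f \<in> D" "\<And>i. \<bar>v $ i - f $ i\<bar> \<le> CARD('d) * R"
proof -
  define e where "e = \<epsilon> / CARD('d)"
  have e: "0 < e" "CARD('d) * e = \<epsilon>" using assms(4) by (auto simp: e_def)
  have e1: "e \<le> \<epsilon>" by (metis divide_card_le assms(4) e_def less_imp_le)
  define S where "S = {x \<in> D. \<forall>i. \<bar>x $ i\<bar> \<le> R}"
  have R0: "0 \<le> R" using assms(4) by (simp add: R)
  have "span S = UNIV"
  proof (rule ccontr)
    assume "span S \<noteq> UNIV"
    then obtain a where a: "a \<noteq> 0" "\<And>x. x \<in> span S \<Longrightarrow> a \<bullet> x = 0"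
      using span_not_UNIV_orthogonal[of S] by auto
    obtain j where j: "\<And>i. \<bar>a $ i\<bar> \<le> \<bar>a $ j\<bar>" using exists_max_coord by blast
    obtain x where x: "x \<in> D" "x \<noteq> 0" "\<And>i. i \<noteq> j \<Longrightarrow> \<bar>x $ i\<bar> \<le> e"
        "\<bar>x $ j\<bar> \<le> 2 ^ CARD('d) / e ^ (CARD('d) - 1)"
      using minkowski_long_box[OF assms(2) e(1), where j = j] by blast
    have p: "0 \<le> 2 ^ CARD('d) / e ^ (CARD('d) - 1)" using e(1) by simp
    have "\<bar>x $ i\<bar> \<le> R" for i
      using x(3)[of i] x(4) e1 p assms(4) unfolding R e_def[symmetric] by (cases "i = j") (auto simp: add.commute)
    then have "x \<in> S" using x(1) by (simp add: S_def)
    then have "x \<bullet> a = 0" using a(2)[OF span_base] by (metis inner_commute)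
    then have "\<bar>x $ j\<bar> \<le> \<epsilon>" using orthogonal_box_small[OF _ j a(1) x(3)] e by simp
    then have "\<forall>i. \<bar>x $ i\<bar> \<le> \<epsilon>" using x(3) e1 by (metis order_trans)
    then show False using assms(3) x(1,2) by (auto simp: short_free_def)
  qed
  obtain B where B: "B \<subseteq> S" "independent B" "S \<subseteq> span B" by (rule basis_exists[of S])
  have fin: "finite B" and cB: "card B \<le> CARD('d)"
    using independent_bound[OF B(2)] by auto
  have "span B = UNIV" using \<open>span S = UNIV\<close> span_minimal[OF B(3)] by auto
  then obtain u where u: "v = (\<Sum>b\<in>B. u b *\<^sub>R b)"
    using span_finite[OF fin] by auto
  define f where "f = (\<Sum>b\<in>B. of_int \<lfloor>u b\<rfloor> *\<^sub>R b)"
  have "f \<in> D" unfolding f_def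
    by (rule additive_subgroup_sum[OF D(1)])
      (use B(1) in \<open>auto simp: S_def intro!: additive_subgroup_scale_int[OF D(1)]\<close>)
  moreover have "\<bar>v $ i - f $ i\<bar> \<le> CARD('d) * R" for i
  proof -
    have "v $ i - f $ i = (\<Sum>b\<in>B. frac (u b) * b $ i)"
      unfolding u f_def by (simp add: frac_def sum_subtractf left_diff_distrib)
    also have "\<bar>\<dots>\<bar> \<le> (\<Sum>b\<in>B. \<bar>frac (u b) * b $ i\<bar>)" by (rule sum_abs)
    also have "\<dots> \<le> (\<Sum>b\<in>B. 1 * R)"
    proof (rule sum_mono)
      fix b assume "b \<in> B"
      then have "\<bar>b $ i\<bar> \<le> R" using B(1) by (auto simp: S_def)
      moreover have "\<bar>frac (u b)\<bar> \<le> 1"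
        using frac_ge_0[of "u b"] frac_lt_1[of "u b"] by linarith
      ultimately show "\<bar>frac (u b) * b $ i\<bar> \<le> 1 * R" unfolding abs_mult by (intro mult_mono) auto
    qed
    also have "\<dots> = card B * R" by simp
    also have "\<dots> \<le> CARD('d) * R" using cB R0 by (intro mult_right_mono) auto
    finally show ?thesis .
  qed
  ultimately show thesis by (rule that)
qed

lemma short_free_finite:
  fixes D :: "(real ^ 'd) set"
  assumes "additive_subgroup D" "short_free D \<epsilon>" "0 < \<epsilon>"
  shows "finite {x \<in> D. \<forall>i. \<bar>x $ i\<bar> \<le> R}" (is "finite ?S")
proof (rule ccontr)
  assume inf: "infinite ?S"
  have "?S \<subseteq> cbox (\<chi> i. - R) (\<chi> i. R)"
    by (auto simp: mem_box_cart abs_le_iff minus_le_iff)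
  then have "bounded ?S" by (rule bounded_subset[OF bounded_cbox])
  then obtain l where "l islimpt ?S" using bounded_infinite_imp_islimpt[of ?S] inf by blast
  then have *: "infinite (?S \<inter> ball l (\<epsilon> / 2))"
    using assms(3) by (meson islimpt_eq_infinite_ball half_gt_zero)
  then obtain x where x: "x \<in> ?S \<inter> ball l (\<epsilon> / 2)" using infinite_imp_nonempty by blast
  obtain y where y: "y \<in> ?S \<inter> ball l (\<epsilon> / 2)" "y \<noteq> x"
    using infinite_imp_nonempty[OF infinite_remove[OF *, of x]] by blast
  have "dist x y < \<epsilon>" using x y dist_triangle_half_r[of l x \<epsilon> y] by auto
  then have "\<bar>(x - y) $ i\<bar> \<le> \<epsilon>" for i
    using component_le_norm_cart[of "x - y" i] by (simp add: dist_norm)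
  moreover have "x - y \<in> D" using x y additive_subgroupD(2)[OF assms(1)] by auto
  ultimately have "x - y = 0" using assms(2) unfolding short_free_def by blast
  then show False using y(2) by simp
qed

section \<open>Primitive tuples of forms close to the coordinate axes\<close>

lemma diagonal_dominant_coefficients:
  fixes a :: "nat \<Rightarrow> real ^ 'd" and e :: "nat \<Rightarrow> 'd" and R T :: real
  assumes e: "bij_betw e {..<CARD('d)} UNIV" and R: "0 \<le> R" "CARD('d) * R < T"
    and a: "\<And>i o'. i < CARD('d) \<Longrightarrow> \<bar>a i $ o' - (if o' = e i then T else 0)\<bar> \<le> R"
  obtains c :: "nat \<Rightarrow> real ^ 'd \<Rightarrow> real" where
    "\<And>j. linear (c j)" "\<And>v. v = (\<Sum>j<CARD('d). c j v *\<^sub>R a j)"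
    "\<And>i j. i < CARD('d) \<Longrightarrow> j < CARD('d) \<Longrightarrow> c j (a i) = (if i = j then 1 else 0)"
proof -
  let ?d = "CARD('d)"
  define A where "A = (\<lambda>u :: real ^ 'd. \<Sum>j<?d. u $ e j *\<^sub>R a j)"
  have lin: "linear A" unfolding A_def
    by (auto intro!: linearI simp: scaleR_add_left sum.distrib scaleR_sum_right)
  have "inj A"
  proof (rule linear_injective_0[THEN iffD2, OF lin], intro allI impI, rule ccontr)
    fix u assume u: "A u = 0" "u \<noteq> 0"
    obtain k where k: "\<And>i. \<bar>u $ i\<bar> \<le> \<bar>u $ k\<bar>" using exists_max_coord by blast
    have uk: "0 < \<bar>u $ k\<bar>"
    proof (rule ccontr)
      assume "\<not> 0 < \<bar>u $ k\<bar>"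
      then have "u $ i = 0" for i using k[of i] by simp
      then show False using u(2) by (simp add: vec_eq_iff)
    qed
    have "0 = (\<Sum>j<?d. u $ e j * a j $ k)"
      using arg_cong[OF u(1), of "\<lambda>v. v $ k"] by (simp add: A_def)
    also have "\<dots> = (\<Sum>j<?d. u $ e j * (a j $ k - (if k = e j then T else 0)))
        + (\<Sum>j<?d. u $ e j * (if k = e j then T else 0))"
      by (simp add: sum.distrib[symmetric] algebra_simps)
    also have "(\<Sum>j<?d. u $ e j * (if k = e j then T else 0)) = (\<Sum>o'\<in>UNIV. u $ o' * (if k = o' then T else 0))"
      by (rule sum.reindex_bij_betw[OF e])
    also have "\<dots> = u $ k * T" by (simp add: if_distrib sum.delta cong: if_cong)
    finally have eq: "u $ k * T = - (\<Sum>j<?d. u $ e j * (a j $ k - (if k = e j then T else 0)))"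
      by (simp add: add_eq_0_iff)
    have "0 \<le> ?d * R" using R(1) by simp
    then have "\<bar>u $ k\<bar> * T = \<bar>u $ k * T\<bar>" using R(2) by (simp add: abs_mult)
    also have "\<dots>  = \<bar>\<Sum>j<?d. u $ e j * (a j $ k - (if k = e j then T else 0))\<bar>"
      unfolding eq by simp
    also have "\<dots> \<le> (\<Sum>j<?d. \<bar>u $ e j * (a j $ k - (if k = e j then T else 0))\<bar>)" by (rule sum_abs)
    also have "\<dots> \<le> (\<Sum>j<?d. \<bar>u $ k\<bar> * R)"
      unfolding abs_mult by (intro sum_mono mult_mono k a) auto
    also have "\<dots> = \<bar>u $ k\<bar> * (?d * R)" by simp
    finally show False using R(2) uk by (simp add: mult_le_cancel_left)
  qed
  then obtain C where C: "linear C" "\<And>x. C (A x) = x" "\<And>x. A (C x) = x"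
    using linear_injective_isomorphism[OF lin] by blast
  show thesis
  proof (rule that[of "\<lambda>j v. C v $ e j"])
    show "linear (\<lambda>v. C v $ e j)" for j
      using C(1) by (auto intro!: linearI simp: linear_add linear_scale)
    show "v = (\<Sum>j<?d. C v $ e j *\<^sub>R a j)" for v using C(3)[of v] by (simp add: A_def)
    fix i j assume ij: "i < ?d" "j < ?d"
    have inj: "e i' = e i \<longleftrightarrow> i' = i" if "i' < ?d" for i'
      using e that ij(1) by (auto simp: bij_betw_def inj_on_def)
    have "A (axis (e i) 1) = (\<Sum>j<?d. (if j = i then a j else 0))"
      unfolding A_def by (rule sum.cong) (auto simp: axis_def inj)
    also have "\<dots> = a i" using ij by simp
    finally have "C (a i) = axis (e i) 1" using C(2)[of "axis (e i) 1"] by simp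
    then show "C (a i) $ e j = (if i = j then 1 else 0)"
      using inj[OF ij(2)] by (auto simp: axis_def)
  qed
qed

text \<open>
  One step of the construction of a basis of D adapted to the flag spanned by the first i of the vectors a 0, a 1, ...
  Among the vectors of D in the i-th member of the flag, g minimizes the positive leading coefficient. It can be reduced modulo
  the a j, which keeps it bounded; this is what makes later constants uniform in D.
\<close>
lemma adapted_vector:
  fixes D :: "(real ^ 'd) set" and c :: "nat \<Rightarrow> real ^ 'd \<Rightarrow> real"
  assumes D: "additive_subgroup D" "short_free D \<epsilon>" "0 < \<epsilon>"
    and a: "\<And>i. i < d \<Longrightarrow> a i \<in> D"
    and c: "\<And>j. linear (c j)" "\<And>v. v = (\<Sum>j<d. c j v *\<^sub>R a j)"
    "\<And>i j. i < d \<Longrightarrow> j < d \<Longrightarrow> c j (a i) = (if i = j then 1 else 0)"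
    and i: "i < d"
  obtains g where "g \<in> D" "\<And>j. i < j \<Longrightarrow> j < d \<Longrightarrow> c j g = 0" "0 < c i g"
    "\<And>j. j < d \<Longrightarrow> \<bar>c j g\<bar> \<le> 1"
    "\<And>v. v \<in> D \<Longrightarrow> (\<And>j. i < j \<Longrightarrow> j < d \<Longrightarrow> c j v = 0) \<Longrightarrow> \<exists>k::int. c i v = of_int k * c i g"
proof -
  define F where "F = {v \<in> D. (\<forall>j. i < j \<and> j < d \<longrightarrow> c j v = 0) \<and> (\<forall>j<d. \<bar>c j v\<bar> \<le> 1) \<and> 0 < c i v}"
  define r where "r = (\<Sum>j<d. infnorm (a j))"
  have "F \<subseteq> {x \<in> D. \<forall>k. \<bar>x $ k\<bar> \<le> r}"
  proof safe
    fix v k assume v: "v \<in> F"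
    then show "v \<in> D" by (simp add: F_def)
    have "\<bar>v $ k\<bar> = \<bar>\<Sum>j<d. c j v * a j $ k\<bar>" by (subst c(2)[of v]) simp
    also have "\<dots> \<le> (\<Sum>j<d. \<bar>c j v * a j $ k\<bar>)" by (rule sum_abs)
    also have "\<dots> \<le> (\<Sum>j<d. 1 * infnorm (a j))"
      unfolding abs_mult by (intro sum_mono mult_mono component_le_infnorm_cart) (use v in \<open>auto simp: F_def\<close>)
    finally show "\<bar>v $ k\<bar> \<le> r" by (simp add: r_def)
  qed
  then have finF: "finite F" using short_free_finite[OF D] finite_subset by blast
  have "a i \<in> F" using a c(3) i by (auto simp: F_def)
  then have ne: "c i ` F \<noteq> {}" by blast
  obtain g where g: "g \<in> F" "c i g = Min (c i ` F)"
    using Min_in[OF finite_imageI[OF finF] ne] by auto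
  have min: "c i g \<le> c i v" if "v \<in> F" for v
    unfolding g(2) using finF that by (intro Min_le) auto
  show thesis
  proof (rule that[of g])
    fix v assume v: "v \<in> D" "\<And>j. i < j \<Longrightarrow> j < d \<Longrightarrow> c j v = 0"
    have gi: "0 < c i g" "c i g \<le> 1" using g(1) i by (auto simp: F_def abs_le_iff)
    define k where "k = \<lfloor>c i v / c i g\<rfloor>"
    define w where "w = v - of_int k *\<^sub>R g"
    have cw: "c j w = c j v - of_int k * c j g" for j
      by (simp add: w_def linear_diff[OF c(1)] linear_scale[OF c(1)])
    have w0: "0 \<le> c i w" "c i w < c i g"
    proof -
      have "of_int k \<le> c i v / c i g" "c i v / c i g < of_int k + 1" unfolding k_def by linarith+
      then show "0 \<le> c i w" "c i w < c i g" using gi(1) unfolding cw by (simp_all add: field_simps)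
    qed
    have wD: "w \<in> D" unfolding w_def using v(1) g(1)
      by (intro additive_subgroupD(2)[OF D(1)] additive_subgroup_scale_int[OF D(1)]) (auto simp: F_def)
    have "c i w = 0"
    proof (rule ccontr)
      assume n: "c i w \<noteq> 0"
      define u where "u = w - (\<Sum>j<i. of_int \<lfloor>c j w\<rfloor> *\<^sub>R a j)"
      have cu: "c l u = c l w - (\<Sum>j<i. of_int \<lfloor>c j w\<rfloor> * c l (a j))" for l
        by (simp add: u_def linear_diff[OF c(1)] linear_sum[OF c(1)] linear_scale[OF c(1)])
      have cu2: "c l u = (if l < i then frac (c l w) else c l w)" if l: "l < d" for l
      proof -
        have "(\<Sum>j<i. of_int \<lfloor>c j w\<rfloor> * c l (a j)) = (\<Sum>j<i. if j = l then of_int \<lfloor>c j w\<rfloor> else 0)"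
          using i l by (intro sum.cong) (auto simp: c(3))
        then show ?thesis unfolding cu by (simp add: frac_def)
      qed
      have "u \<in> D" unfolding u_def using i
        by (intro additive_subgroupD(2)[OF D(1)] wD additive_subgroup_sum[OF D(1)]
            additive_subgroup_scale_int[OF D(1)] a) auto
      moreover have "c j u = 0" if "i < j" "j < d" for j
        using that v(2)[OF that] g(1) by (auto simp: cu2 cw F_def)
      moreover have "\<bar>c j u\<bar> \<le> 1" if "j < d" for j
      proof (cases "j < i")
        case True
        then show ?thesis using that frac_ge_0[of "c j w"] frac_lt_1[of "c j w"] by (simp add: cu2)
      next
        case False
        show ?thesis
        proof (cases "j = i")
          case True
          then show ?thesis using that w0 gi by (simp add: cu2)
        next
          case False
          then have "c j u = 0" using \<open>\<not> j < i\<close> that \<open>\<And>j. \<lbrakk>i < j; j < d\<rbrakk> \<Longrightarrow> c j u = 0\<close> by simp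
          then show ?thesis by simp
        qed
      qed
      moreover have "0 < c i u" using n w0(1) i by (simp add: cu2)
      ultimately have "u \<in> F" by (auto simp: F_def)
      from min[OF this] show False using w0(2) i by (simp add: cu2)
    qed
    then show "\<exists>k::int. c i v = of_int k * c i g" unfolding cw by (intro exI[of _ k]) simp
  qed (use g(1) i in \<open>auto simp: F_def\<close>)
qed

text \<open>
  Division with remainder by the leading coefficients.
\<close>
lemma adapted_basis_generates:
  fixes D :: "(real ^ 'd) set" and c :: "nat \<Rightarrow> real ^ 'd \<Rightarrow> real"
  assumes D: "additive_subgroup D"
    and c: "\<And>j. linear (c j)" "\<And>v. v = (\<Sum>j<d. c j v *\<^sub>R a j)"
    and g: "\<And>i. i < d \<Longrightarrow> g i \<in> D" "\<And>i j. i < j \<Longrightarrow> j < d \<Longrightarrow> c j (g i) = 0"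
    "\<And>i v. i < d \<Longrightarrow> v \<in> D \<Longrightarrow> (\<And>j. i < j \<Longrightarrow> j < d \<Longrightarrow> c j v = 0) \<Longrightarrow> \<exists>k::int. c i v = of_int k * c i (g i)"
    and m: "m \<le> d" and v: "v \<in> D" "\<And>j. m \<le> j \<Longrightarrow> j < d \<Longrightarrow> c j v = 0"
  shows "\<exists>k :: nat \<Rightarrow> int. v = (\<Sum>j<m. of_int (k j) *\<^sub>R g j)"
  using m v
proof (induction m arbitrary: v)
  case 0
  have "v = (\<Sum>j<d. c j v *\<^sub>R a j)" by (rule c(2))
  also have "\<dots> = 0" using 0 by simp
  finally show ?case by simp
next
  case (Suc m)
  then obtain l :: int where l: "c m v = of_int l * c m (g m)" using g(3)[of m v] by auto
  define w where "w = v - of_int l *\<^sub>R g m"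
  have "w \<in> D" unfolding w_def using Suc.prems g(1)[of m]
    by (intro additive_subgroupD(2)[OF D] additive_subgroup_scale_int[OF D]) auto
  moreover have "c j w = 0" if "m \<le> j" "j < d" for j
    using that Suc.prems l g(2)[of m j]
    by (cases "j = m") (auto simp: w_def linear_diff[OF c(1)] linear_scale[OF c(1)])
  ultimately obtain k :: "nat \<Rightarrow> int" where k: "w = (\<Sum>j<m. of_int (k j) *\<^sub>R g j)"
    using Suc.IH[of w] Suc.prems(1) by auto
  have "v = w + of_int l *\<^sub>R g m" by (simp add: w_def)
  also have "\<dots> = (\<Sum>j<Suc m. of_int ((k(m := l)) j) *\<^sub>R g j)" by (simp add: k)
  finally show ?case by blast
qed

text \<open>
  The linear maps with integral values on D form the dual lattice. So the second clause says that evaluation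
  at f maps the dual lattice onto all integral vectors, i.e. that f extends to a basis of D.
\<close>
definition primitive_tuple :: "(real ^ 'd) set \<Rightarrow> nat \<Rightarrow> (nat \<Rightarrow> real ^ 'd) \<Rightarrow> bool" where
  "primitive_tuple D m f \<longleftrightarrow> (\<forall>i<m. f i \<in> D) \<and>
     (\<forall>z :: nat \<Rightarrow> int. \<exists>\<phi> :: real ^ 'd \<Rightarrow> real. linear \<phi> \<and> (\<forall>v\<in>D. \<phi> v \<in> \<int>) \<and> (\<forall>i<m. \<phi> (f i) = z i))"

text \<open>
  Points a i of D near K0 times the axes exist by the covering property, but in general they are not primitive.
  With a basis g adapted to their flag put f i = K a i + g (i + 1). In terms of g, the tuple K a is
  lower triangular, so f is a lower Hessenberg matrix with ones above the diagonal; the columns of these ones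
  form a unitriangular minor, whence f is primitive. For K large the g-term is a negligible perturbation.
  The bound T depends on D through its covering radius only.
\<close>
lemma primitive_tuple_near_axes:
  fixes e :: "nat \<Rightarrow> 'd::finite" and R \<rho> :: real
  assumes e: "bij_betw e {..<CARD('d)} UNIV" and R: "0 \<le> R" and \<rho>: "0 < \<rho>"
  obtains T :: nat where "1 / \<rho> \<le> T" "0 < T"
    "\<And>(D :: (real ^ 'd) set) \<epsilon>. additive_subgroup D \<Longrightarrow> short_free D \<epsilon> \<Longrightarrow> 0 < \<epsilon> \<Longrightarrow>
       (\<And>v. \<exists>f\<in>D. \<forall>i. \<bar>v $ i - f $ i\<bar> \<le> R) \<Longrightarrow>
       \<exists>f. primitive_tuple D (CARD('d) - 1) f \<and>
         (\<forall>i<CARD('d) - 1. \<forall>k. \<bar>f i $ k - (if k = e i then real T else 0)\<bar> \<le> \<rho> * T)"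
proof -
  let ?d = "CARD('d)"
  define K0 where "K0 = nat \<lceil>2 * R / \<rho> + ?d * R + R + 1\<rceil>"
  define K where "K = nat \<lceil>4 * ?d / \<rho> + 1 / \<rho> + 1\<rceil>"
  have p: "0 \<le> 2 * R / \<rho>" "0 \<le> ?d * R" using R \<rho> by auto
  have K0: "2 * R / \<rho> \<le> K0" "?d * R < K0" "R \<le> K0" "1 \<le> K0"
    using p R unfolding K0_def by linarith+
  have p': "0 \<le> 4 * ?d / \<rho>" "0 \<le> 1 / \<rho>" using \<rho> by auto
  have K: "4 * ?d / \<rho> \<le> K" "1 / \<rho> \<le> K" "1 \<le> K"
    using p' unfolding K_def by linarith+
  have small: "K * R + ?d * (K0 + R) \<le> \<rho> * (K * K0)"
  proof -
    have "2 * R \<le> \<rho> * K0" using K0(1) \<rho> by (simp add: field_simps)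
    then have "2 * (K * R) \<le> \<rho> * (K * K0)" by (metis mult.left_commute mult_left_mono of_nat_0_le_iff of_nat_mult)
    moreover have "real (4 * ?d) \<le> \<rho> * K" using K(1) \<rho> by (simp add: field_simps)
    then have "real (4 * ?d) * K0 \<le> \<rho> * K * K0" by (intro mult_right_mono) auto
    then have "4 * (?d * real K0) \<le> \<rho> * (K * K0)" by (simp add: mult.assoc)
    moreover have "?d * R \<le> ?d * real K0" using K0(3) by (intro mult_left_mono) auto
    ultimately show ?thesis by (simp only: distrib_left)
  qed
  show thesis
  proof (rule that[of "K * K0"])
    have "K * 1 \<le> K * K0" using K0(4) by (intro mult_left_mono) auto
    then show "1 / \<rho> \<le> real (K * K0)" using K(2) by linarith
    show "0 < K * K0" using K0(4) K(3) by auto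
    fix D :: "(real ^ 'd) set" and \<epsilon> :: real
    assume D: "additive_subgroup D" "short_free D \<epsilon>" "0 < \<epsilon>"
      and cov: "\<And>v. \<exists>f\<in>D. \<forall>i. \<bar>v $ i - f $ i\<bar> \<le> R"
    have "\<exists>a. \<forall>i. a i \<in> D \<and> (\<forall>k. \<bar>axis (e i) (real K0) $ k - a i $ k\<bar> \<le> R)"
      by (rule choice) (use cov in blast)
    then obtain a where a: "\<And>i. a i \<in> D" "\<And>i k. \<bar>axis (e i) (real K0) $ k - a i $ k\<bar> \<le> R"
      by blast
    have a2: "\<bar>a i $ k - (if k = e i then real K0 else 0)\<bar> \<le> R" for i k
      using a(2)[of i k] by (simp add: axis_def abs_minus_commute split: if_splits)
    obtain c :: "nat \<Rightarrow> real ^ 'd \<Rightarrow> real" where c: "\<And>j. linear (c j)" "\<And>v. v = (\<Sum>j<?d. c j v *\<^sub>R a j)"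
      "\<And>i j. i < ?d \<Longrightarrow> j < ?d \<Longrightarrow> c j (a i) = (if i = j then 1 else 0)"
      using diagonal_dominant_coefficients[OF e R K0(2) a2] by blast
    \<comment> \<open>The properties of an adapted vector, kept opaque for the choice of g.\<close>
    define Q where "Q i g \<longleftrightarrow> g \<in> D \<and> (\<forall>j. i < j \<longrightarrow> j < ?d \<longrightarrow> c j g = 0) \<and> 0 < c i g \<and>
      (\<forall>j<?d. \<bar>c j g\<bar> \<le> 1) \<and>
      (\<forall>v\<in>D. (\<forall>j. i < j \<longrightarrow> j < ?d \<longrightarrow> c j v = 0) \<longrightarrow> (\<exists>k::int. c i v = of_int k * c i g))" for i g
    have "\<exists>g. Q i g" if i: "i < ?d" for i
    proof -
      obtain g where "g \<in> D" "\<And>j. i < j \<Longrightarrow> j < ?d \<Longrightarrow> c j g = 0" "0 < c i g"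
        "\<And>j. j < ?d \<Longrightarrow> \<bar>c j g\<bar> \<le> 1"
        "\<And>v. v \<in> D \<Longrightarrow> (\<And>j. i < j \<Longrightarrow> j < ?d \<Longrightarrow> c j v = 0) \<Longrightarrow> \<exists>k::int. c i v = of_int k * c i g"
        using adapted_vector[OF D a(1) c i] by blast
      then have "Q i g" unfolding Q_def by blast
      then show ?thesis ..
    qed
    then obtain g where gQ: "\<And>i. i < ?d \<Longrightarrow> Q i (g i)" by metis
    have g: "\<And>i. i < ?d \<Longrightarrow> g i \<in> D" "\<And>i j. i < j \<Longrightarrow> j < ?d \<Longrightarrow> c j (g i) = 0"
      "\<And>i. i < ?d \<Longrightarrow> 0 < c i (g i)" "\<And>i j. i < ?d \<Longrightarrow> j < ?d \<Longrightarrow> \<bar>c j (g i)\<bar> \<le> 1"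
      "\<And>i v. i < ?d \<Longrightarrow> v \<in> D \<Longrightarrow> (\<And>j. i < j \<Longrightarrow> j < ?d \<Longrightarrow> c j v = 0) \<Longrightarrow>
         \<exists>k::int. c i v = of_int k * c i (g i)"
      using gQ less_trans unfolding Q_def by blast+
    note gen = adapted_basis_generates[OF D(1) c(1,2) g(1,2,5)]
    define f where "f i = real K *\<^sub>R a i + g (Suc i)" for i
    have gb: "\<bar>g i $ k\<bar> \<le> ?d * (K0 + R)" if "i < ?d" for i k
    proof -
      have "\<bar>g i $ k\<bar> = \<bar>\<Sum>j<?d. c j (g i) * a j $ k\<bar>" by (subst c(2)[of "g i"]) simp
      also have "\<dots> \<le> (\<Sum>j<?d. \<bar>c j (g i) * a j $ k\<bar>)" by (rule sum_abs)
      also have "\<dots> \<le> (\<Sum>j<?d. 1 * (K0 + R))"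
        unfolding abs_mult
      proof (intro sum_mono mult_mono)
        show "\<bar>a j $ k\<bar> \<le> K0 + R" for j using a2[of j k] R by (auto split: if_splits)
      qed (use g(4) that in auto)
      finally show ?thesis by simp
    qed
    have fD: "f i \<in> D" if i: "i < ?d - 1" for i
      unfolding f_def using i additive_subgroup_scale_int[OF D(1) a(1), of "int K"]
      by (intro additive_subgroupD(4)[OF D(1)] g(1)) auto
    show "\<exists>f. primitive_tuple D (?d - 1) f \<and>
      (\<forall>i<?d - 1. \<forall>k. \<bar>f i $ k - (if k = e i then real (K * K0) else 0)\<bar> \<le> \<rho> * real (K * K0))"
      unfolding primitive_tuple_def
    proof (rule exI[of _ f], intro conjI allI impI fD)
      fix i k assume i: "i < ?d - 1"
      have "f i $ k - (if k = e i then real (K * K0) else 0) = K * (a i $ k - (if k = e i then real K0 else 0)) + g (Suc i) $ k"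
        by (simp add: f_def algebra_simps)
      also have "\<bar>\<dots>\<bar> \<le> \<bar>K * (a i $ k - (if k = e i then real K0 else 0))\<bar> + \<bar>g (Suc i) $ k\<bar>" by simp
      also have "\<dots> \<le> K * R + ?d * (K0 + R)"
      proof (rule add_mono)
        show "\<bar>K * (a i $ k - (if k = e i then real K0 else 0))\<bar> \<le> K * R"
          unfolding abs_mult using a2[of i k] by (intro mult_mono) auto
        show "\<bar>g (Suc i) $ k\<bar> \<le> ?d * (K0 + R)" using i by (intro gb) auto
      qed
      finally show "\<bar>f i $ k - (if k = e i then real (K * K0) else 0)\<bar> \<le> \<rho> * real (K * K0)"
        using small by simp
    next
      fix z :: "nat \<Rightarrow> int"
      \<comment> \<open>The Hessenberg form at work: with y l the value at a l, the i-th equation determines y (i + 1) from its predecessors.\<close>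
      have "\<exists>y :: nat \<Rightarrow> real. y 0 = 0 \<and> (\<forall>i<m. K * y i + (\<Sum>l<Suc (Suc i). c l (g (Suc i)) * y l) = z i)"
        if "m \<le> ?d - 1" for m
        using that
      proof (induction m)
        case 0
        show ?case by (rule exI[of _ "\<lambda>_. 0"]) simp
      next
        case (Suc m)
        then obtain y :: "nat \<Rightarrow> real" where y: "y 0 = 0"
          "\<And>i. i < m \<Longrightarrow> K * y i + (\<Sum>l<Suc (Suc i). c l (g (Suc i)) * y l) = z i" by auto
        \<comment> \<open>The coefficient of the new unknown is positive by the choice of g.\<close>
        define t where "t = (z m - K * y m - (\<Sum>l<Suc m. c l (g (Suc m)) * y l)) / c (Suc m) (g (Suc m))"
        have nz: "c (Suc m) (g (Suc m)) \<noteq> 0" 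
        proof -
          have "Suc m < ?d" using Suc.prems by linarith
          then show ?thesis using g(3)[of "Suc m"] by simp
        qed
        define y' where "y' = y(Suc m := t)"
        have y': "y' l = y l" if "l < Suc m" for l using that by (simp add: y'_def)
        have "K * y' i + (\<Sum>l<Suc (Suc i). c l (g (Suc i)) * y' l) = z i" if i: "i < Suc m" for i
        proof (cases "i = m")
          case True
          have "(\<Sum>l<Suc m. c l (g (Suc m)) * y' l) = (\<Sum>l<Suc m. c l (g (Suc m)) * y l)"
            by (rule sum.cong) (auto simp: y')
          then show ?thesis unfolding True sum.lessThan_Suc[of _ "Suc m"]
            using nz y'[of m] by (simp add: t_def y'_def)
        next
          case False
          then have "i < m" using i by simp
          moreover have "(\<Sum>l<Suc (Suc i). c l (g (Suc i)) * y' l) = (\<Sum>l<Suc (Suc i). c l (g (Suc i)) * y l)"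
            using \<open>i < m\<close> by (intro sum.cong) (auto simp: y')
          ultimately show ?thesis using y(2)[of i] y'[of i] by simp
        qed
        moreover have "y' 0 = 0" using y(1) by (simp add: y'_def)
        ultimately show ?case by blast
      qed
      from this[of "?d - 1"] obtain y :: "nat \<Rightarrow> real" where y: "y 0 = 0"
        "\<And>i. i < ?d - 1 \<Longrightarrow> K * y i + (\<Sum>l<Suc (Suc i). c l (g (Suc i)) * y l) = z i" by auto
      define \<phi> where "\<phi> v = (\<Sum>l<?d. c l v * y l)" for v
      have lin: "linear \<phi>" unfolding \<phi>_def
        by (auto intro!: linearI simp: linear_add[OF c(1)] linear_scale[OF c(1)] sum.distrib
            sum_distrib_left algebra_simps)
      have \<phi>a: "\<phi> (a i) = y i" if "i < ?d" for i
      proof -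
        have "\<phi> (a i) = (\<Sum>l<?d. if l = i then y l else 0)"
          unfolding \<phi>_def using that by (intro sum.cong) (auto simp: c(3))
        then show ?thesis using that by simp
      qed
      have \<phi>g: "\<phi> (g i) = (\<Sum>l<Suc i. c l (g i) * y l)" if "i < ?d" for i
        unfolding \<phi>_def using that g(2) by (intro sum.mono_neutral_right) auto
      have \<phi>f: "\<phi> (f i) = z i" if "i < ?d - 1" for i
        using y(2)[OF that] \<phi>a[of i] \<phi>g[of "Suc i"] that
        by (simp add: f_def linear_add[OF lin] linear_scale[OF lin])
      have int_sum: "\<phi> (\<Sum>j<m. of_int (k j) *\<^sub>R g j) \<in> \<int>" if "\<And>j. j < m \<Longrightarrow> \<phi> (g j) \<in> \<int>" for m and k :: "nat \<Rightarrow> int"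
        using that by (auto simp: linear_sum[OF lin] linear_scale[OF lin])
      \<comment> \<open>Integrality propagates, since a (i - 1) is an integral combination of g 0, ..., g (i - 1).\<close>
      have \<phi>gi: "\<phi> (g i) \<in> \<int>" if "i < ?d" for i
        using that
      proof (induction i rule: less_induct)
        case (less i)
        show ?case
        proof (cases i)
          case 0
          then show ?thesis using \<phi>g[of 0] y(1) less.prems by simp
        next
          case (Suc m)
          then have m: "m < ?d - 1" "m < ?d" using less.prems by auto
          have "\<exists>k :: nat \<Rightarrow> int. a m = (\<Sum>j<Suc m. of_int (k j) *\<^sub>R g j)"
            by (rule gen) (use m in \<open>auto simp: a(1) c(3)\<close>)
          then obtain k :: "nat \<Rightarrow> int" where k: "a m = (\<Sum>j<Suc m. of_int (k j) *\<^sub>R g j)" by blast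
          have "\<phi> (a m) \<in> \<int>" unfolding k
            by (rule int_sum) (use less Suc in auto)
          moreover have "\<phi> (g i) = z m - K * \<phi> (a m)"
            using \<phi>f[OF m(1)] Suc by (simp add: f_def linear_add[OF lin] linear_scale[OF lin])
          ultimately show ?thesis by simp
        qed
      qed
      show "\<exists>\<phi> :: real ^ 'd \<Rightarrow> real. linear \<phi> \<and> (\<forall>v\<in>D. \<phi> v \<in> \<int>) \<and> (\<forall>i<?d - 1. \<phi> (f i) = z i)"
      proof (rule exI[of _ \<phi>], intro conjI ballI allI impI lin \<phi>f)
        fix v assume v: "v \<in> D"
        have "\<exists>k :: nat \<Rightarrow> int. v = (\<Sum>j<?d. of_int (k j) *\<^sub>R g j)"
          by (rule gen) (use v in auto)
        then obtain k :: "nat \<Rightarrow> int" where k: "v = (\<Sum>j<?d. of_int (k j) *\<^sub>R g j)" by blast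
        show "\<phi> v \<in> \<int>" unfolding k by (rule int_sum[OF \<phi>gi])
      qed
    qed
  qed
qed

section \<open>Rational points with almost maximal denominator\<close>

lemma int_vecs_subgroup: "additive_subgroup int_vecs"
  by (auto simp: additive_subgroup_def int_vecs_def)

lemma near_scalar_matrix_error:
  fixes A :: "real ^ 'n ^ 'n" and L \<rho> h :: real
  assumes A: "\<And>i j. \<bar>A $ i $ j - (if i = j then L else 0)\<bar> \<le> \<rho> * L" and x: "\<And>i. \<bar>x $ i\<bar> \<le> h"
  shows "\<bar>(A *v x) $ k - L * x $ k\<bar> \<le> CARD('n) * \<rho> * L * h"
proof -
  have "(A *v x) $ k = (\<Sum>j\<in>UNIV. (A $ k $ j - (if k = j then L else 0)) * x $ j) + (\<Sum>j\<in>UNIV. (if k = j then L else 0) * x $ j)"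
    by (simp add: matrix_vector_mult_def sum.distrib[symmetric] algebra_simps)
  also have "(\<Sum>j\<in>UNIV. (if k = j then L else 0) * x $ j) = L * x $ k"
    by (simp add: if_distrib[of "\<lambda>t. t * _"] sum.delta cong: if_cong)
  finally have "\<bar>(A *v x) $ k - L * x $ k\<bar> = \<bar>\<Sum>j\<in>UNIV. (A $ k $ j - (if k = j then L else 0)) * x $ j\<bar>"
    by simp
  also have "\<dots> \<le> (\<Sum>j\<in>UNIV. \<bar>(A $ k $ j - (if k = j then L else 0)) * x $ j\<bar>)" by (rule sum_abs)
  also have "\<dots> \<le> (\<Sum>j\<in>(UNIV::'n set). (\<rho> * L) * h)"
    unfolding abs_mult
  proof (intro sum_mono mult_mono A x)
    show "0 \<le> \<rho> * L" using A[of k k] by (meson abs_ge_zero order_trans)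
  qed auto
  finally show ?thesis by simp
qed

lemma near_scalar_matrix_lower_bound:
  fixes A :: "real ^ 'n ^ 'n" and L \<rho> h :: real
  assumes A: "\<And>i j. \<bar>A $ i $ j - (if i = j then L else 0)\<bar> \<le> \<rho> * L" and L: "0 \<le> L"
    and x: "\<And>i. \<bar>(A *v x) $ i\<bar> \<le> h"
  shows "L * (1 - CARD('n) * \<rho>) * \<bar>x $ i\<bar> \<le> h"
proof -
  obtain k where k: "\<And>i. \<bar>x $ i\<bar> \<le> \<bar>x $ k\<bar>" using exists_max_coord by blast
  have "\<bar>L * x $ k\<bar> \<le> h + CARD('n) * \<rho> * L * \<bar>x $ k\<bar>"
    using near_scalar_matrix_error[OF A k, of k] x[of k] by linarith
  then have b: "L * (1 - CARD('n) * \<rho>) * \<bar>x $ k\<bar> \<le> h"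
    using L by (simp add: abs_mult algebra_simps)
  have h: "0 \<le> h" using x[of k] by linarith
  show ?thesis
  proof (cases "0 \<le> L * (1 - CARD('n) * \<rho>)")
    case True
    then show ?thesis using b k[of i] by (meson mult_left_mono order_trans)
  next
    case False
    then show ?thesis using h by (meson mult_nonpos_nonneg abs_ge_zero order_trans linear not_le)
  qed
qed

lemma near_scalar_matrix_upper_bound:
  fixes A :: "real ^ 'n ^ 'n" and L \<rho> h :: real
  assumes A: "\<And>i j. \<bar>A $ i $ j - (if i = j then L else 0)\<bar> \<le> \<rho> * L" and L: "0 \<le> L"
    and x: "\<And>i. \<bar>x $ i\<bar> \<le> h"
  shows "\<bar>(A *v x) $ k\<bar> \<le> L * (1 + CARD('n) * \<rho>) * h"
proof -
  have "\<bar>L * x $ k\<bar> \<le> L * h" using x[of k] L by (simp add: abs_mult mult_left_mono)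
  then have "\<bar>(A *v x) $ k\<bar> \<le> L * h + CARD('n) * \<rho> * L * h"
    using near_scalar_matrix_error[OF A x, of k] by linarith
  then show ?thesis by (simp add: algebra_simps)
qed

lemma near_scalar_matrix_surj:
  fixes A :: "real ^ 'n ^ 'n" and L \<rho> :: real
  assumes A: "\<And>i j. \<bar>A $ i $ j - (if i = j then L else 0)\<bar> \<le> \<rho> * L" and L: "0 < L" "CARD('n) * \<rho> < 1"
  shows "\<exists>x. A *v x = y"
proof -
  have "inj ((*v) A)"
  proof (rule linear_injective_0[THEN iffD2], simp, intro allI impI)
    fix x assume "A *v x = 0"
    then have "L * (1 - CARD('n) * \<rho>) * \<bar>x $ i\<bar> \<le> 0" for i
      using near_scalar_matrix_lower_bound[of A L \<rho> x 0] A L(1) by simp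
    moreover have "0 < L * (1 - CARD('n) * \<rho>)" using L by simp
    ultimately have "\<bar>x $ i\<bar> \<le> 0" for i by (metis mult_le_0_iff not_less)
    then show "x = 0" by (simp add: vec_eq_iff)
  qed
  then have "surj ((*v) A)" by (simp add: linear_injective_imp_surjective)
  then show ?thesis by (metis surjD)
qed

text \<open>
  By hypothesis A maps Z^n + Z Y onto Z^n, so Z^n + Z Y is so dense that every point of the unit cube
  is within 1 / (2 L (1 - n \<rho>)) of it. Its classes modulo Z^n are represented by multiples of Y, of which at most
  |q0| are different. Grid points of mesh 1/m are too far apart, modulo Z^n, for two of them
  to be close to the same class.
\<close>
lemma denominator_lower_bound:
  fixes A :: "real ^ 'n ^ 'n" and Y :: "real ^ 'n" and L \<rho> q0 :: real
  assumes A: "\<And>i j. \<bar>A $ i $ j - (if i = j then L else 0)\<bar> \<le> \<rho> * L" and L: "0 < L" "CARD('n) * \<rho> < 1"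
    and surj: "\<And>z. z \<in> int_vecs \<Longrightarrow> \<exists>p q. p \<in> int_vecs \<and> q \<in> \<int> \<and> A *v (p + q *\<^sub>R Y) = z"
    and q0: "q0 \<in> \<int>" "q0 \<noteq> 0" "q0 *\<^sub>R Y \<in> int_vecs"
    and m: "real m < L * (1 - CARD('n) * \<rho>)"
  shows "real m ^ CARD('n) \<le> \<bar>q0\<bar>"
proof -
  obtain q1 :: int where q1: "q0 = of_int q1" using q0(1) by (elim Ints_cases)
  \<comment> \<open>A period of the multiples of Y modulo the integral vectors.\<close>
  define Q where "Q = \<bar>q1\<bar>"
  have Q: "0 < Q" using q0(2) q1 by (simp add: Q_def)
  have QY: "real_of_int Q *\<^sub>R Y \<in> int_vecs"
    using q0(3) unfolding Q_def q1 by (cases "q1 \<ge> 0") (auto simp: int_vecs_def)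
  let ?K = "PiE (UNIV :: 'n set) (\<lambda>_. {..<m})"
  define x where "x k = (\<chi> i. real (k i) / real m)" for k :: "'n \<Rightarrow> nat"
  have "\<exists>q :: int. \<exists>p. p \<in> int_vecs \<and> (\<forall>i. \<bar>(A *v (x k - (p + of_int q *\<^sub>R Y))) $ i\<bar> \<le> 1 / 2)" for k
  proof -
    define z :: "real ^ 'n" where "z = (\<chi> i. of_int (round ((A *v x k) $ i)))"
    have "z \<in> int_vecs" by (simp add: z_def int_vecs_def)
    from surj[OF this] obtain p q where pq: "p \<in> int_vecs" "q \<in> \<int>" "A *v (p + q *\<^sub>R Y) = z" by blast
    obtain q' :: int where q': "q = of_int q'" using pq(2) by (elim Ints_cases)
    have "\<bar>(A *v (x k - (p + q *\<^sub>R Y))) $ i\<bar> \<le> 1 / 2" for i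
      using of_int_round_abs_le[of "(A *v x k) $ i"] pq(3)
      by (simp add: matrix_vector_mult_diff_distrib z_def abs_minus_commute)
    then show ?thesis using pq(1) q' by blast
  qed
  then obtain q :: "('n \<Rightarrow> nat) \<Rightarrow> int" and p where
    pq: "\<And>k. p k \<in> int_vecs" "\<And>k i. \<bar>(A *v (x k - (p k + of_int (q k) *\<^sub>R Y))) $ i\<bar> \<le> 1 / 2"
    by metis
  have "inj_on (\<lambda>k. q k mod Q) ?K"
  proof (rule inj_onI)
    fix k k' assume k: "k \<in> ?K" "k' \<in> ?K" and eq: "q k mod Q = q k' mod Q"
    then obtain l where l: "q k = q k' + Q * l" by (metis mod_eqE mult.commute add.commute mod_eq_dvd_iff dvdE diff_add_cancel)
    define u where "u = p k - p k' + of_int l *\<^sub>R (of_int Q *\<^sub>R Y)"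
    have u: "u \<in> int_vecs" unfolding u_def
      by (intro additive_subgroupD(2,4)[OF int_vecs_subgroup] additive_subgroup_scale_int[OF int_vecs_subgroup] pq(1) QY)
    have "x k - x k' - u = (x k - (p k + of_int (q k) *\<^sub>R Y)) - (x k' - (p k' + of_int (q k') *\<^sub>R Y))"
      by (simp add: u_def l algebra_simps)
    then have "A *v (x k - x k' - u) = A *v (x k - (p k + of_int (q k) *\<^sub>R Y)) - A *v (x k' - (p k' + of_int (q k') *\<^sub>R Y))"
      by (simp only: matrix_vector_mult_diff_distrib)
    then have "\<bar>(A *v (x k - x k' - u)) $ i\<bar> \<le> 1" for i
      using pq(2)[of k i] pq(2)[of k' i] by simp
    then have b: "L * (1 - CARD('n) * \<rho>) * \<bar>(x k - x k' - u) $ i\<bar> \<le> 1" for i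
      using near_scalar_matrix_lower_bound[OF A less_imp_le[OF L(1)]] by blast
    show "k = k'"
    proof
      fix i
      have ki: "k i < m" "k' i < m" using k by (auto simp: PiE_def)
      then have m0: "0 < m" by simp
      obtain w :: int where w: "u $ i = of_int w" using u unfolding int_vecs_def by (auto elim: Ints_cases)
      define t where "t = int (k i) - int (k' i) - w * int m"
      have t: "(x k - x k' - u) $ i = of_int t / m" using m0 by (simp add: x_def w t_def field_simps)
      have "t = 0"
      proof (rule ccontr)
        assume "t \<noteq> 0"
        then have "1 \<le> \<bar>t\<bar>" by simp
        then have "1 \<le> real_of_int \<bar>t\<bar>" by linarith
        moreover have "L * (1 - CARD('n) * \<rho>) * real_of_int \<bar>t\<bar> \<le> m"
          using b[of i] m0 unfolding t by (simp add: field_simps)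
        moreover have "0 < L * (1 - CARD('n) * \<rho>)" using L by simp
        ultimately show False using m
          by (metis less_le_not_le mult_le_cancel_left1 order_trans)
      qed
      then have "int (k i) - int (k' i) = w * int m" by (simp add: t_def)
      moreover have "\<bar>int (k i) - int (k' i)\<bar> < int m" using ki by linarith
      ultimately have "w = 0"
        by (metis abs_mult abs_of_nat mult_le_cancel_right1 not_less zero_less_abs_iff zless_imp_add1_zle add_0 abs_ge_zero of_nat_0_le_iff)
      then show "k i = k' i" using \<open>int (k i) - int (k' i) = w * int m\<close> by simp
    qed
  qed
  then have "card ?K \<le> card {0..<Q}"
    by (rule card_inj_on_le) (use Q in auto)
  then have "m ^ CARD('n) \<le> nat Q" by (simp add: card_PiE)
  then have "real (m ^ CARD('n)) \<le> real (nat Q)" by (rule of_nat_mono)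
  then show ?thesis using Q q1 by (simp add: Q_def)
qed

text \<open>
  The lattice of all (p, q) after the shear by Y and the diagonal flow: a vector of sup norm at most \<epsilon>
  is a solution of |p + q Y| \<le> \<epsilon> / N, |q| \<le> \<epsilon> N^n. The coordinate None carries q; its sign is chosen such that the
  pairing with the dual points below is integral.
\<close>
definition primal_point :: "real ^ 'n \<Rightarrow> real \<Rightarrow> real ^ 'n \<Rightarrow> real \<Rightarrow> real ^ 'n option" where
  "primal_point Y N p q = (\<chi> k. case k of Some i \<Rightarrow> N * (p $ i + q * Y $ i) | None \<Rightarrow> - q / N ^ CARD('n))"

text \<open>
  The affine form a . y + b, in the coordinates dual to the previous ones.
\<close>
definition dual_point :: "real ^ 'n \<Rightarrow> real \<Rightarrow> real ^ 'n \<Rightarrow> real \<Rightarrow> real ^ 'n option" where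
  "dual_point Y N a b = (\<chi> k. case k of Some i \<Rightarrow> a $ i / N | None \<Rightarrow> N ^ CARD('n) * (a \<bullet> Y + b))"

definition primal_lattice :: "real ^ 'n \<Rightarrow> real \<Rightarrow> (real ^ 'n option) set" where
  "primal_lattice Y N = {primal_point Y N p q | p q. p \<in> int_vecs \<and> q \<in> \<int>}"

definition dual_lattice :: "real ^ 'n \<Rightarrow> real \<Rightarrow> (real ^ 'n option) set" where
  "dual_lattice Y N = {dual_point Y N a b | a b. a \<in> int_vecs \<and> b \<in> \<int>}"

lemma sum_option: "(\<Sum>k\<in>UNIV. f k) = f None + (\<Sum>i\<in>UNIV. f (Some i))"
  for f :: "'n::finite option \<Rightarrow> 'a::comm_monoid_add"
  by (simp add: UNIV_option_conv sum.reindex)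

lemma prod_option: "(\<Prod>k\<in>UNIV. f k) = f None * (\<Prod>i\<in>UNIV. f (Some i))"
  for f :: "'n::finite option \<Rightarrow> 'a::comm_monoid_mult"
  by (simp add: UNIV_option_conv prod.reindex)

lemma primal_inner_dual:
  assumes "0 < N"
  shows "primal_point Y N p q \<bullet> dual_point Y N a b = a \<bullet> p - q * b"
proof -
  have "primal_point Y N p q \<bullet> dual_point Y N a b =
      - q * (a \<bullet> Y + b) + (\<Sum>i\<in>UNIV. (p $ i + q * Y $ i) * a $ i)"
    using assms by (simp add: inner_vec_def sum_option primal_point_def dual_point_def)
  also have "(\<Sum>i\<in>UNIV. (p $ i + q * Y $ i) * a $ i) = a \<bullet> p + q * (a \<bullet> Y)"
    by (simp add: inner_vec_def sum.distrib sum_distrib_left algebra_simps)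
  finally show ?thesis by (simp add: algebra_simps)
qed

lemma primal_dual_integral:
  assumes "0 < N" "x \<in> primal_lattice Y N" "v \<in> dual_lattice Y N"
  shows "x \<bullet> v \<in> \<int>"
proof -
  obtain p q a b where "x = primal_point Y N p q" "v = dual_point Y N a b"
    "p \<in> int_vecs" "q \<in> \<int>" "a \<in> int_vecs" "b \<in> \<int>"
    using assms by (auto simp: primal_lattice_def dual_lattice_def)
  then show ?thesis
    using assms(1) by (auto simp: primal_inner_dual intro!: Ints_diff int_vecs_inner)
qed

lemma primal_point_bound:
  fixes Y :: "real ^ 'n"
  assumes "0 < N"
  shows "(\<forall>k. \<bar>primal_point Y N p q $ k\<bar> \<le> \<beta> k) \<longleftrightarrow>
    \<bar>q\<bar> \<le> \<beta> None * N ^ CARD('n) \<and> (\<forall>i. \<bar>p $ i + q * Y $ i\<bar> \<le> \<beta> (Some i) / N)"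
  using assms
  by (simp add: split_option_all primal_point_def abs_mult pos_le_divide_eq pos_divide_le_eq
      mult.commute[of N "\<bar>_\<bar>"])

lemma short_free_primal:
  fixes Y :: "real ^ 'n"
  assumes "0 < N"
  shows "short_free (primal_lattice Y N) \<epsilon> \<longleftrightarrow>
    (\<forall>p q. p \<in> int_vecs \<longrightarrow> q \<in> \<int> \<longrightarrow> \<bar>q\<bar> \<le> \<epsilon> * N ^ CARD('n) \<longrightarrow> (\<forall>i. \<bar>p $ i + q * Y $ i\<bar> \<le> \<epsilon> / N) \<longrightarrow> p = 0 \<and> q = 0)"
proof -
  have "(\<forall>k. \<bar>primal_point Y N p q $ k\<bar> \<le> \<epsilon>) \<longleftrightarrow> \<bar>q\<bar> \<le> \<epsilon> * N ^ CARD('n) \<and> (\<forall>i. \<bar>p $ i + q * Y $ i\<bar> \<le> \<epsilon> / N)" for p q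
    by (rule primal_point_bound[OF assms])
  moreover have "primal_point Y N p q = 0 \<longleftrightarrow> p = 0 \<and> q = 0" for p q
    using assms by (auto simp: split_option_all primal_point_def vec_eq_iff)
  ultimately show ?thesis unfolding short_free_def primal_lattice_def by blast
qed

lemma minkowski_primal:
  fixes Y :: "real ^ 'n"
  assumes N: "0 < N"
  shows "minkowski (primal_lattice Y N)"
  unfolding minkowski_def
proof (intro allI impI, elim conjE)
  fix \<beta> :: "'n option \<Rightarrow> real" assume \<beta>: "\<forall>i. 0 < \<beta> i" "2 ^ CARD('n option) \<le> (\<Prod>i\<in>UNIV. \<beta> i)"
  have "(2::real) ^ CARD('n) \<le> 2 ^ CARD('n option)" by simp
  also have "\<dots> \<le> \<beta> None * N ^ CARD('n) * (\<Prod>i\<in>UNIV. \<beta> (Some i) / N)"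
    using \<beta>(2) N by (simp add: prod_option prod_dividef)
  finally obtain p q where pq: "p \<in> int_vecs" "q \<in> \<int>" "p \<noteq> 0 \<or> q \<noteq> 0"
    "\<bar>q\<bar> \<le> \<beta> None * N ^ CARD('n)" "\<And>i. \<bar>p $ i + q * Y $ i\<bar> \<le> \<beta> (Some i) / N"
    by (rule dirichlet_simultaneous[rotated]) (use \<beta> N in auto)
  show "\<exists>x\<in>primal_lattice Y N. x \<noteq> 0 \<and> (\<forall>i. \<bar>x $ i\<bar> \<le> \<beta> i)"
  proof (intro bexI conjI)
    show "primal_point Y N p q \<in> primal_lattice Y N" using pq by (auto simp: primal_lattice_def)
    show "primal_point Y N p q \<noteq> 0"
      using pq(3) N by (auto simp: split_option_all primal_point_def vec_eq_iff)
    show "\<forall>i. \<bar>primal_point Y N p q $ i\<bar> \<le> \<beta> i"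
      using pq(4,5) unfolding primal_point_bound[OF N] by blast
  qed
qed

lemma dual_point_in: "a \<in> int_vecs \<Longrightarrow> b \<in> \<int> \<Longrightarrow> dual_point Y N a b \<in> dual_lattice Y N"
  by (auto simp: dual_lattice_def)

lemma minkowski_dual:
  fixes Y :: "real ^ 'n"
  assumes N: "0 < N"
  shows "minkowski (dual_lattice Y N)"
  unfolding minkowski_def
proof (intro allI impI, elim conjE)
  fix \<beta> :: "'n option \<Rightarrow> real" assume \<beta>: "\<forall>i. 0 < \<beta> i" "2 ^ CARD('n option) \<le> (\<Prod>i\<in>UNIV. \<beta> i)"
  have "(2::real) \<le> 2 ^ CARD('n option)" by simp
  also have "\<dots> \<le> \<beta> None / N ^ CARD('n) * (\<Prod>i\<in>UNIV. \<beta> (Some i) * N)"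
    using \<beta>(2) N by (simp add: prod_option prod.distrib)
  finally obtain a b where ab: "a \<in> int_vecs" "b \<in> \<int>" "a \<noteq> 0 \<or> b \<noteq> 0"
    "\<And>i. \<bar>a $ i\<bar> \<le> \<beta> (Some i) * N" "\<bar>a \<bullet> Y + b\<bar> \<le> \<beta> None / N ^ CARD('n)"
    by (rule dirichlet_form[rotated 2]) (use \<beta> N in auto)
  show "\<exists>x\<in>dual_lattice Y N. x \<noteq> 0 \<and> (\<forall>i. \<bar>x $ i\<bar> \<le> \<beta> i)"
  proof (intro bexI conjI)
    show "dual_point Y N a b \<in> dual_lattice Y N" using ab by (auto simp: dual_lattice_def)
    show "dual_point Y N a b \<noteq> 0"
    proof
      assume 0: "dual_point Y N a b = 0"
      then have a: "a = 0" using N by (auto simp: split_option_all dual_point_def vec_eq_iff)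
      then show False using 0 ab(3) N unfolding a by (auto simp: split_option_all dual_point_def vec_eq_iff)
    qed
    show "\<forall>i. \<bar>dual_point Y N a b $ i\<bar> \<le> \<beta> i"
      using ab(4,5) N
      by (simp add: split_option_all dual_point_def abs_mult pos_le_divide_eq pos_divide_le_eq
          mult.commute[of "\<bar>_\<bar>"])
  qed
qed

lemma dual_subgroup: "additive_subgroup (dual_lattice (Y :: real ^ 'n) N)"
proof -
  have *: "dual_point Y N a b - dual_point Y N a' b' = dual_point Y N (a - a') (b - b')" for a b a' b'
    by (simp add: vec_eq_iff split_option_all dual_point_def inner_diff_left diff_divide_distrib algebra_simps)
  have 0: "0 = dual_point Y N 0 0"
    by (simp add: vec_eq_iff split_option_all dual_point_def)
  show ?thesis
    unfolding additive_subgroup_def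
  proof (intro conjI ballI)
    show "0 \<in> dual_lattice Y N" 
      unfolding 0 dual_lattice_def by (intro CollectI exI[of _ 0]) (simp add: int_vecs_def)
    fix x y assume "x \<in> dual_lattice Y N" "y \<in> dual_lattice Y N"
    then show "x - y \<in> dual_lattice Y N"
      unfolding dual_lattice_def using * int_vecs_diff Ints_diff by blast
  qed
qed

definition dirichlet_solvable :: "real \<Rightarrow> nat \<Rightarrow> real ^ 'n \<Rightarrow> bool" where
  "dirichlet_solvable \<sigma> N Y \<longleftrightarrow> (\<exists>p\<in>int_vecs. \<exists>q\<in>\<int>.
     (q \<noteq> 0 \<and> \<bar>q\<bar> \<le> \<sigma> * real N ^ CARD('n)) \<and> (\<forall>i. \<bar>p $ i + q * Y $ i\<bar> \<le> \<sigma> / real N))"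

text \<open>
  The distance 1/4 keeps Y' inside the grid cube of side N^-(n+1) centered at Y.
\<close>
definition has_hole :: "real \<Rightarrow> real \<Rightarrow> nat \<Rightarrow> real ^ 'n \<Rightarrow> bool" where
  "has_hole \<sigma> \<eta> N Y \<longleftrightarrow> (\<exists>Y' N'. N \<le> N' \<and> (\<forall>i. \<bar>Y' $ i - Y $ i\<bar> \<le> 1 / 4 / real N ^ (CARD('n) + 1)) \<and>
     (\<forall>Y''. (\<forall>i. \<bar>Y'' $ i - Y' $ i\<bar> \<le> \<eta> / real N ^ (CARD('n) + 1)) \<longrightarrow> \<not> dirichlet_solvable \<sigma> N' Y''))"

text \<open>
  The n forms obtained from primitive_tuple_near_axes for the dual lattice vanish simultaneously at one point Y', which is
  close to Y because the values of the forms at Y are small compared with their linear parts. A solution of Dirichlet's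
  system at Y' for T N gives integral values less than 1 to all the forms, so q Y' is integral and q is at
  least the denominator of Y', which denominator_lower_bound shows to be more than \<sigma> (T N)^n. The points close to Y' are covered by
  allowing \<tau> > \<sigma> in place of \<sigma> at Y' itself.
\<close>
lemma hole_exists:
  fixes \<epsilon> \<sigma> :: real
  assumes \<epsilon>: "0 < \<epsilon>" and \<sigma>: "0 < \<sigma>" "\<sigma> < 1"
  obtains \<eta> :: real where "0 < \<eta>"
    "\<And>(Y :: real ^ 'n) N. (0::nat) < N \<Longrightarrow> short_free (primal_lattice Y N) \<epsilon> \<Longrightarrow> has_hole \<sigma> \<eta> N Y"
proof -
  let ?n = "CARD('n)" and ?d = "CARD('n option)"
  define e2 where "e2 = 1 / (2 * (2 ^ ?d / (\<epsilon> / ?d) ^ (?d - 1) + \<epsilon>))"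
  have pos: "0 < 2 ^ ?d / (\<epsilon> / ?d) ^ (?d - 1) + \<epsilon>" using \<epsilon> by (intro add_nonneg_pos) auto
  have e2: "0 < e2" "e2 * (2 ^ ?d / (\<epsilon> / ?d) ^ (?d - 1) + \<epsilon>) < 1"
    using pos by (auto simp: e2_def field_simps)
  define R where "R = ?d * (2 ^ ?d / (e2 / ?d) ^ (?d - 1) + e2)"
  have R: "0 \<le> R" using e2(1) by (simp add: R_def)
  define \<tau> where "\<tau> = (1 + \<sigma>) / 2"
  have \<tau>: "\<sigma> < \<tau>" "\<tau> < 1" using \<sigma> by (auto simp: \<tau>_def)
  \<comment> \<open>Small enough for Bernoulli's inequality to give (1 - (n + 2) \<rho>)^n > \<sigma> at the end.\<close>
  define \<rho> where "\<rho> = (1 - \<tau>) / (8 * (real ?n * (real ?n + 2)))"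
  have n1: "1 \<le> real ?n" by (simp add: Suc_leI)
  have \<rho>0: "0 < \<rho>" using \<tau> n1 unfolding \<rho>_def by (intro divide_pos_pos mult_pos_pos) linarith+
  have \<rho>n: "?n * (real ?n + 2) * \<rho> = (1 - \<tau>) / 8" using n1 by (simp add: \<rho>_def)
  have n2: "?n * \<rho> \<le> ?n * (real ?n + 2) * \<rho>" "\<rho> \<le> ?n * \<rho>" "(real ?n + 2) * \<rho> \<le> ?n * (real ?n + 2) * \<rho>"
    using n1 \<rho>0 by (auto simp: mult_le_cancel_right mult_le_cancel_left1)
  have n3: "?n * \<rho> \<le> (1 - \<tau>) / 8" "(real ?n + 2) * \<rho> \<le> (1 - \<tau>) / 8" using n2 \<rho>n by linarith+
  have t8: "(1 - \<tau>) / 8 \<le> 1 / 8" using \<tau> \<sigma> by simp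
  have n4: "?n * \<rho> \<le> 1 / 8" "\<rho> \<le> 1 / 8" "(real ?n + 2) * \<rho> \<le> 1 / 8"
    by (rule order_trans[OF _ t8], rule n3, rule order_trans[OF n2(2)], rule order_trans[OF _ t8], rule n3,
        rule order_trans[OF _ t8], rule n3)
  obtain h where h: "bij_betw h {0..<?n} (UNIV :: 'n set)" using ex_bij_betw_nat_finite[of "UNIV :: 'n set"] by auto
  \<comment> \<open>The coordinate None comes last in the enumeration, so that the n forms are close to the remaining axes.\<close>
  define e where "e k = (if k < ?n then Some (h k) else None)" for k
  have e: "bij_betw e {..<?d} UNIV"
  proof -
    have "inj_on e {..<?d}"
      using h by (auto simp: inj_on_def e_def bij_betw_def less_Suc_eq)
    moreover have "e ` {..<?d} = UNIV"
    proof -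
      have "k \<in> e ` {..<?d}" for k
      proof (cases k)
        case None
        then show ?thesis by (auto simp: e_def intro!: image_eqI[of _ _ ?n])
      next
        case (Some i)
        have "i \<in> h ` {0..<?n}" using h by (simp add: bij_betw_def)
        then obtain j where "j < ?n" "h j = i" by auto
        then show ?thesis using Some by (auto simp: e_def intro!: image_eqI[of _ _ j])
      qed
      then show ?thesis by auto
    qed
    ultimately show ?thesis by (simp add: bij_betw_def)
  qed
  define l where "l = inv_into {0..<?n} h"
  have l: "l i < ?n" "h (l i) = i" for i
    using h inv_into_into[of i h "{0..<?n}"] f_inv_into_f[of i h "{0..<?n}"]
    unfolding l_def bij_betw_def by auto
  obtain T :: nat where T: "1 / \<rho> \<le> T" "0 < T" and flag:
    "\<And>(D :: (real ^ 'n option) set) \<epsilon>. additive_subgroup D \<Longrightarrow> short_free D \<epsilon> \<Longrightarrow> 0 < \<epsilon> \<Longrightarrow>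
       (\<And>v. \<exists>f\<in>D. \<forall>i. \<bar>v $ i - f $ i\<bar> \<le> R) \<Longrightarrow>
       \<exists>f. primitive_tuple D (?d - 1) f \<and>
         (\<forall>i<?d - 1. \<forall>k. \<bar>f i $ k - (if k = e i then real T else 0)\<bar> \<le> \<rho> * T)"
    using primitive_tuple_near_axes[OF e R \<rho>0] by blast
  define \<eta> where "\<eta> = (\<tau> - \<sigma>) / T ^ (?n + 1)"
  show thesis
  proof (rule that[of \<eta>])
    show "0 < \<eta>" using \<tau> T by (simp add: \<eta>_def)
    fix Y :: "real ^ 'n" and N :: nat
    assume N: "0 < N" and sf: "short_free (primal_lattice Y N) \<epsilon>"
    let ?D = "dual_lattice Y (real N)"
    have N': "0 < real N" using N by simp
    have sfD: "short_free ?D e2"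
      by (rule transference[OF _ minkowski_primal[OF N'] sf \<epsilon>])
        (use primal_dual_integral[OF N'] e2(2) in auto)
    have "\<exists>f\<in>?D. \<forall>i. \<bar>v $ i - f $ i\<bar> \<le> R" for v
      using covering_radius[OF dual_subgroup minkowski_dual[OF N'] sfD e2(1) refl, of v]
      unfolding R_def by blast
    from flag[OF dual_subgroup sfD e2(1) this]
    obtain f :: "nat \<Rightarrow> real ^ 'n option" where "primitive_tuple ?D ?n f"
      "\<forall>i<?n. \<forall>k. \<bar>f i $ k - (if k = e i then real T else 0)\<bar> \<le> \<rho> * T" by auto
    then have f: "\<And>i. i < ?n \<Longrightarrow> f i \<in> ?D"
      "\<And>i k. i < ?n \<Longrightarrow> \<bar>f i $ k - (if k = e i then real T else 0)\<bar> \<le> \<rho> * T"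
      "\<And>z :: nat \<Rightarrow> int. \<exists>\<phi> :: real ^ 'n option \<Rightarrow> real. linear \<phi> \<and> (\<forall>v\<in>?D. \<phi> v \<in> \<int>) \<and> (\<forall>i<?n. \<phi> (f i) = z i)"
      unfolding primitive_tuple_def by blast+
    have "\<exists>a b. a \<in> int_vecs \<and> b \<in> \<int> \<and> f (l i) = dual_point Y N a b" for i
      using f(1)[OF l(1)] unfolding dual_lattice_def by blast
    then obtain a b where ab: "\<And>i. a i \<in> int_vecs" "\<And>i. b i \<in> \<int>" "\<And>i. f (l i) = dual_point Y N (a i) (b i)"
      by metis
    define A :: "real ^ 'n ^ 'n" where "A = (\<chi> i. a i)"
    define L where "L = real (T * N)"
    have L: "0 < L" using T N by (simp add: L_def)
    have A: "\<bar>A $ i $ j - (if i = j then L else 0)\<bar> \<le> \<rho> * L" for i j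
    proof -
      have "\<bar>a i $ j / N - (if j = i then real T else 0)\<bar> \<le> \<rho> * T"
        using f(2)[OF l(1), of i "Some j"] ab(3)[of i] l[of i] by (simp add: e_def dual_point_def)
      then have "\<bar>a i $ j / N - (if j = i then real T else 0)\<bar> * N \<le> \<rho> * T * N"
        by (rule mult_right_mono) simp
      also have "\<bar>a i $ j / N - (if j = i then real T else 0)\<bar> * N = \<bar>(a i $ j / N - (if j = i then real T else 0)) * N\<bar>"
        by (simp add: abs_mult)
      also have "(a i $ j / N - (if j = i then real T else 0)) * N = a i $ j - (if i = j then L else 0)"
        using N' by (auto simp: L_def left_diff_distrib)
      finally show ?thesis by (simp add: A_def L_def mult.assoc)
    qed
    have B: "\<bar>a i \<bullet> Y + b i\<bar> \<le> \<rho> * T / N ^ ?n" for i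
    proof -
      have "\<bar>N ^ ?n * (a i \<bullet> Y + b i)\<bar> \<le> \<rho> * T"
        using f(2)[OF l(1), of i None] ab(3)[of i] l[of i] by (simp add: e_def dual_point_def)
      then show ?thesis using N' by (simp add: abs_mult pos_le_divide_eq mult.commute[of "_ ^ ?n"])
    qed
    have n\<rho>: "?n * \<rho> < 1" using n4 by linarith
    obtain Y' where Y': "A *v Y' = - (\<chi> i. b i)" using near_scalar_matrix_surj[OF A L n\<rho>] by blast
    have AY': "A *v (p + q *\<^sub>R Y') = (\<chi> i. a i \<bullet> p - q * b i)" for p q
    proof -
      have "A *v (p + q *\<^sub>R Y') = A *v p + q *\<^sub>R (A *v Y')"
        by (simp add: matrix_vector_right_distrib matrix_vector_mult_scaleR)
      also have "\<dots> = (\<chi> i. a i \<bullet> p - q * b i)"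
        unfolding Y' by (simp add: vec_eq_iff A_def matrix_vector_mult_def inner_vec_def)
      finally show ?thesis .
    qed
    have surj: "\<exists>p q. p \<in> int_vecs \<and> q \<in> \<int> \<and> A *v (p + q *\<^sub>R Y') = z" if z: "z \<in> int_vecs" for z
    proof -
      have "\<exists>u :: nat \<Rightarrow> int. \<forall>i. z $ i = u (l i)"
      proof (rule exI[of _ "\<lambda>j. \<lfloor>z $ h j\<rfloor>"], rule allI)
        fix i
        have "z $ i \<in> \<int>" using z by (simp add: int_vecs_def)
        then show "z $ i = \<lfloor>z $ h (l i)\<rfloor>" unfolding l(2) by (elim Ints_cases) simp
      qed
      then obtain u :: "nat \<Rightarrow> int" where u: "\<And>i. z $ i = u (l i)" by blast
      obtain \<phi> :: "real ^ 'n option \<Rightarrow> real" where \<phi>: "linear \<phi>" "\<And>v. v \<in> ?D \<Longrightarrow> \<phi> v \<in> \<int>" "\<And>i. i < ?n \<Longrightarrow> \<phi> (f i) = u i"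
        using f(3)[of u] by blast
      define p where "p = (\<chi> j. \<phi> (dual_point Y N (axis j 1) 0))"
      define q where "q = - \<phi> (dual_point Y N 0 1)"
      have "axis j 1 \<in> int_vecs" for j :: 'n by (auto simp: int_vecs_def axis_def)
      then have "p \<in> int_vecs" using \<phi>(2)[OF dual_point_in[OF _ Ints_0]]
        by (simp add: p_def int_vecs_def)
      moreover have "(0 :: real ^ 'n) \<in> int_vecs" by (simp add: int_vecs_def)
      then have "q \<in> \<int>" unfolding q_def by (simp add: \<phi>(2) dual_point_in)
      moreover have "a' \<bullet> p - q * b' = \<phi> (dual_point Y N a' b')" for a' b'
      proof -
        have "dual_point Y N a' b' = (\<Sum>j\<in>UNIV. a' $ j *\<^sub>R dual_point Y N (axis j 1) 0) + b' *\<^sub>R dual_point Y N 0 1"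
          unfolding vec_eq_iff split_option_all
        proof (intro conjI allI)
          show "dual_point Y N a' b' $ None = ((\<Sum>j\<in>UNIV. a' $ j *\<^sub>R dual_point Y N (axis j 1) 0) + b' *\<^sub>R dual_point Y N 0 1) $ None"
            by (simp add: dual_point_def inner_axis' inner_vec_def[of a' Y] sum_distrib_left algebra_simps)
          fix i
          have "(\<Sum>j\<in>UNIV. a' $ j * (axis j 1 $ i / N)) = (\<Sum>j\<in>UNIV. if j = i then a' $ j / N else 0)"
            by (rule sum.cong) (auto simp: axis_def)
          then show "dual_point Y N a' b' $ Some i = ((\<Sum>j\<in>UNIV. a' $ j *\<^sub>R dual_point Y N (axis j 1) 0) + b' *\<^sub>R dual_point Y N 0 1) $ Some i"
            by (simp add: dual_point_def)
        qed
        then show ?thesis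
          by (simp add: linear_add[OF \<phi>(1)] linear_sum[OF \<phi>(1)] linear_scale[OF \<phi>(1)] p_def q_def inner_vec_def mult.commute)
      qed
      then have "A *v (p + q *\<^sub>R Y') = z"
        unfolding AY' using \<phi>(3)[OF l(1)] ab(3) u by (simp add: vec_eq_iff)
      ultimately show ?thesis by blast
    qed
    have close: "\<bar>Y' $ i - Y $ i\<bar> \<le> 1 / 4 / real N ^ (?n + 1)" for i
    proof -
      have "\<bar>(A *v (Y' - Y)) $ i\<bar> \<le> \<rho> * T / N ^ ?n" for i
      proof -
        have "(A *v (Y' - Y)) $ i = - (a i \<bullet> Y + b i)"
          unfolding matrix_vector_mult_diff_distrib Y' by (simp add: A_def matrix_vector_mult_def inner_vec_def)
        then show ?thesis using B[of i] by simp
      qed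
      from near_scalar_matrix_lower_bound[OF A less_imp_le[OF L] this, of i]
      have "L * (1 - ?n * \<rho>) * \<bar>Y' $ i - Y $ i\<bar> \<le> \<rho> * T / N ^ ?n" by simp
      moreover have "L * (1 / 2) * \<bar>Y' $ i - Y $ i\<bar> \<le> L * (1 - ?n * \<rho>) * \<bar>Y' $ i - Y $ i\<bar>"
        using n4 L by (intro mult_right_mono mult_left_mono) auto
      moreover have "\<rho> * T / N ^ ?n \<le> 1 / 8 * T / N ^ ?n"
        using n4 by (intro divide_right_mono mult_right_mono) auto
      ultimately have "L * (1 / 2) * \<bar>Y' $ i - Y $ i\<bar> \<le> 1 / 8 * T / N ^ ?n" by linarith
      then show ?thesis using T N' by (simp add: L_def field_simps)
    qed
    show "has_hole \<sigma> \<eta> N Y"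
      unfolding has_hole_def
    proof (rule exI[of _ Y'], rule exI[of _ "T * N"], intro conjI allI impI close notI)
      show "N \<le> T * N" using T by simp
      fix Y''
      assume Y'': "\<forall>i. \<bar>Y'' $ i - Y' $ i\<bar> \<le> \<eta> / real N ^ (?n + 1)" and "dirichlet_solvable \<sigma> (T * N) Y''"
      then obtain p q where p: "p \<in> int_vecs" and q: "q \<in> \<int>" and q0: "q \<noteq> 0"
        and qb: "\<bar>q\<bar> \<le> \<sigma> * real (T * N) ^ ?n" and pb: "\<forall>i. \<bar>p $ i + q * Y'' $ i\<bar> \<le> \<sigma> / real (T * N)"
        unfolding dirichlet_solvable_def by blast
      have x: "\<bar>(p + q *\<^sub>R Y') $ i\<bar> \<le> \<tau> / L" for i
      proof -
        have "\<bar>q * (Y'' $ i - Y' $ i)\<bar> \<le> L ^ ?n * (\<eta> / real N ^ (?n + 1))"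
          unfolding abs_mult
        proof (rule mult_mono)
          have "\<sigma> * L ^ ?n \<le> 1 * L ^ ?n" using \<sigma> L by (intro mult_right_mono) auto
          then show "\<bar>q\<bar> \<le> L ^ ?n" using qb unfolding L_def by linarith
        qed (use Y'' L in auto)
        also have "\<dots> = (\<tau> - \<sigma>) / L"
          using T N' by (simp add: L_def \<eta>_def power_mult_distrib field_simps)
        finally have "\<bar>q * (Y'' $ i - Y' $ i)\<bar> \<le> (\<tau> - \<sigma>) / L" .
        moreover have "\<bar>p $ i + q * Y'' $ i\<bar> \<le> \<sigma> / L" using pb by (simp add: L_def)
        moreover have "(p + q *\<^sub>R Y') $ i = (p $ i + q * Y'' $ i) - q * (Y'' $ i - Y' $ i)"
          by (simp add: algebra_simps)
        ultimately have "\<bar>(p + q *\<^sub>R Y') $ i\<bar> \<le> \<sigma> / L + (\<tau> - \<sigma>) / L" by linarith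
        then show ?thesis by (simp add: diff_divide_distrib)
      qed
      have "(A *v (p + q *\<^sub>R Y')) $ k = 0" for k
      proof -
        have "\<bar>(A *v (p + q *\<^sub>R Y')) $ k\<bar> \<le> L * (1 + ?n * \<rho>) * (\<tau> / L)"
          by (rule near_scalar_matrix_upper_bound[OF A less_imp_le[OF L] x])
        also have "\<dots> = (1 + ?n * \<rho>) * \<tau>" using L by simp
        also have "\<dots> < 1"
        proof -
          have "(1 + ?n * \<rho>) * \<tau> \<le> \<tau> + ?n * \<rho>"
            using \<tau> \<sigma> n1 \<rho>0 by (simp add: algebra_simps mult_le_cancel_left1)
          also have "\<dots> \<le> \<tau> + (1 - \<tau>) / 8" using n3(1) by (rule add_left_mono)
          also have "\<dots> < 1" using \<tau>(2) by (simp add: field_simps)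
          finally show ?thesis .
        qed
        finally have "\<bar>(A *v (p + q *\<^sub>R Y')) $ k\<bar> < 1" .
        moreover have "(A *v (p + q *\<^sub>R Y')) $ k \<in> \<int>"
          unfolding AY' using int_vecs_inner[OF ab(1) p] q ab(2) by simp
        ultimately show ?thesis using Ints_nonzero_abs_less1 by blast
      qed
      then have "L * (1 - ?n * \<rho>) * \<bar>(p + q *\<^sub>R Y') $ i\<bar> \<le> 0" for i
        using near_scalar_matrix_lower_bound[OF A less_imp_le[OF L], of "p + q *\<^sub>R Y'" 0 i] by simp
      moreover have "0 < L * (1 - ?n * \<rho>)" using L n\<rho> by simp
      ultimately have "\<bar>(p + q *\<^sub>R Y') $ i\<bar> \<le> 0" for i by (metis mult_le_0_iff not_less)
      then have "q *\<^sub>R Y' = - p" by (simp add: vec_eq_iff add_eq_0_iff)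
      then have qY: "q *\<^sub>R Y' \<in> int_vecs" using p by (simp add: int_vecs_def)
      \<comment> \<open>Besides n \<rho>, one \<rho> makes the inequality for m strict; a further one, in the lower bound below, pays for rounding m.\<close>
      define m where "m = nat \<lfloor>L * (1 - (real ?n + 1) * \<rho>)\<rfloor>"
      have g0: "0 \<le> L * (1 - (real ?n + 1) * \<rho>)" using L n4(3) \<rho>0 by (intro mult_nonneg_nonneg) (auto simp: algebra_simps)
      have m1: "real m \<le> L * (1 - (real ?n + 1) * \<rho>)" "L * (1 - (real ?n + 1) * \<rho>) < real m + 1"
        unfolding m_def using g0 by linarith+
      have "0 < L * \<rho>" using L \<rho>0 by simp
      then have "real m < L * (1 - ?n * \<rho>)" using m1(1) by (simp add: algebra_simps)
      from denominator_lower_bound[OF A L n\<rho> surj q q0 qY this]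
      have "real m ^ ?n \<le> \<bar>q\<bar>" .
      also have "\<dots> \<le> \<sigma> * L ^ ?n" using qb by (simp add: L_def)
      finally have mq: "real m ^ ?n \<le> \<sigma> * L ^ ?n" .
      have "1 \<le> T * \<rho>" using T(1) \<rho>0 by (simp add: field_simps)
      also have "\<dots> \<le> L * \<rho>" 
      proof (rule mult_right_mono)
        show "real T \<le> L" unfolding L_def of_nat_le_iff using N by simp
      qed (use \<rho>0 in simp)
      finally have "L * (1 - (real ?n + 2) * \<rho>) \<le> m" using m1(2) by (simp add: algebra_simps)
      moreover have "0 \<le> L * (1 - (real ?n + 2) * \<rho>)" using L n4(3) by simp
      ultimately have "(L * (1 - (real ?n + 2) * \<rho>)) ^ ?n \<le> real m ^ ?n" by (intro power_mono)
      then have "L ^ ?n * (1 - (real ?n + 2) * \<rho>) ^ ?n \<le> L ^ ?n * \<sigma>" using mq by (simp add: power_mult_distrib mult.commute)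
      then have "(1 - (real ?n + 2) * \<rho>) ^ ?n \<le> \<sigma>" using L by simp
      moreover have "1 + real ?n * (- ((real ?n + 2) * \<rho>)) \<le> (1 + - ((real ?n + 2) * \<rho>)) ^ ?n"
        by (rule Bernoulli_inequality) (use n4(3) in simp)
      ultimately have "1 - ?n * (real ?n + 2) * \<rho> \<le> \<sigma>" by (simp add: algebra_simps)
      then have "1 - (1 - \<tau>) / 8 \<le> \<sigma>" unfolding \<rho>n .
      then show False using \<tau> by (simp add: field_simps)
    qed
  qed
qed

section \<open>Comparison with Lebesgue measure\<close>

lemma infnorm_Max_cart: "infnorm (v :: real ^ 'n) = Max (range (\<lambda>i. \<bar>v $ i\<bar>))"
proof -
  have "(\<lambda>i. \<bar>v \<bullet> i\<bar>) ` Basis = range (\<lambda>i. \<bar>v $ i\<bar>)"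
    unfolding Basis_vec_def by (auto simp: inner_axis image_iff)
  then show ?thesis by (simp add: infnorm_Max)
qed

lemma infnorm_less_iff: "infnorm (v :: real ^ 'n) < s \<longleftrightarrow> (\<forall>i. \<bar>v $ i\<bar> < s)"
  by (simp add: infnorm_Max_cart)

lemma infnorm_le_iff: "infnorm (v :: real ^ 'n) \<le> s \<longleftrightarrow> (\<forall>i. \<bar>v $ i\<bar> \<le> s)"
  by (simp add: infnorm_Max_cart)

lemma sup_ball_box: "sup_ball x s = box (\<chi> i. x $ i - s) (\<chi> i. x $ i + s)"
  by (auto simp: sup_ball_def infnorm_less_iff mem_box_cart abs_less_iff algebra_simps)

lemma open_sup_ball: "open (sup_ball x s)"
  by (simp add: sup_ball_box open_box)

lemma sup_ball_measurable [measurable]: "sup_ball x s \<in> sets borel"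
  by (simp add: borel_open open_sup_ball)

lemma emeasure_sup_ball:
  fixes x :: "real ^ 'n"
  assumes "0 \<le> s"
  shows "emeasure lborel (sup_ball x s) = ennreal ((2 * s) ^ CARD('n))"
proof -
  have *: "((\<chi> i. x $ i + s) - (\<chi> i. x $ i - s)) \<bullet> b = 2 * s" if "b \<in> Basis" for b
    using that by (auto simp: Basis_vec_def inner_axis)
  have **: "(\<chi> i. x $ i - s) \<bullet> b \<le> (\<chi> i. x $ i + s) \<bullet> b" if "b \<in> Basis" for b
    using that assms by (auto simp: Basis_vec_def inner_axis)
  show ?thesis
    unfolding sup_ball_box by (subst emeasure_lborel_box[OF **]) (simp_all add: *)
qed

lemma sup_ball_commute: "y \<in> sup_ball x s \<longleftrightarrow> x \<in> sup_ball y s"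
  by (simp add: sup_ball_def infnorm_sub)

lemma sup_ball_subset:
  assumes "y \<in> sup_ball x s" "s + t \<le> u"
  shows "sup_ball y t \<subseteq> sup_ball x u"
proof
  fix z assume "z \<in> sup_ball y t"
  then show "z \<in> sup_ball x u"
    using infnorm_triangle[of "z - y" "y - x"] assms by (simp add: sup_ball_def)
qed

text \<open>
  Averaging \<mu> over balls of radius w and exchanging the integrals replaces \<mu> on A by Lebesgue measure on the
  w-neighbourhood of A, localized to balls of radius comparable to r. The loss is governed by the ratio K of the measures
  of concentric balls, so a set that is small for Lebesgue measure at the scales w and r is small for \<mu>.
\<close>
lemma lebesgue_comparison:
  fixes \<mu> :: "(real ^ 'n) measure" and w r \<kappa> K :: real
  assumes "prob_space \<mu>" and sets[measurable_cong, simp]: "sets \<mu> = sets borel"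
    and A[measurable]: "A \<in> sets borel" and w: "0 < w" "w \<le> r"
    and K: "\<And>x. x \<in> A \<Longrightarrow> measure \<mu> (sup_ball x (2 * w)) \<le> K * measure \<mu> (sup_ball x r)" "0 \<le> K"
    and \<kappa>: "\<And>x. emeasure lborel ((\<Union>a\<in>A. sup_ball a w) \<inter> sup_ball x (2 * r)) \<le> ennreal \<kappa>" "0 \<le> \<kappa>"
  shows "measure \<mu> A * (2 * w) ^ CARD('n) \<le> K * \<kappa>"
proof -
  interpret prob_space \<mu> by fact
  interpret P: pair_sigma_finite \<mu> "lborel :: (real ^ 'n) measure" ..
  have sp: "space \<mu> = UNIV" using sets_eq_imp_space_eq[OF sets] by simp
  have prod_sets: "sets (\<mu> \<Otimes>\<^sub>M (lborel :: (real ^ 'n) measure)) = sets borel"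
    by (subst borel_prod[symmetric]) (rule sets_pair_measure_cong, auto)
  let ?U = "\<Union>a\<in>A. sup_ball a w"
  have U[measurable]: "?U \<in> sets borel" by (intro borel_open open_UN ballI open_sup_ball)
  have near: "{z. snd z \<in> sup_ball (fst z) t} \<in> sets (\<mu> \<Otimes>\<^sub>M (lborel :: (real ^ 'n) measure))" for t
  proof -
    have "{z :: (real ^ 'n) \<times> (real ^ 'n). snd z \<in> sup_ball (fst z) t} = {z. infnorm (snd z - fst z) < t}"
      by (simp add: sup_ball_def)
    also have "\<dots> = (\<Inter>i. {z. \<bar>(snd z - fst z) $ i\<bar> < t})" by (auto simp: infnorm_less_iff)
    also have "\<dots> \<in> sets borel"
      by (intro borel_open open_INT ballI open_Collect_less continuous_intros) auto
    finally show ?thesis unfolding prod_sets .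
  qed
  define F where "F z = (indicator A (fst z) * indicator {z. snd z \<in> sup_ball (fst z) w} z :: ennreal)"
    for z :: "(real ^ 'n) \<times> (real ^ 'n)"
  define G where "G z = (indicator ?U (snd z) * indicator {z. snd z \<in> sup_ball (fst z) (2 * r)} z :: ennreal)"
    for z :: "(real ^ 'n) \<times> (real ^ 'n)"
  have F[measurable]: "F \<in> borel_measurable (\<mu> \<Otimes>\<^sub>M lborel)"
    unfolding F_def by (intro borel_measurable_times_ennreal borel_measurable_indicator near) measurable
  have G[measurable]: "G \<in> borel_measurable (\<mu> \<Otimes>\<^sub>M lborel)"
    unfolding G_def by (intro borel_measurable_times_ennreal borel_measurable_indicator near) measurable
  have "emeasure \<mu> A * ennreal ((2 * w) ^ CARD('n)) = (\<integral>\<^sup>+x. ennreal ((2 * w) ^ CARD('n)) * indicator A x \<partial>\<mu>)"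
    by (subst nn_integral_cmult_indicator) (simp_all only: sets A mult.commute)
  also have "\<dots> = (\<integral>\<^sup>+x. (\<integral>\<^sup>+y. F (x, y) \<partial>lborel) \<partial>\<mu>)"
  proof (rule nn_integral_cong)
    fix x
    have "(\<integral>\<^sup>+y. F (x, y) \<partial>lborel) = (\<integral>\<^sup>+y. indicator A x * indicator (sup_ball x w) y \<partial>lborel)"
      by (rule nn_integral_cong) (auto simp: F_def indicator_def)
    also have "\<dots> = indicator A x * emeasure lborel (sup_ball x w)"
      by (simp add: nn_integral_cmult)
    finally show "ennreal ((2 * w) ^ CARD('n)) * indicator A x = (\<integral>\<^sup>+y. F (x, y) \<partial>lborel)"
      using w by (simp add: emeasure_sup_ball mult.commute)
  qed
  also have "\<dots> = (\<integral>\<^sup>+y. (\<integral>\<^sup>+x. F (x, y) \<partial>\<mu>) \<partial>lborel)"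
    by (rule P.Fubini[symmetric, OF F])
  also have "\<dots> \<le> (\<integral>\<^sup>+y. ennreal K * (\<integral>\<^sup>+x. G (x, y) \<partial>\<mu>) \<partial>lborel)"
  proof (rule nn_integral_mono)
    fix y
    have "(\<integral>\<^sup>+x. F (x, y) \<partial>\<mu>) = (\<integral>\<^sup>+x. indicator (A \<inter> sup_ball y w) x \<partial>\<mu>)"
      by (rule nn_integral_cong) (auto simp: F_def indicator_def sup_ball_commute)
    also have "\<dots> = emeasure \<mu> (A \<inter> sup_ball y w)" by simp
    also have "\<dots> \<le> ennreal K * (indicator ?U y * emeasure \<mu> (sup_ball y (2 * r)))"
    proof (cases "A \<inter> sup_ball y w = {}")
      case False
      then obtain a where a: "a \<in> A" "a \<in> sup_ball y w" by auto
      have "emeasure \<mu> (A \<inter> sup_ball y w) \<le> emeasure \<mu> (sup_ball a (2 * w))"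
        using sup_ball_subset[of y a w w "2 * w"] a(2) by (intro emeasure_mono) (auto simp: sup_ball_commute)
      also have "\<dots> \<le> ennreal (K * measure \<mu> (sup_ball a r))"
        using K(1)[OF a(1)] by (simp add: emeasure_eq_measure ennreal_leI)
      also have "\<dots> \<le> ennreal (K * measure \<mu> (sup_ball y (2 * r)))"
        using sup_ball_subset[of a y w r "2 * r"] a(2) w(2) K(2)
        by (intro ennreal_leI mult_left_mono finite_measure_mono) auto
      also have "\<dots> = ennreal K * (indicator ?U y * emeasure \<mu> (sup_ball y (2 * r)))"
        using a K(2) by (auto simp: emeasure_eq_measure ennreal_mult indicator_def sup_ball_commute)
      finally show ?thesis .
    qed simp
    also have "indicator ?U y * emeasure \<mu> (sup_ball y (2 * r)) = (\<integral>\<^sup>+x. indicator ?U y * indicator (sup_ball y (2 * r)) x \<partial>\<mu>)"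
      by (simp add: nn_integral_cmult)
    also have "\<dots> = (\<integral>\<^sup>+x. G (x, y) \<partial>\<mu>)"
      by (rule nn_integral_cong) (auto simp: G_def indicator_def sup_ball_commute)
    finally show "(\<integral>\<^sup>+x. F (x, y) \<partial>\<mu>) \<le> ennreal K * (\<integral>\<^sup>+x. G (x, y) \<partial>\<mu>)" .
  qed
  also have "\<dots> = ennreal K * (\<integral>\<^sup>+y. (\<integral>\<^sup>+x. G (x, y) \<partial>\<mu>) \<partial>lborel)"
    by (rule nn_integral_cmult) measurable
  also have "(\<integral>\<^sup>+y. (\<integral>\<^sup>+x. G (x, y) \<partial>\<mu>) \<partial>lborel) = (\<integral>\<^sup>+x. (\<integral>\<^sup>+y. G (x, y) \<partial>lborel) \<partial>\<mu>)"
    by (rule P.Fubini[OF G])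
  also have "\<dots> \<le> (\<integral>\<^sup>+x. ennreal \<kappa> \<partial>\<mu>)"
  proof (rule nn_integral_mono)
    fix x
    have "(\<integral>\<^sup>+y. G (x, y) \<partial>lborel) = (\<integral>\<^sup>+y. indicator (?U \<inter> sup_ball x (2 * r)) y \<partial>lborel)"
      by (rule nn_integral_cong) (auto simp: G_def indicator_def)
    also have "\<dots> = emeasure lborel (?U \<inter> sup_ball x (2 * r))" by (simp del: Int_UN_distrib2 UN_simps)
    finally show "(\<integral>\<^sup>+y. G (x, y) \<partial>lborel) \<le> ennreal \<kappa>" using \<kappa>(1)[of x] by simp
  qed
  also have "(\<integral>\<^sup>+x. ennreal \<kappa> \<partial>\<mu>) = ennreal \<kappa>" by (simp add: emeasure_space_1)
  finally have "ennreal (measure \<mu> A * (2 * w) ^ CARD('n)) \<le> ennreal (K * \<kappa>)"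
    using K(2) \<kappa>(2) w by (simp add: emeasure_eq_measure ennreal_mult mult_left_mono)
  then show ?thesis using K(2) \<kappa>(2) by (simp add: ennreal_le_iff)
qed

text \<open>
  Translates of the slab by multiples of 3 h in the direction of the largest coefficient of a are disjoint, and about R / h of
  them fit into a ball of radius 7 R.
\<close>
lemma slab_measure:
  fixes a x :: "real ^ 'n" and h R b :: real
  assumes a: "\<And>i. \<bar>a $ i\<bar> \<le> \<bar>a $ k\<bar>" "a \<noteq> 0" and h: "0 < h" "h \<le> R"
  shows "emeasure lborel (sup_ball x R \<inter> {y. \<bar>a \<bullet> y + b\<bar> \<le> h * \<bar>a $ k\<bar>}) \<le> ennreal (h / R * (14 * R) ^ CARD('n))"
    (is "emeasure lborel ?S \<le> _")
proof -
  have ak: "0 < \<bar>a $ k\<bar>"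
  proof (rule ccontr)
    assume "\<not> 0 < \<bar>a $ k\<bar>"
    then have "a $ i = 0" for i using a(1)[of i] by simp
    then show False using a(2) by (simp add: vec_eq_iff)
  qed
  have S[measurable]: "?S \<in> sets borel"
    by (intro sets.Int sup_ball_measurable borel_closed closed_Collect_le continuous_intros)
  define J where "J = nat \<lceil>R / h\<rceil>"
  have Rh: "1 \<le> R / h" using h by simp
  have J: "R / h \<le> real J" "real J \<le> R / h + 1" unfolding J_def using Rh by linarith+
  define c where "c j = (3 * h * real j) *\<^sub>R axis k (1::real)" for j :: nat
  define S' where "S' j = {y. y - c j \<in> ?S}" for j
  have em: "emeasure lborel (S' j) = emeasure lborel ?S" for j
  proof -
    have "emeasure lborel ?S = emeasure (distr lborel borel ((+) (- c j))) ?S" by (simp add: lborel_distr_plus)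
    also have "\<dots> = emeasure lborel ((+) (- c j) -` ?S \<inter> space lborel)" by (rule emeasure_distr) simp_all
    also have "(+) (- c j) -` ?S \<inter> space lborel = S' j" by (auto simp: S'_def)
    finally show ?thesis by simp
  qed
  have S'm: "S' j \<in> sets borel" for j
  proof -
    have "S' j = (\<lambda>y. y - c j) -` ?S \<inter> space borel" by (auto simp: S'_def)
    also have "\<dots> \<in> sets borel" by (rule measurable_sets[OF _ S]) measurable
    finally show ?thesis .
  qed
  have ac: "a \<bullet> (y - c j) = a \<bullet> y - 3 * h * real j * a $ k" for y j
    by (simp add: c_def inner_diff_right inner_axis)
  have disj: "disjoint_family_on S' {..<J}"
  proof (unfold disjoint_family_on_def, intro ballI impI, rule ccontr)
    fix i j assume ij: "i \<noteq> j" "S' i \<inter> S' j \<noteq> {}"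
    then obtain y where y: "y \<in> S' i" "y \<in> S' j" by auto
    then have "\<bar>a \<bullet> y - 3 * h * real i * a $ k + b\<bar> \<le> h * \<bar>a $ k\<bar>" "\<bar>a \<bullet> y - 3 * h * real j * a $ k + b\<bar> \<le> h * \<bar>a $ k\<bar>"
      by (auto simp: S'_def ac)
    then have "\<bar>3 * h * real i * a $ k - 3 * h * real j * a $ k\<bar> \<le> 2 * (h * \<bar>a $ k\<bar>)" by linarith
    also have "3 * h * real i * a $ k - 3 * h * real j * a $ k = 3 * h * (real i - real j) * a $ k"
      by (simp add: algebra_simps)
    finally have "3 * \<bar>real i - real j\<bar> * (h * \<bar>a $ k\<bar>) \<le> 2 * (h * \<bar>a $ k\<bar>)"
      using h by (simp add: abs_mult)
    then have "3 * \<bar>real i - real j\<bar> \<le> 2" using h ak by (simp add: mult_le_cancel_right)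
    moreover have "1 \<le> \<bar>real i - real j\<bar>" using ij(1) by linarith
    then have "3 * 1 \<le> 3 * \<bar>real i - real j\<bar>" by (rule mult_left_mono) simp
    ultimately have "(3::real) * 1 \<le> 2" by (rule order_trans[rotated])
    then show False by simp
  qed
  have "real J * emeasure lborel ?S = (\<Sum>j<J. emeasure lborel (S' j))" by (simp add: em ennreal_of_nat_eq_real_of_nat)
  also have "\<dots> = emeasure lborel (\<Union>j<J. S' j)"
    by (rule sum_emeasure) (use S'm disj in auto)
  also have "\<dots> \<le> emeasure lborel (sup_ball x (7 * R))"
  proof (rule emeasure_mono, rule UN_least)
    fix j assume j: "j \<in> {..<J}"
    show "S' j \<subseteq> sup_ball x (7 * R)"
    proof
      fix y assume "y \<in> S' j"
      then have 1: "infnorm (y - c j - x) < R" by (auto simp: S'_def sup_ball_def)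
      have "real j \<le> R / h" using j J(2) by simp
      then have "3 * h * real j \<le> 3 * R" using h by (simp add: field_simps)
      then have "infnorm (c j) \<le> 3 * R" using h by (auto simp: infnorm_le_iff c_def axis_def)
      moreover have "infnorm (y - x) \<le> infnorm (y - c j - x) + infnorm (c j)"
        using infnorm_triangle[of "y - c j - x" "c j"] by (simp add: algebra_simps)
      ultimately show "y \<in> sup_ball x (7 * R)" using 1 h by (simp add: sup_ball_def)
    qed
  qed simp
  also have "\<dots> = ennreal ((14 * R) ^ CARD('n))" using h by (simp add: emeasure_sup_ball)
  finally have *: "real J * emeasure lborel ?S \<le> ennreal ((14 * R) ^ CARD('n))" .
  have "emeasure lborel ?S = ennreal (h / R) * (ennreal (R / h) * emeasure lborel ?S)"
    using h by (simp add: mult.assoc[symmetric] ennreal_mult[symmetric])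
  also have "\<dots> \<le> ennreal (h / R) * (real J * emeasure lborel ?S)"
    using J(1) by (intro mult_left_mono mult_right_mono ennreal_leI) auto
  also have "\<dots> \<le> ennreal (h / R) * ennreal ((14 * R) ^ CARD('n))" by (intro mult_left_mono *) auto
  also have "\<dots> = ennreal (h / R * (14 * R) ^ CARD('n))" by (rule ennreal_mult[symmetric]) (use h in auto)
  finally show ?thesis .
qed

section \<open>Neighbourhoods of rational points\<close>

lemma countable_int_vecs: "countable (int_vecs :: (real ^ 'n) set)"
proof -
  have "int_vecs \<subseteq> range (\<lambda>f :: 'n \<Rightarrow> int. \<chi> i. of_int (f i))"
  proof
    fix v :: "real ^ 'n" assume "v \<in> int_vecs"
    then have "v = (\<chi> i. of_int \<lfloor>v $ i\<rfloor>)" by (auto simp: int_vecs_def vec_eq_iff)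
    then show "v \<in> range (\<lambda>f :: 'n \<Rightarrow> int. \<chi> i. of_int (f i))"
      by (rule image_eqI[where x = "\<lambda>i. \<lfloor>v $ i\<rfloor>"]) simp
  qed
  then show ?thesis by (rule countable_subset) simp
qed

lemma borel_near_rationals:
  "{Y :: real ^ 'n. \<exists>p\<in>int_vecs. \<exists>q\<in>\<int>. P p q \<and> (\<forall>i. \<bar>p $ i + q * Y $ i\<bar> \<le> c)} \<in> sets borel"
proof -
  have ctb: "countable (\<int> :: real set)" unfolding Ints_def by simp
  have "{Y :: real ^ 'n. \<exists>p\<in>int_vecs. \<exists>q\<in>\<int>. P p q \<and> (\<forall>i. \<bar>p $ i + q * Y $ i\<bar> \<le> c)} =
    (\<Union>p\<in>int_vecs. \<Union>q\<in>{q\<in>\<int>. P p q}. (\<Inter>i. {Y. \<bar>p $ i + q * Y $ i\<bar> \<le> c}))" by auto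
  also have "\<dots> \<in> sets borel"
  proof -
    have cl: "(\<Inter>i. {Y :: real ^ 'n. \<bar>p $ i + q * Y $ i\<bar> \<le> c}) \<in> sets borel" for p q
      by (intro borel_closed closed_INT ballI closed_Collect_le continuous_intros)
    have c: "countable {q \<in> \<int>. P p q}" for p by (rule countable_subset[OF _ ctb]) auto
    show ?thesis
      by (rule sets.countable_UN''[OF countable_int_vecs], rule sets.countable_UN''[OF c], rule cl)
  qed
  finally show ?thesis .
qed

lemma unit_cube_cbox: "unit_cube = cbox 0 (1 :: real ^ 'n)"
  by (auto simp: unit_cube_def mem_box_cart)

lemma unit_cube_borel [measurable]: "unit_cube \<in> sets borel"
  unfolding unit_cube_cbox by simp

text \<open>
  The simplex lemma. Dirichlet's theorem provides a small form (a, b) at x, whose value at a rational point p/q near x,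
  multiplied by q, is integral and less than 1. The hyperplane carrying the rational points is the zero set of this form.
\<close>
lemma rationals_in_ball_on_hyperplane:
  fixes x :: "real ^ 'n" and Q R X :: real
  assumes Q: "0 < Q" and X: "X ^ CARD('n) = 8 * Q" "0 < X" and R: "4 * CARD('n) * (Q * X * R) < 1" "0 \<le> R"
  obtains a b where "a \<noteq> 0 \<or> b \<noteq> 0"
    "\<And>p q. p \<in> int_vecs \<Longrightarrow> q \<in> \<int> \<Longrightarrow> 0 < q \<Longrightarrow> q \<le> 2 * Q \<Longrightarrow> (\<And>i. \<bar>p $ i / q + x $ i\<bar> \<le> R) \<Longrightarrow> a \<bullet> p = q * b"
proof -
  obtain a b where ab: "a \<in> int_vecs" "b \<in> \<int>" "a \<noteq> 0 \<or> b \<noteq> 0"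
    "\<And>i. \<bar>a $ i\<bar> \<le> X" "\<bar>a \<bullet> x + b\<bar> \<le> 2 / X ^ CARD('n)"
    by (rule dirichlet_form[of "\<lambda>_. X" "2 / X ^ CARD('n)" x]) (use X Q in auto)
  show thesis
  proof (rule that[OF ab(3)])
    fix p q assume pq: "p \<in> int_vecs" "q \<in> \<int>" "0 < q" "q \<le> 2 * Q" "\<And>i. \<bar>p $ i / q + x $ i\<bar> \<le> R"
    define u where "u = (1 / q) *\<^sub>R p + x"
    have "\<bar>a \<bullet> u\<bar> \<le> (\<Sum>i\<in>UNIV. \<bar>a $ i * u $ i\<bar>)" unfolding inner_vec_def inner_real_def by (rule sum_abs)
    also have "\<dots> \<le> (\<Sum>i\<in>(UNIV :: 'n set). X * R)"
      unfolding abs_mult using pq(5) ab(4) X(2) by (intro sum_mono mult_mono) (auto simp: u_def)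
    finally have au: "\<bar>a \<bullet> u\<bar> \<le> CARD('n) * (X * R)" by simp
    \<comment> \<open>The rational point is - p / q, so that u is the difference between x and it.\<close>
    have eq: "a \<bullet> p - q * b = q * (a \<bullet> u) - q * (a \<bullet> x + b)"
      using pq(3) by (simp add: u_def inner_add_right algebra_simps)
    have "\<bar>q * (a \<bullet> u)\<bar> \<le> 2 * Q * (CARD('n) * (X * R))"
      unfolding abs_mult using pq(3,4) au Q by (intro mult_mono) auto
    moreover have "\<bar>q * (a \<bullet> x + b)\<bar> \<le> 2 * Q * (2 / (8 * Q))"
      unfolding abs_mult using pq(3,4) ab(5)[unfolded X(1)] Q by (intro mult_mono) auto
    moreover have "2 * Q * (2 / (8 * Q)) = 1 / 2" using Q by simp
    moreover have "2 * Q * (CARD('n) * (X * R)) < 1 / 2" using R(1) by (simp add: algebra_simps)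
    ultimately have "\<bar>a \<bullet> p - q * b\<bar> < 1" unfolding eq by linarith
    moreover have "a \<bullet> p - q * b \<in> \<int>" using int_vecs_inner[OF ab(1) pq(1)] pq(2) ab(2) by simp
    ultimately have "a \<bullet> p - q * b = 0" using Ints_nonzero_abs_less1 by blast
    then show "a \<bullet> p = q * b" by simp
  qed
qed

lemma near_rationals_slab:
  fixes x :: "real ^ 'n" and Q X w r :: real
  assumes Q: "0 < Q" and X: "X ^ CARD('n) = 8 * Q" "0 < X" and r: "12 * CARD('n) * (Q * X * r) < 1"
    and w: "0 < w" "2 * CARD('n) * w \<le> r"
    and A: "\<And>Y. Y \<in> A \<Longrightarrow> \<exists>p\<in>int_vecs. \<exists>q\<in>\<int>. 0 < q \<and> q \<le> 2 * Q \<and> (\<forall>i. \<bar>p $ i / q + Y $ i\<bar> \<le> w)"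
  shows "emeasure lborel ((\<Union>a\<in>A. sup_ball a w) \<inter> sup_ball x (2 * r)) \<le> ennreal (CARD('n) * (w / r) * (28 * r) ^ CARD('n))"
    (is "emeasure lborel ?S \<le> _")
proof -
  have n1: "1 \<le> real CARD('n)" by (simp add: Suc_leI)
  have "1 * (2 * w) \<le> CARD('n) * (2 * w)" using n1 w(1) by (intro mult_right_mono) auto
  also have "\<dots> \<le> r" using w(2) by (simp add: mult.assoc mult.left_commute)
  finally have r0: "2 * w \<le> r" by simp
  have near: "\<exists>p\<in>int_vecs. \<exists>q\<in>\<int>. 0 < q \<and> q \<le> 2 * Q \<and> (\<forall>i. \<bar>p $ i / q + y $ i\<bar> \<le> 2 * w) \<and> (\<forall>i. \<bar>p $ i / q + x $ i\<bar> \<le> 3 * r)"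
    if y: "y \<in> ?S" for y
  proof -
    obtain Y where Y: "Y \<in> A" "infnorm (y - Y) < w" "infnorm (y - x) < 2 * r" using y by (auto simp: sup_ball_def)
    obtain p q where pq: "p \<in> int_vecs" "q \<in> \<int>" "0 < q" "q \<le> 2 * Q" "\<forall>i. \<bar>p $ i / q + Y $ i\<bar> \<le> w"
      using A[OF Y(1)] by blast
    have 1: "\<bar>p $ i / q + y $ i\<bar> \<le> 2 * w" for i
      using spec[OF pq(5), of i] Y(2)[unfolded infnorm_less_iff, rule_format, of i] by simp
    have "\<bar>p $ i / q + x $ i\<bar> \<le> 3 * r" for i
      using 1[of i] Y(3)[unfolded infnorm_less_iff, rule_format, of i] r0 by simp
    then show ?thesis using pq 1 by blast
  qed
  show ?thesis
  proof (cases "?S = {}")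
    case False
    have R: "4 * CARD('n) * (Q * X * (3 * r)) < 1" "0 \<le> 3 * r" using r r0 w by auto
    obtain a b where ab: "a \<noteq> 0 \<or> b \<noteq> 0"
      "\<And>p q. p \<in> int_vecs \<Longrightarrow> q \<in> \<int> \<Longrightarrow> 0 < q \<Longrightarrow> q \<le> 2 * Q \<Longrightarrow> (\<And>i. \<bar>p $ i / q + x $ i\<bar> \<le> 3 * r) \<Longrightarrow> a \<bullet> p = q * b"
      using rationals_in_ball_on_hyperplane[OF Q X R] by blast
    have a0: "a \<noteq> 0"
    proof
      assume a: "a = 0"
      obtain y where "y \<in> ?S" using False by blast
      from near[OF this] obtain p q where "p \<in> int_vecs" "q \<in> \<int>" "0 < q" "q \<le> 2 * Q" "\<forall>i. \<bar>p $ i / q + x $ i\<bar> \<le> 3 * r"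
        by blast
      then have "0 = q * b" using ab(2)[of p q] a by simp
      then show False using \<open>0 < q\<close> ab(1) a by simp
    qed
    obtain k where k: "\<And>i. \<bar>a $ i\<bar> \<le> \<bar>a $ k\<bar>" using exists_max_coord by blast
    have "?S \<subseteq> sup_ball x (2 * r) \<inter> {y. \<bar>a \<bullet> y + b\<bar> \<le> (2 * CARD('n) * w) * \<bar>a $ k\<bar>}"
    proof
      fix y assume y: "y \<in> ?S"
      obtain p q where pq: "p \<in> int_vecs" "q \<in> \<int>" "0 < q" "q \<le> 2 * Q" "\<forall>i. \<bar>p $ i / q + y $ i\<bar> \<le> 2 * w"
        "\<forall>i. \<bar>p $ i / q + x $ i\<bar> \<le> 3 * r" using near[OF y] by blast
      define u where "u = (1 / q) *\<^sub>R p + y"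
      have "a \<bullet> p = q * b" using ab(2) pq by blast
      then have "a \<bullet> y + b = a \<bullet> u" using pq(3) by (simp add: u_def inner_add_right)
      also have "\<bar>\<dots>\<bar> \<le> (\<Sum>i\<in>UNIV. \<bar>a $ i * u $ i\<bar>)" unfolding inner_vec_def inner_real_def by (rule sum_abs)
      also have "\<dots> \<le> (\<Sum>i\<in>(UNIV :: 'n set). \<bar>a $ k\<bar> * (2 * w))"
        unfolding abs_mult using pq(5) by (intro sum_mono mult_mono k) (auto simp: u_def)
      also have "\<dots> = (2 * CARD('n) * w) * \<bar>a $ k\<bar>" by simp
      finally show "y \<in> sup_ball x (2 * r) \<inter> {y. \<bar>a \<bullet> y + b\<bar> \<le> (2 * CARD('n) * w) * \<bar>a $ k\<bar>}" using y by simp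
    qed
    moreover have "sup_ball x (2 * r) \<inter> {y. \<bar>a \<bullet> y + b\<bar> \<le> (2 * CARD('n) * w) * \<bar>a $ k\<bar>} \<in> sets borel"
      by (intro sets.Int sup_ball_measurable borel_closed closed_Collect_le continuous_intros)
    ultimately have "emeasure lborel ?S \<le> emeasure lborel (sup_ball x (2 * r) \<inter> {y. \<bar>a \<bullet> y + b\<bar> \<le> (2 * CARD('n) * w) * \<bar>a $ k\<bar>})"
      by (intro emeasure_mono) simp_all
    also have "\<dots> \<le> ennreal ((2 * CARD('n) * w) / (2 * r) * (14 * (2 * r)) ^ CARD('n))"
      by (rule slab_measure[OF k a0]) (use w r0 in auto)
    also have "(2 * CARD('n) * w) / (2 * r) * (14 * (2 * r)) ^ CARD('n) = CARD('n) * (w / r) * (28 * r) ^ CARD('n)"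
      by simp
    finally show ?thesis .
  qed (use w r0 in simp)
qed

section \<open>Non-divergence\<close>

definition ball_decay :: "(real ^ 'n) measure \<Rightarrow> real \<Rightarrow> real \<Rightarrow> real \<Rightarrow> bool" where
  "ball_decay \<mu> s0 e C \<longleftrightarrow> (\<forall>\<delta> s x. 0 < \<delta> \<and> \<delta> < 1 \<and> 0 < s \<and> s \<le> s0 \<and> x \<in> unit_cube \<longrightarrow>
     measure \<mu> (sup_ball x (\<delta> * s)) \<le> C * \<delta> powr (real CARD('n) - e) * measure \<mu> (sup_ball x s))"

text \<open>
  Rational points with denominators about Q are compared at the scale r = c / (Q X), with X = (8 Q)^(1/n), where they lie on one
  hyperplane, and their neighbourhoods have radius w = \<epsilon> / (Q N). A slab of relative width w / r has measure
  at most a constant times (w / r)^(1 - e); the value e = 1/2 will suffice.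
\<close>
lemma measure_near_rationals:
  fixes \<mu> :: "(real ^ 'n) measure" and Q X N \<epsilon> c s0 C :: real
  assumes \<mu>: "prob_space \<mu>" "sets \<mu> = sets borel" and lmd: "ball_decay \<mu> s0 (1 / 2) C" "0 \<le> C"
    and Q: "1 \<le> Q" and X: "X ^ CARD('n) = 8 * Q" "0 < X" and c: "0 < c" "c \<le> s0" "12 * CARD('n) * c < 1"
    and N: "0 < N" and \<epsilon>: "0 < \<epsilon>" and t: "2 * CARD('n) * (\<epsilon> * X / (c * N)) < 1"
  shows "measure \<mu> {Y \<in> unit_cube. \<exists>p\<in>int_vecs. \<exists>q\<in>\<int>. (Q \<le> q \<and> q \<le> 2 * Q) \<and> (\<forall>i. \<bar>p $ i + q * Y $ i\<bar> \<le> \<epsilon> / N)}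
     \<le> C * CARD('n) * 28 ^ CARD('n) * sqrt (\<epsilon> * X / (c * N))" (is "measure \<mu> ?A \<le> _")
proof -
  let ?n = "CARD('n)"
  define w where "w = \<epsilon> / (Q * N)"
  define r where "r = c / (Q * X)"
  define t where "t = \<epsilon> * X / (c * N)"
  have w: "0 < w" and r: "0 < r" and t0: "0 < t" using Q X N c \<epsilon> by (auto simp: w_def r_def t_def)
  have wr: "w / r = t" using Q X N c by (simp add: w_def r_def t_def)
  have n1: "1 \<le> real ?n" by (simp add: Suc_leI)
  have "2 * (?n * w) < r" using t wr r unfolding t_def[symmetric] by (simp add: field_simps)
  moreover have "1 * w \<le> ?n * w" using n1 w by (intro mult_right_mono) auto
  ultimately have wr2: "2 * ?n * w \<le> r" "2 * w < r" by linarith+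
  have "1 \<le> X"
  proof (rule ccontr)
    assume "\<not> 1 \<le> X"
    then have "X ^ ?n \<le> 1" using X(2) by (intro power_le_one) auto
    then show False using X(1) Q by simp
  qed
  then have "1 * 1 \<le> Q * X" using Q by (intro mult_mono) auto
  then have "r \<le> c" using c(1) Q X by (simp add: r_def divide_le_eq mult_le_cancel_left1)
  then have rs: "r \<le> s0" using c by simp
  have A[measurable]: "?A \<in> sets borel"
  proof -
    have "?A = unit_cube \<inter> {Y. \<exists>p\<in>int_vecs. \<exists>q\<in>\<int>. (Q \<le> q \<and> q \<le> 2 * Q) \<and> (\<forall>i. \<bar>p $ i + q * Y $ i\<bar> \<le> \<epsilon> / N)}" by auto
    also have "\<dots> \<in> sets borel" by (intro sets.Int unit_cube_borel borel_near_rationals)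
    finally show ?thesis .
  qed
  define K where "K = C * (2 * w / r) powr (?n - 1 / 2)"
  have K: "measure \<mu> (sup_ball x (2 * w)) \<le> K * measure \<mu> (sup_ball x r)" if "x \<in> ?A" for x
    using lmd(1)[unfolded ball_decay_def, rule_format, of "2 * w / r" r x] that wr2 r rs w by (simp add: K_def)
  have K0: "0 \<le> K" using lmd(2) by (simp add: K_def)
  have slab: "emeasure lborel ((\<Union>a\<in>?A. sup_ball a w) \<inter> sup_ball x (2 * r)) \<le> ennreal (?n * (w / r) * (28 * r) ^ ?n)" for x
  proof (rule near_rationals_slab[OF _ X _ w wr2(1)])
    show "0 < Q" using Q by simp
    show "12 * ?n * (Q * X * r) < 1" using c Q X by (simp add: r_def)
    fix Y assume "Y \<in> ?A"
    then obtain p q where pq: "p \<in> int_vecs" "q \<in> \<int>" "Q \<le> q" "q \<le> 2 * Q" "\<forall>i. \<bar>p $ i + q * Y $ i\<bar> \<le> \<epsilon> / N" by auto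
    have q0: "0 < q" using pq Q by simp
    have "\<bar>p $ i / q + Y $ i\<bar> \<le> w" for i
    proof -
      have "p $ i / q + Y $ i = (p $ i + q * Y $ i) / q" using q0 by (simp add: add_divide_distrib)
      then have "\<bar>p $ i / q + Y $ i\<bar> = \<bar>p $ i + q * Y $ i\<bar> / q" using q0 by simp
      also have "\<dots> \<le> \<epsilon> / N / Q" using pq(3,5) Q \<epsilon> N by (intro frac_le) auto
      finally show ?thesis by (simp add: w_def mult.commute)
    qed
    then show "\<exists>p\<in>int_vecs. \<exists>q\<in>\<int>. 0 < q \<and> q \<le> 2 * Q \<and> (\<forall>i. \<bar>p $ i / q + Y $ i\<bar> \<le> w)" using pq q0 by blast
  qed
  have "measure \<mu> ?A * (2 * w) ^ ?n \<le> K * (?n * (w / r) * (28 * r) ^ ?n)"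
    by (rule lebesgue_comparison[OF \<mu> A w _ K K0 slab]) (use wr2 w r in auto)
  also have "K = C * ((2 * t) ^ ?n / sqrt (2 * t))"
    using t0 unfolding K_def by (simp add: powr_diff powr_realpow powr_half_sqrt wr[symmetric])
  also have "C * ((2 * t) ^ ?n / sqrt (2 * t)) * (?n * (w / r) * (28 * r) ^ ?n)
     = (C * ?n * 28 ^ ?n * (t / sqrt (2 * t))) * (2 * w) ^ ?n"
  proof -
    have "2 * w = 2 * t * r" using wr r by (simp add: field_simps)
    then have "(2 * w) ^ ?n = (2 * t) ^ ?n * r ^ ?n" by (simp add: power_mult_distrib)
    then show ?thesis unfolding wr by (simp add: power_mult_distrib)
  qed
  also have "\<dots> \<le> (C * ?n * 28 ^ ?n * sqrt t) * (2 * w) ^ ?n"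
  proof (intro mult_right_mono mult_left_mono)
    have "t / sqrt (2 * t) \<le> t / sqrt t" using t0 by (intro divide_left_mono) auto
    then show "t / sqrt (2 * t) \<le> sqrt t" using t0 by (simp add: real_div_sqrt)
  qed (use lmd(2) w in auto)
  finally show ?thesis using w unfolding t_def by (simp add: mult_le_cancel_right)
qed

text \<open>
  The relative widths for Q = 2^j grow geometrically up to the largest possible Q, which is \<epsilon> N^n, so the sum over j is comparable
  to its last term; that term is a power of \<epsilon> and does not involve N.
\<close>
lemma nondivergence:
  fixes \<mu> :: "(real ^ 'n) measure" and \<kappa> s0 C :: real
  assumes \<mu>: "prob_space \<mu>" "sets \<mu> = sets borel" and lmd: "ball_decay \<mu> s0 (1 / 2) C" "0 \<le> C" "0 < s0"
    and \<kappa>: "0 < \<kappa>"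
  obtains \<epsilon> :: real where "0 < \<epsilon>"
    "\<And>N :: nat. (0::nat) < N \<Longrightarrow> {Y \<in> unit_cube :: (real ^ 'n) set. \<not> short_free (primal_lattice Y N) \<epsilon>} \<in> sets borel"
    "\<And>N :: nat. (0::nat) < N \<Longrightarrow> measure \<mu> {Y \<in> unit_cube :: (real ^ 'n) set. \<not> short_free (primal_lattice Y N) \<epsilon>} \<le> \<kappa>"
proof -
  let ?n = "CARD('n)"
  interpret prob_space \<mu> by fact
  have n1: "1 \<le> real ?n" by (simp add: Suc_leI)
  define c where "c = min s0 (1 / (24 * ?n))"
  have c: "0 < c" "c \<le> s0" "c \<le> 1 / (24 * ?n)" using lmd(3) n1 by (auto simp: c_def)
  have c2: "12 * ?n * c < 1" "c \<le> 1"
  proof -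
    have "24 * ?n * c \<le> 1" using c(3) n1 by (simp add: field_simps)
    moreover have "0 < ?n * c" using c(1) by simp
    ultimately show "12 * ?n * c < 1" by simp
    have "1 \<le> 24 * real ?n" using n1 by linarith
    then have "1 / (24 * ?n) \<le> 1" by (simp add: divide_le_eq)
    then show "c \<le> 1" by (rule order_trans[OF c(3)])
  qed
  define \<theta> where "\<theta> = sqrt (root ?n 2)"
  have \<theta>: "1 < \<theta>" by (simp add: \<theta>_def real_root_gt_1_iff)
  define B where "B = C * ?n * 28 ^ ?n"
  have B: "0 \<le> B" using lmd(2) by (simp add: B_def)
  define D where "D = B * 3 * \<theta> / (sqrt c * (\<theta> - 1))"
  have D: "0 \<le> D" using B \<theta> c by (simp add: D_def)
  \<comment> \<open>The first bound is what the preceding lemma requires at the largest Q, the second makes the final estimate D sqrt \<epsilon> at most \<kappa>.\<close>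
  define \<epsilon> where "\<epsilon> = min (c / (32 * ?n)) ((\<kappa> / (D + 1))\<^sup>2)"
  have \<epsilon>0: "0 < \<epsilon>" using c n1 D \<kappa> by (simp add: \<epsilon>_def)
  have \<epsilon>1: "\<epsilon> \<le> c / (32 * ?n)" by (simp add: \<epsilon>_def)
  also have "c / (32 * ?n) < 1"
  proof -
    have "c < 32 * real ?n" using c2(2) n1 by linarith
    then show ?thesis by (simp add: divide_less_eq)
  qed
  finally have \<epsilon>2: "\<epsilon> < 1" .
  have D\<epsilon>: "D * sqrt \<epsilon> \<le> \<kappa>"
  proof -
    have "sqrt \<epsilon> \<le> sqrt ((\<kappa> / (D + 1))\<^sup>2)" by (intro real_sqrt_le_mono) (simp add: \<epsilon>_def)
    also have "\<dots> = \<kappa> / (D + 1)" using D \<kappa> by simp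
    finally have "D * sqrt \<epsilon> \<le> D * (\<kappa> / (D + 1))" using D by (intro mult_left_mono)
    also have "\<dots> \<le> \<kappa>" using D \<kappa> by (simp add: field_simps)
    finally show ?thesis .
  qed
  show thesis
  proof (rule that[OF \<epsilon>0])
    fix N :: nat assume N: "0 < N"
    let ?S = "{Y \<in> unit_cube :: (real ^ 'n) set. \<not> short_free (primal_lattice Y N) \<epsilon>}"
    have "?S = unit_cube \<inter> {Y :: real ^ 'n. \<exists>p\<in>int_vecs. \<exists>q\<in>\<int>. (\<bar>q\<bar> \<le> \<epsilon> * real N ^ ?n \<and> \<not> (p = 0 \<and> q = 0)) \<and> (\<forall>i. \<bar>p $ i + q * Y $ i\<bar> \<le> \<epsilon> / N)}"
      using N by (auto simp: short_free_primal)
    also have "\<dots> \<in> sets borel" by (intro sets.Int unit_cube_borel borel_near_rationals)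
    finally show "?S \<in> sets borel" .
    define A where "A Q = {Y :: real ^ 'n. Y \<in> unit_cube \<and> (\<exists>p\<in>int_vecs. \<exists>q\<in>\<int>. (Q \<le> q \<and> q \<le> 2 * Q) \<and> (\<forall>i. \<bar>p $ i + q * Y $ i\<bar> \<le> \<epsilon> / N))}" for Q
    have Am: "A Q \<in> sets \<mu>" for Q
    proof -
      have "A Q = unit_cube \<inter> {Y. \<exists>p\<in>int_vecs. \<exists>q\<in>\<int>. (Q \<le> q \<and> q \<le> 2 * Q) \<and> (\<forall>i. \<bar>p $ i + q * Y $ i\<bar> \<le> \<epsilon> / N)}" by (auto simp: A_def)
      also have "\<dots> \<in> sets borel" by (intro sets.Int unit_cube_borel borel_near_rationals)
      finally show ?thesis unfolding \<mu>(2) .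
    qed
    define I where "I = {j :: nat. 2 ^ j \<le> \<epsilon> * real N ^ ?n}"
    have "I \<subseteq> {..N ^ ?n}"
    proof
      fix j assume "j \<in> I"
      then have "2 ^ j \<le> \<epsilon> * real N ^ ?n" by (simp add: I_def)
      also have "\<dots> \<le> real N ^ ?n" using \<epsilon>2 by (simp add: mult_le_cancel_right2)
      finally have "real (2 ^ j) \<le> real (N ^ ?n)" by simp
      then have "2 ^ j \<le> N ^ ?n" by (simp only: of_nat_le_iff)
      then show "j \<in> {..N ^ ?n}" unfolding atMost_iff using less_exp[of j] by linarith
    qed
    then have finI: "finite I" using finite_subset by blast
    have "?S \<subseteq> (\<Union>j\<in>I. A (2 ^ j))"
    proof
      fix Y assume "Y \<in> ?S"
      then obtain p q where Y: "Y \<in> unit_cube" and pq: "p \<in> int_vecs" "q \<in> \<int>" "\<bar>q\<bar> \<le> \<epsilon> * real N ^ ?n"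
          "\<not> (p = 0 \<and> q = 0)" "\<forall>i. \<bar>p $ i + q * Y $ i\<bar> \<le> \<epsilon> / N"
        using N by (auto simp: short_free_primal)
      have q0: "q \<noteq> 0"
      proof
        assume q: "q = 0"
        have "\<epsilon> / N < 1" using \<epsilon>2 N by (simp add: divide_less_eq)
        then have "\<bar>p $ i\<bar> < 1" for i using spec[OF pq(5), of i] q by simp
        then have "p $ i = 0" for i using pq(1) Ints_nonzero_abs_less1 unfolding int_vecs_def by blast
        then show False using pq(4) q by (simp add: vec_eq_iff)
      qed
      obtain p' q' where pq': "p' \<in> int_vecs" "q' \<in> \<int>" "0 < q'" "q' \<le> \<epsilon> * real N ^ ?n"
          "\<forall>i. \<bar>p' $ i + q' * Y $ i\<bar> \<le> \<epsilon> / N"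
      proof (cases "0 < q")
        case True
        then show ?thesis using that[of p q] pq by auto
      next
        case False
        have "\<bar>(- p) $ i + (- q) * Y $ i\<bar> = \<bar>p $ i + q * Y $ i\<bar>" for i by simp
        then show ?thesis using that[of "- p" "- q"] pq False q0
          by (metis Ints_minus abs_of_neg additive_subgroupD(3) int_vecs_subgroup linorder_neqE_linordered_idom neg_0_less_iff_less)
      qed
      obtain z :: int where z: "q' = of_int z" using pq'(2) by (elim Ints_cases)
      have "1 \<le> q'" using pq'(3) z by simp
      define j where "j = nat \<lfloor>log 2 q'\<rfloor>"
      have j: "2 ^ j \<le> q'" "q' < 2 ^ (j + 1)"
      proof -
        have "0 \<le> log 2 q'" using \<open>1 \<le> q'\<close> by simp
        then have "real j \<le> log 2 q'" "log 2 q' < real (j + 1)" unfolding j_def by linarith+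
        then show "2 ^ j \<le> q'" "q' < 2 ^ (j + 1)"
          using \<open>1 \<le> q'\<close> by (simp_all add: le_log_iff log_less_iff powr_realpow[symmetric] powr_add del: of_nat_add)
      qed
      have "j \<in> I" using j(1) pq'(4) by (simp add: I_def)
      moreover have "Y \<in> A (2 ^ j)" unfolding A_def using Y pq' j by force
      ultimately show "Y \<in> (\<Union>j\<in>I. A (2 ^ j))" by blast
    qed
    then have "measure \<mu> ?S \<le> measure \<mu> (\<Union>j\<in>I. A (2 ^ j))"
      by (intro finite_measure_mono) (use Am finI in auto)
    also have "\<dots> \<le> (\<Sum>j\<in>I. measure \<mu> (A (2 ^ j)))"
      by (rule finite_measure_subadditive_finite[OF finI]) (use Am in auto)
    also have "\<dots> \<le> (\<Sum>j\<in>I. B * (sqrt (\<epsilon> / (c * N)) * (3 * \<theta> ^ j)))"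
    proof (rule sum_mono)
      fix j assume j: "j \<in> I"
      define X where "X = root ?n (8 * 2 ^ j)"
      have X: "X ^ ?n = 8 * 2 ^ j" "0 < X" by (simp_all add: X_def)
      have "8 * 2 ^ j \<le> (8 * real N) ^ ?n"
      proof -
        have "2 ^ j \<le> \<epsilon> * real N ^ ?n" using j by (simp add: I_def)
        also have "\<dots> \<le> real N ^ ?n" using \<epsilon>2 by (simp add: mult_le_cancel_right2)
        finally have "8 * 2 ^ j \<le> 8 * real N ^ ?n" by simp
        also have "\<dots> \<le> 8 ^ ?n * real N ^ ?n"
          using self_le_power[of "8::real" ?n] by (intro mult_right_mono) auto
        finally show ?thesis by (simp add: power_mult_distrib)
      qed
      then have "X \<le> root ?n ((8 * real N) ^ ?n)" unfolding X_def by (intro real_root_le_mono) auto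
      also have "root ?n ((8 * real N) ^ ?n) = 8 * real N" by (rule real_root_power_cancel) auto
      finally have X8: "X \<le> 8 * real N" .
      have "\<epsilon> * X / (c * N) \<le> (c / (32 * ?n)) * (8 * real N) / (c * N)"
        using \<epsilon>1 X8 \<epsilon>0 X c N by (intro divide_right_mono mult_mono) auto
      also have "\<dots> = 1 / (4 * ?n)" using c N by simp
      finally have "2 * ?n * (\<epsilon> * X / (c * N)) \<le> 2 * ?n * (1 / (4 * ?n))" by (rule mult_left_mono) simp
      also have "\<dots> < 1" by simp
      finally have t: "2 * ?n * (\<epsilon> * X / (c * real N)) < 1" .
      have "measure \<mu> (A (2 ^ j)) \<le> B * sqrt (\<epsilon> * X / (c * N))"
        unfolding A_def B_def
        by (rule measure_near_rationals[OF \<mu> lmd(1,2) _ X c(1,2) c2(1) _ \<epsilon>0 t]) (use N in auto)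
      also have "sqrt (\<epsilon> * X / (c * N)) = sqrt (\<epsilon> / (c * N)) * sqrt X"
        by (simp add: real_sqrt_mult[symmetric])
      also have "sqrt X = sqrt (root ?n 8) * \<theta> ^ j"
        by (simp add: X_def \<theta>_def real_root_mult real_sqrt_mult real_root_power real_sqrt_power)
      also have "B * (sqrt (\<epsilon> / (c * N)) * (sqrt (root ?n 8) * \<theta> ^ j)) \<le> B * (sqrt (\<epsilon> / (c * N)) * (3 * \<theta> ^ j))"
      proof (intro mult_left_mono mult_right_mono)
        have "root ?n 8 \<le> root ?n (8 ^ ?n)" using self_le_power[of "8::real" ?n] by (intro real_root_le_mono) auto
        then have "root ?n 8 \<le> 3\<^sup>2" by (simp add: real_root_power_cancel)
        then show "sqrt (root ?n 8) \<le> 3" by (intro real_le_lsqrt) simp_all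
      qed (use B \<epsilon>0 c \<theta> in auto)
      finally show "measure \<mu> (A (2 ^ j)) \<le> B * (sqrt (\<epsilon> / (c * N)) * (3 * \<theta> ^ j))" .
    qed
    also have "\<dots> = B * sqrt (\<epsilon> / (c * N)) * 3 * (\<Sum>j\<in>I. \<theta> ^ j)"
      by (simp add: sum_distrib_left mult.assoc)
    also have "\<dots> \<le> B * sqrt (\<epsilon> / (c * N)) * 3 * (\<theta> * sqrt N / (\<theta> - 1))"
    proof (rule mult_left_mono)
      show "(\<Sum>j\<in>I. \<theta> ^ j) \<le> \<theta> * sqrt N / (\<theta> - 1)"
      proof (cases "I = {}")
        case False
        define J where "J = Max I"
        have J: "J \<in> I" "\<And>j. j \<in> I \<Longrightarrow> j \<le> J" using finI False by (auto simp: J_def)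
        have "(\<Sum>j\<in>I. \<theta> ^ j) \<le> (\<Sum>j<Suc J. \<theta> ^ j)"
          using J(2) \<theta> by (intro sum_mono2) (auto simp: less_Suc_eq_le)
        also have "\<dots> = (\<theta> ^ Suc J - 1) / (\<theta> - 1)" by (rule geometric_sum) (use \<theta> in simp)
        also have "\<dots> \<le> \<theta> ^ Suc J / (\<theta> - 1)" using \<theta> by (intro divide_right_mono) auto
        also have "\<dots> \<le> \<theta> * sqrt N / (\<theta> - 1)"
        proof (intro divide_right_mono)
          have "2 ^ J \<le> \<epsilon> * real N ^ ?n" using J(1) by (simp add: I_def)
          also have "\<dots> \<le> real N ^ ?n" using \<epsilon>2 by (simp add: mult_le_cancel_right2)
          finally have "root ?n (2 ^ J) \<le> root ?n (real N ^ ?n)" by (intro real_root_le_mono) auto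
          then have "sqrt (root ?n (2 ^ J)) \<le> sqrt N" by (simp add: real_root_power_cancel)
          moreover have "\<theta> ^ J = sqrt (root ?n (2 ^ J))" by (simp add: \<theta>_def real_root_power real_sqrt_power)
          ultimately show "\<theta> ^ Suc J \<le> \<theta> * sqrt N" using \<theta> by simp
        qed (use \<theta> in auto)
        finally show ?thesis .
      qed (use \<theta> in auto)
    qed (use B \<epsilon>0 c in auto)
    also have "\<dots> = D * sqrt \<epsilon>"
      using N c \<theta> by (simp add: D_def real_sqrt_divide real_sqrt_mult)
    finally show "measure \<mu> ?S \<le> \<kappa>" using D\<epsilon> by linarith
  qed
qed

section \<open>Counting cubes\<close>

text \<open>
  Each level at which fewer than B children survive improves the bound for the number of descendants by the factor
  (B - 1) / B. Induction runs from the root downwards: the first level costs one unit of j if the root z loses a child, and the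
  remaining levels are handled below each child. For j = 0 the trivial bound suffices.
\<close>
lemma tree_count:
  fixes E :: "'a set" and idx :: "nat \<Rightarrow> 'a \<Rightarrow> 'b" and B :: nat
  defines "children \<equiv> \<lambda>l z. idx (Suc l) ` {x \<in> E. idx l x = z}"
  assumes fin: "\<And>l z. finite (children l z)" and card: "\<And>l z. card (children l z) \<le> B"
    and B: "0 < B"
  shows "finite (idx (k + t) ` {x \<in> E. idx k x = z \<and> j \<le> card {l \<in> {k..<k + t}. card (children l (idx l x)) < B}}) \<and>
    real (card (idx (k + t) ` {x \<in> E. idx k x = z \<and> j \<le> card {l \<in> {k..<k + t}. card (children l (idx l x)) < B}}))
      \<le> real B ^ t * (real (B - 1) / real B) ^ j"
proof (induction t arbitrary: k z j)
  case 0
  define \<theta> where "\<theta> = real (B - 1) / real B"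
  have sub: "idx (k + 0) ` {x \<in> E. idx k x = z \<and> j \<le> card {l \<in> {k..<k + 0}. card (children l (idx l x)) < B}}
    \<subseteq> (if j = 0 then {z} else {})" by auto
  then have "card (idx (k + 0) ` {x \<in> E. idx k x = z \<and> j \<le> card {l \<in> {k..<k + 0}. card (children l (idx l x)) < B}})
    \<le> card (if j = 0 then {z} else {})" by (intro card_mono) auto
  then have "real (card (idx (k + 0) ` {x \<in> E. idx k x = z \<and> j \<le> card {l \<in> {k..<k + 0}. card (children l (idx l x)) < B}}))
    \<le> (if j = 0 then 1 else 0)" by (auto split: if_splits)
  also have "\<dots> \<le> real B ^ 0 * \<theta> ^ j" by (simp add: \<theta>_def)
  finally show ?case using finite_subset[OF sub] unfolding \<theta>_def by simp
next
  case (Suc t)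
  define \<theta> where "\<theta> = real (B - 1) / real B"
  have \<theta>: "0 \<le> \<theta>" by (simp add: \<theta>_def)
  define good where "good l x \<longleftrightarrow> card (children l (idx l x)) < B" for l x
  define S where "S k z t j = {x \<in> E. idx k x = z \<and> j \<le> card {l \<in> {k..<k + t}. good l x}}" for k z t j
  define gk where "gk \<longleftrightarrow> card (children k z) < B"
  define j' where "j' = (if gk then j - 1 else j)"
  have IH: "finite (idx (k + t) ` S k z t j)" "real (card (idx (k + t) ` S k z t j)) \<le> real B ^ t * \<theta> ^ j" for k z j
    using Suc.IH[of k z j] unfolding S_def good_def \<theta>_def by blast+
  have sub: "idx (k + Suc t) ` S k z (Suc t) j \<subseteq> (\<Union>c\<in>children k z. idx (Suc k + t) ` S (Suc k) c t j')"
  proof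
    fix u assume "u \<in> idx (k + Suc t) ` S k z (Suc t) j"
    then obtain x where x: "u = idx (k + Suc t) x" "x \<in> E" "idx k x = z" "j \<le> card {l \<in> {k..<k + Suc t}. good l x}"
      by (auto simp: S_def)
    have gx: "good k x \<longleftrightarrow> gk" using x(3) by (simp add: good_def gk_def)
    have "{l \<in> {k..<k + Suc t}. good l x} = (if gk then {k} else {}) \<union> {l \<in> {Suc k..<Suc k + t}. good l x}"
    proof -
      have "{k..<k + Suc t} = insert k {Suc k..<Suc k + t}" by auto
      then show ?thesis using gx by auto
    qed
    then have "card {l \<in> {k..<k + Suc t}. good l x} \<le> card (if gk then {k} else {}) + card {l \<in> {Suc k..<Suc k + t}. good l x}"
      using card_Un_le by metis
    then have "j' \<le> card {l \<in> {Suc k..<Suc k + t}. good l x}" using x(4) by (auto simp: j'_def split: if_splits)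
    then have "x \<in> S (Suc k) (idx (Suc k) x) t j'" using x by (simp add: S_def)
    moreover have "idx (Suc k) x \<in> children k z" using x by (auto simp: children_def)
    ultimately show "u \<in> (\<Union>c\<in>children k z. idx (Suc k + t) ` S (Suc k) c t j')" using x(1) by auto
  qed
  have finU: "finite (\<Union>c\<in>children k z. idx (Suc k + t) ` S (Suc k) c t j')"
    using fin IH(1) by blast
  have "card (idx (k + Suc t) ` S k z (Suc t) j) \<le> card (\<Union>c\<in>children k z. idx (Suc k + t) ` S (Suc k) c t j')"
    by (rule card_mono[OF finU sub])
  also have "\<dots> \<le> (\<Sum>c\<in>children k z. card (idx (Suc k + t) ` S (Suc k) c t j'))" by (rule card_UN_le[OF fin])
  finally have "real (card (idx (k + Suc t) ` S k z (Suc t) j)) \<le> real (\<Sum>c\<in>children k z. card (idx (Suc k + t) ` S (Suc k) c t j'))"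
    by (rule of_nat_mono)
  also have "\<dots> = (\<Sum>c\<in>children k z. real (card (idx (Suc k + t) ` S (Suc k) c t j')))" by simp
  also have "\<dots> \<le> (\<Sum>c\<in>children k z. real B ^ t * \<theta> ^ j')" by (intro sum_mono IH(2))
  also have "\<dots> = real (card (children k z)) * (real B ^ t * \<theta> ^ j')" by simp
  also have "\<dots> \<le> real B ^ Suc t * \<theta> ^ j"
  proof (cases "gk \<and> 0 < j")
    case True
    then have "real (card (children k z)) \<le> real (B - 1)" by (simp add: gk_def)
    then have "real (card (children k z)) * (real B ^ t * \<theta> ^ j') \<le> real (B - 1) * (real B ^ t * \<theta> ^ j')"
      using \<theta> by (intro mult_right_mono) auto
    also have "real (B - 1) = real B * \<theta>" using B by (simp add: \<theta>_def)
    also have "real B * \<theta> * (real B ^ t * \<theta> ^ j') = real B ^ Suc t * \<theta> ^ Suc j'" by simp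
    also have "Suc j' = j" using True by (simp add: j'_def)
    finally show ?thesis .
  next
    case False
    then have "j' = j" by (auto simp: j'_def)
    then show ?thesis using card[of k z] \<theta> by (simp add: mult.assoc[symmetric] mult_right_mono)
  qed
  finally show ?case using finite_subset[OF sub finU] unfolding S_def good_def \<theta>_def by blast
qed

definition improvable_from :: "real \<Rightarrow> nat \<Rightarrow> (real ^ 'n) set" where
  "improvable_from \<sigma> N0 = {Y \<in> unit_cube. \<forall>N\<ge>N0. dirichlet_solvable \<sigma> N Y}"

lemma improvable_from_borel: "(improvable_from \<sigma> N0 :: (real ^ 'n) set) \<in> sets borel"
proof -
  have "(improvable_from \<sigma> N0 :: (real ^ 'n) set) = unit_cube \<inter> (\<Inter>N\<in>{N0..}. {Y. \<exists>p\<in>int_vecs. \<exists>q\<in>\<int>.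
     (q \<noteq> 0 \<and> \<bar>q\<bar> \<le> \<sigma> * real N ^ CARD('n)) \<and> (\<forall>i. \<bar>p $ i + q * Y $ i\<bar> \<le> \<sigma> / real N)})"
    by (auto simp: improvable_from_def dirichlet_solvable_def)
  also have "\<dots> \<in> sets borel"
    by (rule sets.Int[OF unit_cube_borel], rule sets.countable_INT''[OF _ _ borel_near_rationals]) auto
  finally show ?thesis .
qed

text \<open>
  The index of the grid cube of side \<beta>^-l that contains Y.
\<close>
definition cell :: "nat \<Rightarrow> nat \<Rightarrow> real ^ 'n \<Rightarrow> 'n \<Rightarrow> int" where
  "cell \<beta> l Y = (\<lambda>i. \<lfloor>Y $ i * real \<beta> ^ l\<rfloor>)"

lemma cell_dist:
  assumes "0 < \<beta>" "cell \<beta> l x = cell \<beta> l y"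
  shows "\<bar>x $ i - y $ i\<bar> < 1 / real \<beta> ^ l"
proof -
  have "\<lfloor>x $ i * real \<beta> ^ l\<rfloor> = \<lfloor>y $ i * real \<beta> ^ l\<rfloor>" using fun_cong[OF assms(2), of i] by (simp add: cell_def)
  then have "\<bar>x $ i * real \<beta> ^ l - y $ i * real \<beta> ^ l\<bar> < 1" by linarith
  then have "\<bar>x $ i - y $ i\<bar> * real \<beta> ^ l < 1"
    by (simp add: left_diff_distrib[symmetric] abs_mult)
  then show ?thesis using assms(1) by (simp add: pos_less_divide_eq)
qed

lemma cell_parent:
  assumes "0 < \<beta>"
  shows "cell \<beta> l Y i = cell \<beta> (Suc l) Y i div int \<beta>"
proof -
  have "cell \<beta> l Y i = \<lfloor>(Y $ i * real \<beta> ^ Suc l) / real_of_int (int \<beta>)\<rfloor>" using assms by (simp add: cell_def)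
  also have "\<dots> = \<lfloor>Y $ i * real \<beta> ^ Suc l\<rfloor> div int \<beta>" by (rule floor_divide_real_eq_div) simp
  finally show ?thesis by (simp add: cell_def)
qed

definition subcells :: "nat \<Rightarrow> ('n \<Rightarrow> int) \<Rightarrow> ('n \<Rightarrow> int) set" where
  "subcells \<beta> z = PiE UNIV (\<lambda>i. {z i * int \<beta>..<z i * int \<beta> + int \<beta>})"

lemma subcells_finite_card: "finite (subcells \<beta> (z :: 'n::finite \<Rightarrow> int))" "card (subcells \<beta> z) = \<beta> ^ CARD('n)"
  by (simp_all add: subcells_def card_PiE finite_PiE)

lemma cell_in_subcells:
  assumes "0 < \<beta>"
  shows "cell \<beta> (Suc l) Y \<in> subcells \<beta> (cell \<beta> l Y)"
proof -
  have "cell \<beta> (Suc l) Y i \<in> {cell \<beta> l Y i * int \<beta>..<cell \<beta> l Y i * int \<beta> + int \<beta>}" for i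
  proof -
    let ?a = "cell \<beta> (Suc l) Y i"
    have "?a = ?a div int \<beta> * int \<beta> + ?a mod int \<beta>" by simp
    moreover have "0 \<le> ?a mod int \<beta>" "?a mod int \<beta> < int \<beta>" using assms by simp_all
    ultimately show ?thesis unfolding cell_parent[OF assms, of l Y i] atLeastLessThan_iff by linarith
  qed
  then show ?thesis unfolding subcells_def by (intro PiE_I) auto
qed

text \<open>
  Non-divergence at one point of a grid cube extends to its center, at the cost of halving \<epsilon>. The center
  is needed because the hole must lie inside the cube.
\<close>
lemma short_free_center:
  fixes Y c :: "real ^ 'n"
  assumes N: "0 < N" and sf: "short_free (primal_lattice Y N) \<epsilon>" and \<epsilon>: "0 < \<epsilon>"
    and c: "\<And>i. \<bar>Y $ i - c $ i\<bar> \<le> 1 / N ^ (CARD('n) + 1)"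
  shows "short_free (primal_lattice c N) (\<epsilon> / 2)"
  unfolding short_free_primal[OF N]
proof (intro allI impI)
  fix p q assume pq: "p \<in> int_vecs" "q \<in> \<int>" "\<bar>q\<bar> \<le> \<epsilon> / 2 * N ^ CARD('n)" "\<forall>i. \<bar>p $ i + q * c $ i\<bar> \<le> \<epsilon> / 2 / N"
  have "\<bar>p $ i + q * Y $ i\<bar> \<le> \<epsilon> / N" for i
  proof -
    have "\<bar>q * (Y $ i - c $ i)\<bar> \<le> \<epsilon> / 2 * N ^ CARD('n) * (1 / N ^ (CARD('n) + 1))"
      unfolding abs_mult using pq(3) c \<epsilon> N by (intro mult_mono) auto
    also have "\<dots> = \<epsilon> / 2 / N" using N by simp
    finally have "\<bar>q * (Y $ i - c $ i)\<bar> \<le> \<epsilon> / 2 / N" .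
    moreover have "p $ i + q * Y $ i = (p $ i + q * c $ i) + q * (Y $ i - c $ i)" by (simp add: algebra_simps)
    moreover have "\<epsilon> / 2 / N + \<epsilon> / 2 / N = \<epsilon> / N" by simp
    ultimately show ?thesis using spec[OF pq(4), of i] by linarith
  qed
  moreover have "\<bar>q\<bar> \<le> \<epsilon> * N ^ CARD('n)"
    by (rule order_trans[OF pq(3)]) (use \<epsilon> N in \<open>auto intro!: mult_right_mono\<close>)
  ultimately show "p = 0 \<and> q = 0" using sf pq(1,2) unfolding short_free_primal[OF N] by blast
qed

text \<open>
  The hole around Y' has radius at least the side of the cubes of the next level, so it contains the child to which
  Y' belongs.
\<close>
lemma nondivergent_cell_loses_child:
  fixes E :: "(real ^ 'n) set" and \<epsilon> \<sigma> \<eta> :: real and b \<beta> N0 l :: nat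
  assumes hole: "\<And>(Y :: real ^ 'n) N. (0::nat) < N \<Longrightarrow> short_free (primal_lattice Y N) (\<epsilon> / 2) \<Longrightarrow> has_hole \<sigma> \<eta> N Y"
    and E: "E = improvable_from \<sigma> N0" and \<beta>: "\<beta> = b ^ (CARD('n) + 1)" "0 < b" "1 \<le> \<eta> * \<beta>" and \<epsilon>: "0 < \<epsilon>"
    and l: "N0 \<le> b ^ l" and Y: "short_free (primal_lattice Y (real (b ^ l))) \<epsilon>"
  shows "card (cell \<beta> (Suc l) ` {x \<in> E. cell \<beta> l x = cell \<beta> l Y}) < \<beta> ^ CARD('n)"
proof -
  let ?n = "CARD('n)"
  define N where "N = b ^ l"
  have N: "0 < N" "0 < real N" using \<beta>(2) by (simp_all add: N_def)
  have \<beta>0: "0 < \<beta>" using \<beta> by simp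
  have \<beta>N: "real N ^ (?n + 1) = real \<beta> ^ l"
    by (simp add: \<beta>(1) N_def power_mult[symmetric] mult.commute del: power_Suc)
  have bl: "0 < real \<beta> ^ l" using \<beta>0 by simp
  define c :: "real ^ 'n" where "c = (\<chi> i. (of_int (cell \<beta> l Y i) + 1 / 2) / real \<beta> ^ l)"
  have "\<bar>Y $ i - c $ i\<bar> \<le> 1 / real N ^ (?n + 1)" for i
  proof -
    have "of_int (cell \<beta> l Y i) \<le> Y $ i * real \<beta> ^ l" "Y $ i * real \<beta> ^ l < of_int (cell \<beta> l Y i) + 1"
      unfolding cell_def by linarith+
    then have "\<bar>Y $ i * real \<beta> ^ l - (of_int (cell \<beta> l Y i) + 1 / 2)\<bar> \<le> 1" by (simp add: abs_le_iff)
    moreover have "(Y $ i - c $ i) * real \<beta> ^ l = Y $ i * real \<beta> ^ l - (of_int (cell \<beta> l Y i) + 1 / 2)"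
      using bl by (simp add: c_def field_simps)
    ultimately have "\<bar>(Y $ i - c $ i) * real \<beta> ^ l\<bar> \<le> 1" by simp
    then have "\<bar>Y $ i - c $ i\<bar> * real \<beta> ^ l \<le> 1" using bl by (simp add: abs_mult)
    then show ?thesis unfolding \<beta>N using bl by (simp add: pos_le_divide_eq)
  qed
  from short_free_center[OF N(2) Y[folded N_def] \<epsilon> this]
  have "short_free (primal_lattice c (real N)) (\<epsilon> / 2)" .
  from hole[OF N(1) this] obtain Y' N' where Y': "N \<le> N'" "\<forall>i. \<bar>Y' $ i - c $ i\<bar> \<le> 1 / 4 / real N ^ (?n + 1)"
    "\<forall>Y''. (\<forall>i. \<bar>Y'' $ i - Y' $ i\<bar> \<le> \<eta> / real N ^ (?n + 1)) \<longrightarrow> \<not> dirichlet_solvable \<sigma> N' Y''"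
    unfolding has_hole_def by blast
  have cY': "cell \<beta> l Y' = cell \<beta> l Y"
  proof
    fix i
    have "\<bar>Y' $ i - c $ i\<bar> \<le> 1 / 4 / real \<beta> ^ l" using Y'(2) unfolding \<beta>N by blast
    then have "\<bar>Y' $ i - c $ i\<bar> * real \<beta> ^ l \<le> 1 / 4" using bl by (simp only: pos_le_divide_eq)
    then have "\<bar>(Y' $ i - c $ i) * real \<beta> ^ l\<bar> \<le> 1 / 4" using bl by (simp add: abs_mult)
    moreover have "(Y' $ i - c $ i) * real \<beta> ^ l = Y' $ i * real \<beta> ^ l - (of_int (cell \<beta> l Y i) + 1 / 2)"
      using bl by (simp add: c_def field_simps)
    ultimately have *: "\<bar>Y' $ i * real \<beta> ^ l - (of_int (cell \<beta> l Y i) + 1 / 2)\<bar> \<le> 1 / 4" by simp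
    have "\<bar>Y' $ i * real \<beta> ^ l - (of_int (cell \<beta> l Y i) + 1 / 2)\<bar> < 1 / 2"
      using * by (rule le_less_trans) simp
    then have "\<lfloor>Y' $ i * real \<beta> ^ l\<rfloor> = cell \<beta> l Y i"
      unfolding abs_less_iff by (intro floor_unique) (simp_all add: field_simps)
    then show "cell \<beta> l Y' i = cell \<beta> l Y i" by (simp add: cell_def)
  qed
  define w where "w = cell \<beta> (Suc l) Y'"
  have w: "w \<in> subcells \<beta> (cell \<beta> l Y)" using cell_in_subcells[OF \<beta>0, of l Y'] by (simp add: w_def cY')
  have "cell \<beta> (Suc l) ` {x \<in> E. cell \<beta> l x = cell \<beta> l Y} \<subseteq> subcells \<beta> (cell \<beta> l Y) - {w}"
  proof
    fix u assume "u \<in> cell \<beta> (Suc l) ` {x \<in> E. cell \<beta> l x = cell \<beta> l Y}"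
    then obtain x where x: "u = cell \<beta> (Suc l) x" "x \<in> E" "cell \<beta> l x = cell \<beta> l Y" by blast
    have "u \<noteq> w"
    proof
      assume "u = w"
      then have "cell \<beta> (Suc l) x = cell \<beta> (Suc l) Y'" using x(1) by (simp add: w_def)
      then have "\<bar>x $ i - Y' $ i\<bar> \<le> 1 / real \<beta> ^ Suc l" for i using cell_dist[OF \<beta>0] less_imp_le by blast
      moreover have "1 / real \<beta> ^ Suc l \<le> \<eta> / real \<beta> ^ l"
        using \<beta>(3) \<beta>0 by (simp add: field_simps)
      ultimately have "\<forall>i. \<bar>x $ i - Y' $ i\<bar> \<le> \<eta> / real N ^ (?n + 1)" unfolding \<beta>N by (meson order_trans)
      moreover have "N0 \<le> N'" using Y'(1) l by (simp add: N_def)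
      then have "dirichlet_solvable \<sigma> N' x" using x(2) unfolding E improvable_from_def by blast
      ultimately show False using Y'(3) by blast
    qed
    then show "u \<in> subcells \<beta> (cell \<beta> l Y) - {w}" using cell_in_subcells[OF \<beta>0, of l x] x by auto
  qed
  then have "card (cell \<beta> (Suc l) ` {x \<in> E. cell \<beta> l x = cell \<beta> l Y}) \<le> card (subcells \<beta> (cell \<beta> l Y) - {w})"
    by (intro card_mono) (simp add: subcells_finite_card)
  also have "\<dots> < card (subcells \<beta> (cell \<beta> l Y))"
    by (rule card_Diff1_less[OF subcells_finite_card(1) w])
  finally show ?thesis by (simp add: subcells_finite_card)
qed

text \<open>
  Markov's inequality for the number of bad indices.
\<close>
lemma (in prob_space) prob_half_bad_le:
  fixes Bd :: "nat \<Rightarrow> 'a set" and \<kappa> :: real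
  assumes Bd: "\<And>l. l \<in> L \<Longrightarrow> Bd l \<in> sets M" "\<And>l. l \<in> L \<Longrightarrow> prob (Bd l) \<le> \<kappa>" and L: "finite L" "L \<noteq> {}"
  shows "{x \<in> space M. card L \<le> 2 * card {l \<in> L. x \<in> Bd l}} \<in> sets M"
    "prob {x \<in> space M. card L \<le> 2 * card {l \<in> L. x \<in> Bd l}} \<le> 2 * \<kappa>"
proof -
  define f where "f x = (\<Sum>l\<in>L. indicator (Bd l) x :: real)" for x
  have f: "f x = card {l \<in> L. x \<in> Bd l}" for x
    unfolding f_def using L(1) by (simp add: indicator_def sum.If_cases Int_def)
  have eq: "{x \<in> space M. card L \<le> 2 * card {l \<in> L. x \<in> Bd l}} = {x \<in> space M. card L / 2 \<le> f x}"
    unfolding f by (auto simp: field_simps simp flip: of_nat_mult)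
  have int: "integrable M f" unfolding f_def using Bd(1)
    by (intro Bochner_Integration.integrable_sum integrable_real_indicator) (auto simp: less_top[symmetric])
  have meas: "f \<in> borel_measurable M" using int by simp
  show "{x \<in> space M. card L \<le> 2 * card {l \<in> L. x \<in> Bd l}} \<in> sets M"
    unfolding eq using meas by measurable
  have c0: "0 < card L" using L by (simp add: card_gt_0_iff)
  have "prob {x \<in> space M. card L / 2 \<le> f x} \<le> (\<integral>x. f x \<partial>M) / (card L / 2)"
    by (rule integral_Markov_inequality_measure[OF int sets.empty_sets]) (use c0 in \<open>auto simp: f\<close>)
  also have "(\<integral>x. f x \<partial>M) = (\<Sum>l\<in>L. prob (Bd l))"
    unfolding f_def using Bd(1) by (subst Bochner_Integration.integral_sum) (auto simp: less_top[symmetric])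
  also have "\<dots> \<le> (\<Sum>l\<in>L. \<kappa>)" by (rule sum_mono[OF Bd(2)])
  also have "(\<Sum>l\<in>L. \<kappa>) / (card L / 2) = 2 * \<kappa>" using c0 by simp
  finally show "prob {x \<in> space M. card L \<le> 2 * card {l \<in> L. x \<in> Bd l}} \<le> 2 * \<kappa>"
    unfolding eq using c0 by (simp add: divide_right_mono)
qed

section \<open>Improvable points form a null set\<close>

lemma local_maximal_dimension_iff:
  "local_maximal_dimension \<mu> \<longleftrightarrow> (\<exists>s0>0. \<forall>e>0. \<exists>C>0. ball_decay \<mu> s0 e C)"
  by (simp only: local_maximal_dimension_def ball_decay_def)

text \<open>
  With \<theta> = 1 - 1/B, the counting argument gives a constant times \<theta>^s B^(2s) cubes of side \<beta>^-(N0 + 2s), each of measure at most a constant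
  times B^-(2s) \<beta>^(2se). Here e is chosen such that g = \<beta>^e is the fourth root of 1/\<theta>. Then the total is a constant
  times \<theta>^(s/2).
\<close>
lemma improvable_from_null:
  fixes \<mu> :: "(real ^ 'n) measure" and \<sigma> :: real
  assumes \<mu>: "prob_space \<mu>" "sets \<mu> = sets borel" and lmd: "local_maximal_dimension \<mu>"
    and \<sigma>: "0 < \<sigma>" "\<sigma> < 1"
  shows "measure \<mu> (improvable_from \<sigma> N0) = 0"
proof (rule ccontr)
  let ?n = "CARD('n)"
  interpret prob_space \<mu> by fact
  have sp: "space \<mu> = UNIV" using sets_eq_imp_space_eq[OF \<mu>(2)] by simp
  define E :: "(real ^ 'n) set" where "E = improvable_from \<sigma> N0"
  define m where "m = measure \<mu> E"
  assume "measure \<mu> (improvable_from \<sigma> N0) \<noteq> 0"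
  then have m: "0 < m" unfolding m_def E_def by (simp only: zero_less_measure_iff) simp
  have Em: "E \<in> sets \<mu>" unfolding \<mu>(2) E_def by (rule improvable_from_borel)
  have Ecube: "E \<subseteq> unit_cube" unfolding E_def improvable_from_def by (rule Collect_restrict)
  obtain s0 where "0 < s0 \<and> (\<forall>e>0. \<exists>C>0. ball_decay \<mu> s0 e C)"
    using lmd[unfolded local_maximal_dimension_iff] by (elim exE)
  then have s0: "0 < s0" "\<And>e. 0 < e \<Longrightarrow> \<exists>C>0. ball_decay \<mu> s0 e C" by simp_all
  obtain C1 where C1: "0 < C1" "ball_decay \<mu> s0 (1 / 2) C1" using s0(2)[of "1 / 2"] by auto
  have m4: "0 < m / 4" using m by simp
  obtain \<epsilon> :: real where \<epsilon>: "0 < \<epsilon>"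
    and bad: "\<And>N :: nat. (0::nat) < N \<Longrightarrow> {Y \<in> unit_cube :: (real ^ 'n) set. \<not> short_free (primal_lattice Y N) \<epsilon>} \<in> sets borel"
      "\<And>N :: nat. (0::nat) < N \<Longrightarrow> measure \<mu> {Y \<in> unit_cube :: (real ^ 'n) set. \<not> short_free (primal_lattice Y N) \<epsilon>} \<le> m / 4"
    by (rule nondivergence[OF \<mu> C1(2) less_imp_le[OF C1(1)] s0(1) m4], rule that)
  have \<epsilon>2: "0 < \<epsilon> / 2" using \<epsilon> by simp
  obtain \<eta> :: real where \<eta>: "0 < \<eta>" and
    hole: "\<And>(Y :: real ^ 'n) N. (0::nat) < N \<Longrightarrow> short_free (primal_lattice Y N) (\<epsilon> / 2) \<Longrightarrow> has_hole \<sigma> \<eta> N Y"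
    by (rule hole_exists[OF \<epsilon>2 \<sigma>], rule that)
  \<comment> \<open>Consecutive scales differ so much that a hole at one of them contains a cube of the next.\<close>
  define b where "b = max 2 (nat \<lceil>1 / \<eta>\<rceil>)"
  define \<beta> where "\<beta> = b ^ (?n + 1)"
  have b: "2 \<le> b" by (simp add: b_def)
  have b\<beta>: "b \<le> \<beta>" unfolding \<beta>_def using b by (intro self_le_power) auto
  have \<beta>: "2 \<le> \<beta>" using b b\<beta> by simp
  have \<eta>\<beta>: "1 \<le> \<eta> * \<beta>"
  proof -
    have "1 / \<eta> \<le> real b" unfolding b_def by linarith
    also have "\<dots> \<le> real \<beta>" using b\<beta> by simp
    finally show ?thesis using \<eta> by (simp add: field_simps)
  qed
  define B where "B = \<beta> ^ ?n"
  have "\<beta> \<le> B" unfolding B_def using \<beta> by (intro self_le_power) auto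
  then have B: "2 \<le> B" using \<beta> by simp
  define \<theta> where "\<theta> = real (B - 1) / real B"
  have \<theta>: "0 < \<theta>" "\<theta> < 1" using B by (auto simp: \<theta>_def)
  define g where "g = sqrt (sqrt (1 / \<theta>))"
  have g: "1 < g" using \<theta> by (simp add: g_def)
  have "g\<^sup>2 * \<theta> = sqrt (1 / \<theta>) * \<theta>" using \<theta> by (simp add: g_def)
  also have "\<dots> = sqrt \<theta>" using \<theta> by (simp add: real_sqrt_divide real_div_sqrt)
  also have "\<dots> < 1" using \<theta> by simp
  finally have g\<theta>: "g\<^sup>2 * \<theta> < 1" .
  define e where "e = ln g / ln \<beta>"
  have e: "0 < e" using g \<beta> by (simp add: e_def)
  have \<beta>e: "real \<beta> powr e = g" using g \<beta> by (simp add: powr_def e_def)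
  obtain C where C: "0 < C" "ball_decay \<mu> s0 e C" using s0(2)[OF e] by blast
  define good where "good l x \<longleftrightarrow> card (cell \<beta> (Suc l) ` {y \<in> E. cell \<beta> l y = cell \<beta> l x}) < B" for l and x :: "real ^ 'n"
  have N0_le: "N0 \<le> b ^ l" if "N0 \<le> l" for l
  proof -
    have "l < 2 ^ l" by (rule less_exp)
    also have "(2::nat) ^ l \<le> b ^ l" using b by (intro power_mono) auto
    finally show ?thesis using that by simp
  qed
  define Bd where "Bd l = {Y \<in> unit_cube :: (real ^ 'n) set. \<not> short_free (primal_lattice Y (real (b ^ l))) \<epsilon>}" for l
  have good: "good l x" if "x \<in> E" "x \<notin> Bd l" "N0 \<le> l" for x l
    unfolding good_def B_def
  proof (rule nondivergent_cell_loses_child[OF hole E_def \<beta>_def _ \<eta>\<beta> \<epsilon> N0_le[OF that(3)]])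
    show "short_free (primal_lattice x (real (b ^ l))) \<epsilon>" using that Ecube by (auto simp: Bd_def)
  qed (use b in auto)
  \<comment> \<open>The cubes of level N0 are the roots of the trees of cubes.\<close>
  define M0 where "M0 = card (cell \<beta> N0 ` E)"
  have fin0: "finite (cell \<beta> N0 ` E)"
  proof (rule finite_subset)
    show "cell \<beta> N0 ` E \<subseteq> PiE UNIV (\<lambda>_. {0..int (\<beta> ^ N0)})"
    proof
      fix z assume "z \<in> cell \<beta> N0 ` E"
      then obtain x where x: "x \<in> E" "z = cell \<beta> N0 x" by blast
      have "0 \<le> z i \<and> z i \<le> int (\<beta> ^ N0)" for i
      proof -
        have xi: "0 \<le> x $ i" "x $ i \<le> 1" using x(1) Ecube by (auto simp: unit_cube_def)
        then have "x $ i * real \<beta> ^ N0 \<le> 1 * real \<beta> ^ N0" by (intro mult_right_mono) auto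
        then have "x $ i * real \<beta> ^ N0 \<le> real_of_int (int (\<beta> ^ N0))" by simp
        then have "\<lfloor>x $ i * real \<beta> ^ N0\<rfloor> \<le> int (\<beta> ^ N0)" by linarith
        then show ?thesis using xi by (simp add: x(2) cell_def)
      qed
      then show "z \<in> PiE UNIV (\<lambda>_. {0..int (\<beta> ^ N0)})" by (intro PiE_I) auto
    qed
  qed (simp add: finite_PiE)
  define Z where "Z = real M0 * C * (1 / s0) powr (?n - e) * g ^ N0 / real B ^ N0"
  have main: "m / 2 \<le> Z * (g\<^sup>2 * \<theta>) ^ s" if s: "0 < s" "(1 / 2) ^ s < s0" for s
  proof -
    define L where "L = {N0..<N0 + 2 * s}"
    define K where "K = N0 + 2 * s"
    have L: "finite L" "L \<noteq> {}" "card L = 2 * s" using s by (auto simp: L_def)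
    define Bad where "Bad = {x \<in> space \<mu>. card L \<le> 2 * card {l \<in> L. x \<in> Bd l}}"
    have Bdm: "Bd l \<in> sets \<mu>" "measure \<mu> (Bd l) \<le> m / 4" for l
      using bad[of "b ^ l"] b unfolding Bd_def \<mu>(2) by simp_all
    have Bad: "Bad \<in> sets \<mu>" "measure \<mu> Bad \<le> m / 2"
      using prob_half_bad_le[of L Bd "m / 4"] Bdm L unfolding Bad_def by simp_all
    define G where "G = E - Bad"
    have Gm: "G \<in> sets \<mu>" using Em Bad(1) by (simp add: G_def)
    have "m \<le> measure \<mu> (G \<union> Bad)"
      unfolding m_def by (intro finite_measure_mono sets.Un Gm Bad(1)) (auto simp: G_def)
    also have "\<dots> \<le> measure \<mu> G + measure \<mu> Bad" by (rule measure_Un_le[OF Gm Bad(1)])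
    finally have mG: "m / 2 \<le> measure \<mu> G" using Bad(2) by (simp add: field_simps)
    define S where "S z = {x \<in> E. cell \<beta> N0 x = z \<and> s \<le> card {l \<in> L. good l x}}" for z
    have count: "finite (cell \<beta> K ` S z)" "real (card (cell \<beta> K ` S z)) \<le> real B ^ (2 * s) * \<theta> ^ s" for z
    proof -
      have sub: "cell \<beta> (Suc l) ` {x \<in> E. cell \<beta> l x = z} \<subseteq> subcells \<beta> z" for l z
        using cell_in_subcells[of \<beta> l] \<beta> by auto
      have f: "finite (cell \<beta> (Suc l) ` {x \<in> E. cell \<beta> l x = z})" for l z
        by (rule finite_subset[OF sub subcells_finite_card(1)])
      have c: "card (cell \<beta> (Suc l) ` {x \<in> E. cell \<beta> l x = z}) \<le> B" for l z
        using card_mono[OF subcells_finite_card(1) sub] by (simp add: subcells_finite_card B_def)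
      have "0 < B" using B by simp
      from tree_count[where idx = "cell \<beta>", OF f c this, of N0 "2 * s" z s]
      show "finite (cell \<beta> K ` S z)" "real (card (cell \<beta> K ` S z)) \<le> real B ^ (2 * s) * \<theta> ^ s"
        unfolding S_def K_def L_def good_def \<theta>_def by blast+
    qed
    define W where "W = (\<Union>z\<in>cell \<beta> N0 ` E. cell \<beta> K ` S z)"
    have finW: "finite W" unfolding W_def using fin0 count(1) by blast
    have cardW: "real (card W) \<le> real M0 * (real B ^ (2 * s) * \<theta> ^ s)"
    proof -
      have "card W \<le> (\<Sum>z\<in>cell \<beta> N0 ` E. card (cell \<beta> K ` S z))" unfolding W_def by (rule card_UN_le[OF fin0])
      then have "real (card W) \<le> real (\<Sum>z\<in>cell \<beta> N0 ` E. card (cell \<beta> K ` S z))" by (rule of_nat_mono)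
      also have "\<dots> = (\<Sum>z\<in>cell \<beta> N0 ` E. real (card (cell \<beta> K ` S z)))" by simp
      also have "\<dots> \<le> (\<Sum>z\<in>cell \<beta> N0 ` E. real B ^ (2 * s) * \<theta> ^ s)" by (intro sum_mono count(2))
      finally show ?thesis by (simp add: M0_def)
    qed
    have "\<exists>y. y \<in> E \<and> cell \<beta> K y = u" if "u \<in> W" for u
      using that by (auto simp: W_def S_def)
    then obtain y where y: "\<And>u. u \<in> W \<Longrightarrow> y u \<in> E" "\<And>u. u \<in> W \<Longrightarrow> cell \<beta> K (y u) = u" by metis
    have GW: "G \<subseteq> (\<Union>u\<in>W. sup_ball (y u) (1 / real \<beta> ^ K))"
    proof
      fix x assume x: "x \<in> G"
      then have xE: "x \<in> E" and "x \<notin> Bad" by (auto simp: G_def)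
      then have "2 * card {l \<in> L. x \<in> Bd l} < 2 * s" using L(3) by (simp add: Bad_def sp)
      moreover have "card {l \<in> L. x \<in> Bd l} + card {l \<in> L. x \<notin> Bd l} = card L"
      proof -
        have "{l \<in> L. x \<in> Bd l} \<union> {l \<in> L. x \<notin> Bd l} = L" by auto
        then show ?thesis
          by (subst card_Un_disjoint[symmetric]) (use L(1) in auto)
      qed
      moreover have "card {l \<in> L. x \<notin> Bd l} \<le> card {l \<in> L. good l x}"
        by (rule card_mono) (use L(1) good[OF xE] in \<open>auto simp: L_def\<close>)
      ultimately have "s \<le> card {l \<in> L. good l x}" using L(3) by linarith
      then have "x \<in> S (cell \<beta> N0 x)" using xE by (simp add: S_def)
      then have u: "cell \<beta> K x \<in> W" using xE by (auto simp: W_def)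
      have "x \<in> sup_ball (y (cell \<beta> K x)) (1 / real \<beta> ^ K)"
        unfolding sup_ball_def infnorm_less_iff using cell_dist[of \<beta> K x "y (cell \<beta> K x)"] y(2)[OF u] \<beta> by simp
      then show "x \<in> (\<Union>u\<in>W. sup_ball (y u) (1 / real \<beta> ^ K))" using u by blast
    qed
    define \<delta> where "\<delta> = 1 / (real \<beta> ^ K * s0)"
    have \<beta>K: "0 < real \<beta> ^ K" using \<beta> by simp
    have \<delta>: "0 < \<delta>" "\<delta> < 1" "\<delta> * s0 = 1 / real \<beta> ^ K"
    proof -
      show "0 < \<delta>" "\<delta> * s0 = 1 / real \<beta> ^ K" using s0 \<beta>K by (simp_all add: \<delta>_def)
      have "(2::real) ^ s \<le> 2 ^ K" by (intro power_increasing) (auto simp: K_def)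
      also have "\<dots> \<le> real \<beta> ^ K" using \<beta> by (intro power_mono) auto
      finally have "1 \<le> real \<beta> ^ K * (1 / 2) ^ s" by (simp add: power_one_over field_simps)
      also have "\<dots> < real \<beta> ^ K * s0" using s(2) \<beta>K by simp
      finally show "\<delta> < 1" by (simp add: \<delta>_def)
    qed
    have ball: "measure \<mu> (sup_ball (y u) (1 / real \<beta> ^ K)) \<le> C * \<delta> powr (?n - e)" if "u \<in> W" for u
    proof -
      have "measure \<mu> (sup_ball (y u) (\<delta> * s0)) \<le> C * \<delta> powr (?n - e) * measure \<mu> (sup_ball (y u) s0)"
        using C(2) \<delta>(1,2) s0(1) y(1)[OF that] Ecube unfolding ball_decay_def by blast
      also have "\<dots> \<le> C * \<delta> powr (?n - e) * 1"
        using C(1) by (intro mult_left_mono) auto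
      finally show ?thesis unfolding \<delta>(3) by simp
    qed
    have "measure \<mu> G \<le> measure \<mu> (\<Union>u\<in>W. sup_ball (y u) (1 / real \<beta> ^ K))"
      by (rule finite_measure_mono[OF GW]) (intro sets.finite_UN finW, simp add: \<mu>(2) sup_ball_measurable)
    also have "\<dots> \<le> (\<Sum>u\<in>W. measure \<mu> (sup_ball (y u) (1 / real \<beta> ^ K)))"
      by (rule finite_measure_subadditive_finite[OF finW]) (auto simp: \<mu>(2) sup_ball_measurable)
    also have "\<dots> \<le> (\<Sum>u\<in>W. C * \<delta> powr (?n - e))" by (intro sum_mono ball)
    also have "\<dots> = real (card W) * (C * \<delta> powr (?n - e))" by simp
    also have "\<dots> \<le> real M0 * (real B ^ (2 * s) * \<theta> ^ s) * (C * \<delta> powr (?n - e))"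
      using cardW C(1) by (intro mult_right_mono) auto
    also have "\<delta> powr (?n - e) = (1 / s0) powr (?n - e) * (g ^ K / real B ^ K)"
    proof -
      have "\<delta> = (1 / s0) * (1 / real \<beta> ^ K)" by (simp add: \<delta>_def)
      then have "\<delta> powr (?n - e) = (1 / s0) powr (?n - e) * (1 / real \<beta> ^ K) powr (?n - e)"
        using s0(1) by (simp only: powr_mult)
      also have "(1 / real \<beta> ^ K) powr (?n - e) = (real \<beta> ^ K) powr (e - ?n)"
        using \<beta>K by (simp add: powr_divide powr_minus_divide[symmetric])
      also have "\<dots> = (real \<beta> ^ K) powr e / (real \<beta> ^ K) ^ ?n"
        using \<beta>K by (simp only: powr_diff powr_realpow)
      also have "(real \<beta> ^ K) powr e = g ^ K"
        using \<beta> by (simp add: \<beta>e[symmetric] powr_power powr_powr powr_realpow[symmetric] mult.commute)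
      also have "(real \<beta> ^ K) ^ ?n = real B ^ K" by (simp add: B_def power_mult[symmetric] mult.commute)
      finally show ?thesis .
    qed
    also have "real M0 * (real B ^ (2 * s) * \<theta> ^ s) * (C * ((1 / s0) powr (?n - e) * (g ^ K / real B ^ K)))
      = Z * (g\<^sup>2 * \<theta>) ^ s"
    proof -
      have 1: "g ^ K = g ^ N0 * (g\<^sup>2) ^ s" by (simp add: K_def power_add power_mult)
      have 2: "real B ^ K = real B ^ N0 * real B ^ (2 * s)" by (simp add: K_def power_add)
      have cancel: "M * (B2 * t) * (c * (u * (g0 * g2 / (B0 * B2)))) = M * c * u * g0 / B0 * (g2 * t)"
        if "B2 \<noteq> 0" for M B2 t c u g0 g2 B0 :: real
        using that by simp
      show ?thesis unfolding Z_def 1 2 power_mult_distrib[of "g\<^sup>2" \<theta>]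
        by (rule cancel) (use B in simp)
    qed
    finally show ?thesis using mG by linarith
  qed
  have "(\<lambda>s. Z * (g\<^sup>2 * \<theta>) ^ s) \<longlonglongrightarrow> Z * 0"
    using g \<theta> g\<theta> by (intro tendsto_mult_left LIMSEQ_realpow_zero) auto
  then have "eventually (\<lambda>s. Z * (g\<^sup>2 * \<theta>) ^ s < m / 2) sequentially"
    using m by (intro order_tendstoD(2)[of _ "Z * 0"]) auto
  moreover have "(\<lambda>s. (1 / 2 :: real) ^ s) \<longlonglongrightarrow> 0" by (intro LIMSEQ_realpow_zero) auto
  then have "eventually (\<lambda>s. (1 / 2 :: real) ^ s < s0) sequentially"
    using s0(1) by (rule order_tendstoD(2))
  moreover have "eventually (\<lambda>s. 0 < s) sequentially" by (rule eventually_gt_at_top)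
  ultimately have "eventually (\<lambda>s. False) sequentially"
  proof eventually_elim
    case (elim s)
    then show ?case using main[of s] by linarith
  qed
  then show False by simp
qed

text \<open>
  Solvability is monotone in the constant, so that a sequence of constants tending to 1 suffices.
\<close>
lemma DI_rowvector_improvable_from:
  fixes Y :: "real ^ 'n"
  assumes "(rowvector Y :: real ^ 'n ^ 1) \<in> DI \<sigma>" "\<sigma> \<le> \<tau>" "Y \<in> unit_cube"
  shows "\<exists>N0. Y \<in> improvable_from \<tau> N0"
proof -
  obtain N0 where N0: "\<And>N. N0 \<le> N \<Longrightarrow> \<exists>(q :: real ^ 1) (p :: real ^ 'n).
      (\<forall>i. q $ i \<in> \<int>) \<and> q \<noteq> 0 \<and> (\<forall>j. p $ j \<in> \<int>) \<and>
      infnorm (q v* rowvector Y + p) \<le> \<sigma> / real N ^ CARD(1) \<and> infnorm q \<le> \<sigma> * real N ^ CARD('n)"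
    using assms(1) unfolding DI_def eventually_sequentially mem_Collect_eq by blast
  have "dirichlet_solvable \<tau> N Y" if N: "N0 \<le> N" for N
  proof -
    obtain q :: "real ^ 1" and p :: "real ^ 'n" where pq: "\<forall>i. q $ i \<in> \<int>" "q \<noteq> 0" "\<forall>j. p $ j \<in> \<int>"
      "infnorm (q v* rowvector Y + p) \<le> \<sigma> / real N ^ CARD(1)" "infnorm q \<le> \<sigma> * real N ^ CARD('n)"
      using N0[OF N] by blast
    have qY: "(q v* rowvector Y) $ i = q $ 1 * Y $ i" for i
      by (simp add: vector_matrix_mult_def rowvector_def mult.commute)
    have "\<sigma> * real N ^ CARD('n) \<le> \<tau> * real N ^ CARD('n)" using assms(2) by (intro mult_right_mono) auto
    moreover have "\<bar>q $ 1\<bar> \<le> \<sigma> * real N ^ CARD('n)" using pq(5) unfolding infnorm_le_iff by blast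
    ultimately have "\<bar>q $ 1\<bar> \<le> \<tau> * real N ^ CARD('n)" by linarith
    moreover have "\<bar>p $ i + q $ 1 * Y $ i\<bar> \<le> \<tau> / real N" for i
    proof -
      have "\<bar>p $ i + q $ 1 * Y $ i\<bar> \<le> \<sigma> / real N"
        using pq(4) qY unfolding infnorm_le_iff by (simp add: add.commute)
      also have "\<dots> \<le> \<tau> / real N" using assms(2) by (intro divide_right_mono) auto
      finally show ?thesis .
    qed
    moreover have "q $ 1 \<noteq> 0" using pq(2) by (simp add: vec_eq_iff forall_1)
    ultimately show ?thesis using pq(1,3) by (auto simp: int_vecs_def dirichlet_solvable_def)
  qed
  then show ?thesis using assms(3) unfolding improvable_from_def by blast
qed

theorem theorem1p5:
  fixes \<mu> :: "(real ^ 'n) measure"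
  assumes "prob_space \<mu>"
    and "sets \<mu> = sets borel"
    and "emeasure \<mu> unit_cube = 1"
    and "local_maximal_dimension \<mu>"
    and "federer \<mu>"
  shows "AE Y in \<mu>. \<not> DT_improvable (rowvector Y :: real ^ 'n ^ 1)"
proof -
  interpret prob_space \<mu> by fact
  have "AE Y in \<mu>. Y \<in> unit_cube"
    using assms(2,3) by (intro AE_prob_1) (simp add: emeasure_eq_measure)
  moreover have "AE Y in \<mu>. \<forall>k N0. Y \<notin> improvable_from (1 - 1 / (real k + 2)) N0"
  proof (unfold AE_all_countable, intro allI)
    fix k N0
    have "measure \<mu> (improvable_from (1 - 1 / (real k + 2)) N0) = 0"
      by (rule improvable_from_null[OF assms(1,2,4)]) (auto simp: field_simps)
    then have "improvable_from (1 - 1 / (real k + 2)) N0 \<in> null_sets \<mu>"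
      using improvable_from_borel assms(2) by (auto simp: null_sets_def emeasure_eq_measure)
    then show "AE Y in \<mu>. Y \<notin> improvable_from (1 - 1 / (real k + 2)) N0" by (rule AE_not_in)
  qed
  ultimately show ?thesis
  proof eventually_elim
    case (elim Y)
    show ?case
    proof
      assume "DT_improvable (rowvector Y :: real ^ 'n ^ 1)"
      then obtain \<sigma> where \<sigma>: "0 < \<sigma>" "\<sigma> < 1" "(rowvector Y :: real ^ 'n ^ 1) \<in> DI \<sigma>"
        by (auto simp: DT_improvable_def)
      define k where "k = nat \<lceil>1 / (1 - \<sigma>)\<rceil>"
      have "1 / (1 - \<sigma>) \<le> real k + 2" unfolding k_def by linarith
      then have "\<sigma> \<le> 1 - 1 / (real k + 2)" using \<sigma>(2) by (simp add: field_simps)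
      from DI_rowvector_improvable_from[OF \<sigma>(3) this] elim show False by blast
    qed
  qed
qed

end
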